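(* Let $n,d\ge 1$ and let $A(\lambda,\mu)=\sum_{i=0}^dA_i\lambda^i\mu^{d-i}$, with $A_i\in\mathbb{C}^{n\times n}$, be a matrix polynomial such that the vector space $(A)$ has dimension $n$. Let $W\in\mathbb{C}^{dn\times(d+1)n}$ be any matrix with full row rank such that $$W\begin{bmatrix} A_0 \\ A_1 \\ \vdots \\ A_d \end{bmatrix}=0 .$$ 1. The matrices $$W_0:=W\begin{bmatrix} 0_{n\times dn} \\ I_{dn} \end{bmatrix},\qquad W_1:=W\begin{bmatrix} I_{dn} \\ 0_{n\times dn} \end{bmatrix}$$ represent, using suitable bases of $\mathbb{C}^n_{d-1}[\lambda,\mu]$ and of $\mathbb{C}^n_d[\lambda,\mu]/(A)$ (the same bases for both maps), the quotiented multiplication operators $\bar M_\lambda$ and $\bar M_\mu$ respectively. 2. If $A(\lambda,\mu)$ is nonsingular, then $W(\lambda,\mu):=\mu W_0-\lambda W_1$, and more generally the pencil $\mu\bar M_\lambda-\lambda\bar M_\mu$ obtained by representing $\bar M_\lambda,\bar M_\mu$ as matrices with respect to any choice of bases of $\mathbb{C}^n_{d-1}[\lambda,\mu]$ and $\mathbb{C}^n_d[\lambda,\mu]/(A)$, is a strong linearization of $A(\lambda,\mu)$.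
   Context: For $k\ge 0$, $\mathbb{C}^n_k[\lambda,\mu]:=\{a_k\lambda^k+a_{k-1}\lambda^{k-1}\mu+\dots+a_0\mu^k: a_i\in\mathbb{C}^n\}$ is the space of homogeneous degree-$k$ polynomials in $\lambda,\mu$ with coefficients in $\mathbb{C}^n$. For a matrix polynomial $A(\lambda,\mu)=\sum_{i=0}^dA_i\lambda^i\mu^{d-i}$ define the vector space $$(A):=\{v\in\mathbb{C}^n_d[\lambda,\mu]: v(\lambda,\mu)=A(\lambda,\mu)u\text{ for some }u\in\mathbb{C}^n\}.$$ The quotiented multiplication operators are the linear maps $\bar M_\lambda,\bar M_\mu:\mathbb{C}^n_{d-1}[\lambda,\mu]\to\mathbb{C}^n_d[\lambda,\mu]/(A)$, $\bar M_\lambda(v)=\lambda v+(A)$, $\bar M_\mu(v)=\mu v+(A)$. $A(\lambda,\mu)$ is nonsingular (regular) if $\det A(\lambda,\mu)$ is not identically zero. $A(\lambda,\mu)$ is identified with the one-variable matrix polynomial $A(x)=\sum_{i=0}^dA_ix^i$ (put $\lambda=x,\mu=1$); thus a pencil $\mu L_0-\lambda L_1$ corresponds to $L_0-xL_1$. A pencil $L(x)\in\mathbb{C}^{dn\times dn}[x]$ is a linearization of $A(x)=\sum_{i=0}^dA_ix^i\in\mathbb{C}^{n\times n}[x]$ if there are $E(x),F(x)\in\mathbb{C}^{dn\times dn}[x]$ whose determinants are nonzero constants such that $L(x)=E(x)\,\mathrm{diag}(A(x),I_{(d-1)n})\,F(x)$. With $\mathrm{rev}\sum_{i=0}^dM_ix^i:=\sum_{i=0}^dM_{d-i}x^i$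 (with $d=1$ for pencils), $L(x)$ is a strong linearization of $A(x)$ if $L(x)$ is a linearization of $A(x)$ and $\mathrm{rev}\,L(x)$ is a linearization of $\mathrm{rev}\,A(x)$. *)

theory Defs
  imports Complex_Main "HOL-Algebra.AbelCoset" "Jordan_Normal_Form.DL_Rank"
begin

text \<open>
  Polynomials in the two variables \<open>\<lambda>\<close>, \<open>\<mu>\<close> are elements of \<^typ>\<open>complex poly poly\<close>: the outer
  variable is \<open>\<lambda>\<close>, the inner one is \<open>\<mu>\<close>.
\<close>

abbreviation var_lam :: "complex poly poly" where
  "var_lam \<equiv> [:0, 1:]"

abbreviation var_mu :: "complex poly poly" where
  "var_mu \<equiv> [:[:0, 1:]:]"

abbreviation const2 :: "complex \<Rightarrow> complex poly poly" where
  "const2 c \<equiv> [:[:c:]:]"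

definition hom_poly :: "nat \<Rightarrow> (nat \<Rightarrow> complex) \<Rightarrow> complex poly poly" where
  "hom_poly k a = (\<Sum>i\<le>k. const2 (a i) * var_lam ^ i * var_mu ^ (k - i))"

definition hom_vec :: "nat \<Rightarrow> nat \<Rightarrow> (nat \<Rightarrow> complex vec) \<Rightarrow> complex poly poly vec" where
  "hom_vec n k a = vec n (\<lambda>r. hom_poly k (\<lambda>i. a i $ r))"

definition hom_mat :: "nat \<Rightarrow> nat \<Rightarrow> (nat \<Rightarrow> complex mat) \<Rightarrow> complex poly poly mat" where
  "hom_mat n d A = mat n n (\<lambda>(r, c). hom_poly d (\<lambda>i. A i $$ (r, c)))"

text \<open>
  The space $\mathbb{C}^n_k[\lambda,\mu]$ as a vector space over \<open>\<complex>\<close>. The ring multiplication and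
  unit that the record type demands play no role.
\<close>

definition hom_space :: "nat \<Rightarrow> nat \<Rightarrow> (complex, complex poly poly vec) module" where
  "hom_space n k = \<lparr>
     carrier = {hom_vec n k a | a. \<forall>i\<le>k. a i \<in> carrier_vec n},
     mult = undefined,
     one = undefined,
     zero = 0\<^sub>v n,
     add = (+),
     smult = (\<lambda>c v. const2 c \<cdot>\<^sub>v v)\<rparr>"

definition image_space :: "nat \<Rightarrow> nat \<Rightarrow> (nat \<Rightarrow> complex mat) \<Rightarrow> complex poly poly vec set" where
  "image_space n d A = {v \<in> carrier (hom_space n d).
     \<exists>u \<in> carrier_vec n. v = hom_mat n d A *\<^sub>v map_vec const2 u}"

text \<open>The quotient of a module by a submodule \<open>H\<close>; its elements are the cosets of \<open>H\<close>.\<close>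

definition quotient_module :: "('a, 'b, 'c) module_scheme \<Rightarrow> 'b set \<Rightarrow> ('a, 'b set) module" where
  "quotient_module M H = \<lparr>
     carrier = a_rcosets\<^bsub>M\<^esub> H,
     mult = undefined,
     one = undefined,
     zero = H,
     add = (<+>\<^bsub>M\<^esub>),
     smult = (\<lambda>c X. \<Union>x\<in>X. H +>\<^bsub>M\<^esub> (c \<odot>\<^bsub>M\<^esub> x))\<rparr>"

definition quot_space :: "nat \<Rightarrow> nat \<Rightarrow> (nat \<Rightarrow> complex mat) \<Rightarrow> (complex, complex poly poly vec set) module" where
  "quot_space n d A = quotient_module (hom_space n d) (image_space n d A)"

definition mult_lam :: "nat \<Rightarrow> nat \<Rightarrow> (nat \<Rightarrow> complex mat) \<Rightarrow> complex poly poly vec \<Rightarrow> complex poly poly vec set" where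
  "mult_lam n d A v = image_space n d A +>\<^bsub>hom_space n d\<^esub> (var_lam \<cdot>\<^sub>v v)"

definition mult_mu :: "nat \<Rightarrow> nat \<Rightarrow> (nat \<Rightarrow> complex mat) \<Rightarrow> complex poly poly vec \<Rightarrow> complex poly poly vec set" where
  "mult_mu n d A v = image_space n d A +>\<^bsub>hom_space n d\<^esub> (var_mu \<cdot>\<^sub>v v)"

definition ordered_basis :: "(complex, 'b, 'c) module_scheme \<Rightarrow> 'b list \<Rightarrow> bool" where
  "ordered_basis V bs \<longleftrightarrow> distinct bs \<and> vectorspace.basis class_ring V (set bs)"

text \<open>Column \<open>j\<close> of \<open>M\<close> holds the coordinates of \<open>T (bs ! j)\<close> with respect to \<open>cs\<close>.\<close>

definition represents ::
  "(complex, 'b, 'c) module_scheme \<Rightarrow> 'a list \<Rightarrow> 'b list \<Rightarrow> ('a \<Rightarrow> 'b) \<Rightarrow> complex mat \<Rightarrow> bool" where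
  "represents V bs cs T M \<longleftrightarrow>
     M \<in> carrier_mat (length cs) (length bs) \<and>
     (\<forall>j < length bs. T (bs ! j) = (\<Oplus>\<^bsub>V\<^esub> i \<in> {..<length cs}. M $$ (i, j) \<odot>\<^bsub>V\<^esub> (cs ! i)))"

definition block_column :: "nat \<Rightarrow> nat \<Rightarrow> (nat \<Rightarrow> complex mat) \<Rightarrow> complex mat" where
  "block_column n d A = mat ((d + 1) * n) n (\<lambda>(r, c). A (r div n) $$ (r mod n, c))"

definition pencil :: "complex mat \<Rightarrow> complex mat \<Rightarrow> complex poly poly mat" where
  "pencil L0 L1 = var_mu \<cdot>\<^sub>m map_mat const2 L0 - var_lam \<cdot>\<^sub>m map_mat const2 L1"

text \<open>The one-variable polynomial obtained by putting \<open>\<lambda> = x\<close> and \<open>\<mu> = 1\<close>.\<close>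

definition dehom :: "complex poly poly mat \<Rightarrow> complex poly mat" where
  "dehom = map_mat (map_poly (\<lambda>p. poly p 1))"

definition unimodular :: "nat \<Rightarrow> complex poly mat \<Rightarrow> bool" where
  "unimodular m E \<longleftrightarrow> E \<in> carrier_mat m m \<and> (\<exists>c. c \<noteq> 0 \<and> det E = [:c:])"

definition is_linearization :: "nat \<Rightarrow> nat \<Rightarrow> complex poly mat \<Rightarrow> complex poly mat \<Rightarrow> bool" where
  "is_linearization n d L A \<longleftrightarrow>
     L \<in> carrier_mat (d * n) (d * n) \<and>
     (\<forall>i < d * n. \<forall>j < d * n. degree (L $$ (i, j)) \<le> 1) \<and>
     (\<exists>E F. unimodular (d * n) E \<and> unimodular (d * n) F \<and>
        L = E * diag_block_mat [A, 1\<^sub>m ((d - 1) * n)] * F)"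

text \<open>The reversal depends on the grade \<open>d\<close>, which may exceed the actual degree.\<close>

definition rev_mat :: "nat \<Rightarrow> complex poly mat \<Rightarrow> complex poly mat" where
  "rev_mat d = map_mat (\<lambda>p. \<Sum>i\<le>d. monom (coeff p (d - i)) i)"

definition is_strong_linearization :: "nat \<Rightarrow> nat \<Rightarrow> complex poly mat \<Rightarrow> complex poly mat \<Rightarrow> bool" where
  "is_strong_linearization n d L A \<longleftrightarrow>
     is_linearization n d L A \<and> is_linearization n d (rev_mat 1 L) (rev_mat d A)"

text \<open>
  The spaces above are vector spaces and the quotiented multiplications are linear maps, so the
  notions of \<open>vectorspace\<close> used for them have their usual meaning.
\<close>

lemma abelian_subgroup_submodule:
  assumes H: "submodule R H M"
  shows "abelian_subgroup H M"
proof -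
  interpret sm: submodule R H M by fact
  interpret M: Module.module R M by (rule sm.module)
  have neg: "\<ominus>\<^bsub>M\<^esub> x \<in> H" if "x \<in> H" for x
  proof -
    have xM: "x \<in> carrier M" using that sm.subset by auto
    have "\<ominus>\<^bsub>M\<^esub> x = (\<ominus>\<^bsub>R\<^esub> \<one>\<^bsub>R\<^esub>) \<odot>\<^bsub>M\<^esub> x" using xM by (simp add: M.smult_l_minus)
    moreover have "(\<ominus>\<^bsub>R\<^esub> \<one>\<^bsub>R\<^esub>) \<odot>\<^bsub>M\<^esub> x \<in> H" using that by (intro sm.smult_closed) auto
    ultimately show ?thesis by metis
  qed
  have "additive_subgroup H M"
    using sm.subset neg by (intro additive_subgroup.intro subgroup.intro) (auto simp: a_inv_def)
  then show ?thesis by (intro abelian_subgroupI3 M.abelian_group_axioms)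
qed

lemma quotient_smult_coset:
  assumes H: "submodule R H M" and c: "c \<in> carrier R" and x: "x \<in> carrier M"
  shows "(\<Union>y\<in>H +>\<^bsub>M\<^esub> x. H +>\<^bsub>M\<^esub> (c \<odot>\<^bsub>M\<^esub> y)) = H +>\<^bsub>M\<^esub> (c \<odot>\<^bsub>M\<^esub> x)"
proof -
  interpret sm: submodule R H M by fact
  interpret M: Module.module R M by (rule sm.module)
  interpret as: abelian_subgroup H M by (rule abelian_subgroup_submodule[OF H])
  have *: "H +>\<^bsub>M\<^esub> (c \<odot>\<^bsub>M\<^esub> y) = H +>\<^bsub>M\<^esub> (c \<odot>\<^bsub>M\<^esub> x)" if "y \<in> H +>\<^bsub>M\<^esub> x" for y
  proof -
    obtain h where h: "h \<in> H" "y = h \<oplus>\<^bsub>M\<^esub> x" using \<open>y \<in> _\<close> unfolding a_r_coset_def' by auto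
    have hM: "h \<in> carrier M" using h sm.subset by auto
    have "c \<odot>\<^bsub>M\<^esub> y = c \<odot>\<^bsub>M\<^esub> h \<oplus>\<^bsub>M\<^esub> c \<odot>\<^bsub>M\<^esub> x"
      using h hM c x M.smult_r_distr by auto
    moreover have "c \<odot>\<^bsub>M\<^esub> h \<in> H" using h c by auto
    ultimately have "c \<odot>\<^bsub>M\<^esub> y \<in> H +>\<^bsub>M\<^esub> (c \<odot>\<^bsub>M\<^esub> x)" unfolding a_r_coset_def' by auto
    then show ?thesis using as.a_repr_independence'[of "c \<odot>\<^bsub>M\<^esub> y" "c \<odot>\<^bsub>M\<^esub> x"] c x by auto
  qed
  have "x \<in> H +>\<^bsub>M\<^esub> x" using x by (simp add: as.a_rcos_self)
  moreover have "(\<Union>y\<in>H +>\<^bsub>M\<^esub> x. H +>\<^bsub>M\<^esub> (c \<odot>\<^bsub>M\<^esub> y)) = (\<Union>y\<in>H +>\<^bsub>M\<^esub> x. H +>\<^bsub>M\<^esub> (c \<odot>\<^bsub>M\<^esub> x))"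
    by (intro SUP_cong refl *)
  ultimately show ?thesis by blast
qed

lemma module_quotient_module:
  assumes H: "submodule R H M"
  shows "Module.module R (quotient_module M H)"
proof -
  interpret sm: submodule R H M by fact
  interpret M: Module.module R M by (rule sm.module)
  interpret as: abelian_subgroup H M by (rule abelian_subgroup_submodule[OF H])
  let ?Q = "quotient_module M H"
  have car: "X \<in> carrier ?Q \<longleftrightarrow> (\<exists>x\<in>carrier M. X = H +>\<^bsub>M\<^esub> x)" for X
    by (auto simp: quotient_module_def A_RCOSETS_def')
  have add: "(H +>\<^bsub>M\<^esub> x) \<oplus>\<^bsub>?Q\<^esub> (H +>\<^bsub>M\<^esub> y) = H +>\<^bsub>M\<^esub> (x \<oplus>\<^bsub>M\<^esub> y)"
    if "x \<in> carrier M" "y \<in> carrier M" for x y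
    using that by (simp add: quotient_module_def as.a_rcos_sum)
  have sc: "c \<odot>\<^bsub>?Q\<^esub> (H +>\<^bsub>M\<^esub> x) = H +>\<^bsub>M\<^esub> (c \<odot>\<^bsub>M\<^esub> x)"
    if "c \<in> carrier R" "x \<in> carrier M" for c x
    using quotient_smult_coset[OF H that] by (simp add: quotient_module_def)
  have zero: "\<zero>\<^bsub>?Q\<^esub> = H +>\<^bsub>M\<^esub> \<zero>\<^bsub>M\<^esub>"
    by (simp add: quotient_module_def as.a_subset)
  show ?thesis
  proof (rule moduleI)
    show "cring R" by (rule M.is_cring)
    show "abelian_group ?Q"
    proof (rule abelian_groupI)
      fix X assume "X \<in> carrier ?Q"
      then obtain x where x: "x \<in> carrier M" "X = H +>\<^bsub>M\<^esub> x" unfolding car by blast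
      have "H +>\<^bsub>M\<^esub> (\<ominus>\<^bsub>M\<^esub> x) \<in> carrier ?Q" unfolding car using x by blast
      moreover have "(H +>\<^bsub>M\<^esub> (\<ominus>\<^bsub>M\<^esub> x)) \<oplus>\<^bsub>?Q\<^esub> X = \<zero>\<^bsub>?Q\<^esub>"
        using x by (simp only: add zero M.l_neg M.a_inv_closed)
      ultimately show "\<exists>Y\<in>carrier ?Q. Y \<oplus>\<^bsub>?Q\<^esub> X = \<zero>\<^bsub>?Q\<^esub>" by blast
    next
      fix X Y assume "X \<in> carrier ?Q" "Y \<in> carrier ?Q"
      then obtain x y where "x \<in> carrier M" "X = H +>\<^bsub>M\<^esub> x" "y \<in> carrier M" "Y = H +>\<^bsub>M\<^esub> y"
        unfolding car by blast
      then show "X \<oplus>\<^bsub>?Q\<^esub> Y \<in> carrier ?Q" unfolding car using add M.a_closed by blast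
    next
      show "\<zero>\<^bsub>?Q\<^esub> \<in> carrier ?Q" unfolding car using zero M.zero_closed by blast
    next
      fix X Y Z assume "X \<in> carrier ?Q" "Y \<in> carrier ?Q" "Z \<in> carrier ?Q"
      then obtain x y z where "x \<in> carrier M" "X = H +>\<^bsub>M\<^esub> x" "y \<in> carrier M" "Y = H +>\<^bsub>M\<^esub> y"
        "z \<in> carrier M" "Z = H +>\<^bsub>M\<^esub> z" unfolding car by blast
      then show "X \<oplus>\<^bsub>?Q\<^esub> Y \<oplus>\<^bsub>?Q\<^esub> Z = X \<oplus>\<^bsub>?Q\<^esub> (Y \<oplus>\<^bsub>?Q\<^esub> Z)" by (simp add: add M.a_assoc)
    next
      fix X Y assume "X \<in> carrier ?Q" "Y \<in> carrier ?Q"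
      then obtain x y where "x \<in> carrier M" "X = H +>\<^bsub>M\<^esub> x" "y \<in> carrier M" "Y = H +>\<^bsub>M\<^esub> y"
        unfolding car by blast
      then show "X \<oplus>\<^bsub>?Q\<^esub> Y = Y \<oplus>\<^bsub>?Q\<^esub> X" by (simp add: add M.a_comm)
    next
      fix X assume "X \<in> carrier ?Q"
      then obtain x where "x \<in> carrier M" "X = H +>\<^bsub>M\<^esub> x" unfolding car by blast
      then show "\<zero>\<^bsub>?Q\<^esub> \<oplus>\<^bsub>?Q\<^esub> X = X" by (simp only: zero add M.zero_closed M.l_zero)
    qed
  next
    fix a X assume "a \<in> carrier R" "X \<in> carrier ?Q"
    then show "a \<odot>\<^bsub>?Q\<^esub> X \<in> carrier ?Q" unfolding car using sc M.smult_closed by blast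
  next
    fix a b X assume ab: "a \<in> carrier R" "b \<in> carrier R" and "X \<in> carrier ?Q"
    then obtain x where x: "x \<in> carrier M" "X = H +>\<^bsub>M\<^esub> x" unfolding car by blast
    show "(a \<oplus>\<^bsub>R\<^esub> b) \<odot>\<^bsub>?Q\<^esub> X = a \<odot>\<^bsub>?Q\<^esub> X \<oplus>\<^bsub>?Q\<^esub> b \<odot>\<^bsub>?Q\<^esub> X"
      using ab x by (simp add: sc add M.smult_l_distr)
    show "(a \<otimes>\<^bsub>R\<^esub> b) \<odot>\<^bsub>?Q\<^esub> X = a \<odot>\<^bsub>?Q\<^esub> (b \<odot>\<^bsub>?Q\<^esub> X)"
      using ab x by (simp add: sc M.smult_assoc1)
  next
    fix a X Y assume a: "a \<in> carrier R" and "X \<in> carrier ?Q" "Y \<in> carrier ?Q"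
    then obtain x y where "x \<in> carrier M" "X = H +>\<^bsub>M\<^esub> x" "y \<in> carrier M" "Y = H +>\<^bsub>M\<^esub> y"
      unfolding car by blast
    then show "a \<odot>\<^bsub>?Q\<^esub> (X \<oplus>\<^bsub>?Q\<^esub> Y) = a \<odot>\<^bsub>?Q\<^esub> X \<oplus>\<^bsub>?Q\<^esub> a \<odot>\<^bsub>?Q\<^esub> Y"
      using a by (simp add: sc add M.smult_r_distr)
  next
    fix X assume "X \<in> carrier ?Q"
    then obtain x where "x \<in> carrier M" "X = H +>\<^bsub>M\<^esub> x" unfolding car by blast
    then show "\<one>\<^bsub>R\<^esub> \<odot>\<^bsub>?Q\<^esub> X = X" by (simp add: sc)
  qed
qed

lemma vectorspace_quotient_module:
  assumes "field K" and "submodule K H V"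
  shows "vectorspace K (quotient_module V H)"
  using assms(1) module_quotient_module[OF assms(2)] by (simp add: vectorspace_def)

lemma hom_vec_carrier: "hom_vec n k a \<in> carrier_vec n"
  by (simp add: hom_vec_def)

lemma hom_poly_add: "hom_poly k (\<lambda>i. a i + b i) = hom_poly k a + hom_poly k b"
proof -
  have "const2 (x + y) = const2 x + const2 y" for x y by simp
  then show ?thesis unfolding hom_poly_def by (simp only: sum.distrib distrib_right)
qed

lemma hom_poly_smult: "hom_poly k (\<lambda>i. c * a i) = const2 c * hom_poly k a"
proof -
  have "const2 (x * y) = const2 x * const2 y" for x y by simp
  then show ?thesis unfolding hom_poly_def by (simp only: sum_distrib_left mult.assoc)
qed

lemma hom_poly_cong: "(\<And>i. i \<le> k \<Longrightarrow> a i = b i) \<Longrightarrow> hom_poly k a = hom_poly k b"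
  unfolding hom_poly_def by (rule sum.cong) auto

lemma hom_vec_add:
  assumes "\<forall>i\<le>k. a i \<in> carrier_vec n" "\<forall>i\<le>k. b i \<in> carrier_vec n"
  shows "hom_vec n k a + hom_vec n k b = hom_vec n k (\<lambda>i. a i + b i)"
proof (intro eq_vecI)
  fix r assume "r < dim_vec (hom_vec n k (\<lambda>i. a i + b i))"
  then have r: "r < n" by (simp add: hom_vec_def)
  have "hom_poly k (\<lambda>i. (a i + b i) $ r) = hom_poly k (\<lambda>i. a i $ r + b i $ r)"
    using assms r by (intro hom_poly_cong) auto
  then show "(hom_vec n k a + hom_vec n k b) $ r = hom_vec n k (\<lambda>i. a i + b i) $ r"
    using r by (simp add: hom_vec_def hom_poly_add)
qed (simp add: hom_vec_def)

lemma hom_vec_smult: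
  assumes "\<forall>i\<le>k. a i \<in> carrier_vec n"
  shows "const2 c \<cdot>\<^sub>v hom_vec n k a = hom_vec n k (\<lambda>i. c \<cdot>\<^sub>v a i)"
proof (intro eq_vecI)
  fix r assume "r < dim_vec (hom_vec n k (\<lambda>i. c \<cdot>\<^sub>v a i))"
  then have r: "r < n" by (simp add: hom_vec_def)
  have "hom_poly k (\<lambda>i. (c \<cdot>\<^sub>v a i) $ r) = hom_poly k (\<lambda>i. c * a i $ r)"
    using assms r by (intro hom_poly_cong) auto
  then show "(const2 c \<cdot>\<^sub>v hom_vec n k a) $ r = hom_vec n k (\<lambda>i. c \<cdot>\<^sub>v a i) $ r"
    using r hom_poly_smult[of k c] by (simp add: hom_vec_def)
qed (simp add: hom_vec_def)

lemma hom_vec_zero: "hom_vec n k (\<lambda>i. 0\<^sub>v n) = 0\<^sub>v n"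
  by (intro eq_vecI) (auto simp: hom_vec_def hom_poly_def)

lemma hom_space_carrierE:
  assumes "v \<in> carrier (hom_space n k)"
  obtains a where "v = hom_vec n k a" "\<forall>i\<le>k. a i \<in> carrier_vec n"
proof -
  have "\<exists>a. v = hom_vec n k a \<and> (\<forall>i\<le>k. a i \<in> carrier_vec n)"
    using assms by (simp add: hom_space_def)
  then show thesis using that by blast
qed

lemma vectorspace_hom_space: "vectorspace class_ring (hom_space n k)"
proof -
  have sub: "v \<in> carrier_vec n" if "v \<in> carrier (hom_space n k)" for v
    using that by (auto simp: hom_space_def hom_vec_carrier)
  have sm: "const2 c \<cdot>\<^sub>v v \<in> carrier (hom_space n k)" if v: "v \<in> carrier (hom_space n k)" for c v
  proof -
    obtain a where "v = hom_vec n k a" "\<forall>i\<le>k. a i \<in> carrier_vec n"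
      using hom_space_carrierE[OF v] by blast
    then show ?thesis
      by (auto simp: hom_space_def hom_vec_smult intro!: exI[of _ "\<lambda>i. c \<cdot>\<^sub>v a i"])
  qed
  have add: "v + w \<in> carrier (hom_space n k)"
    if v: "v \<in> carrier (hom_space n k)" and w: "w \<in> carrier (hom_space n k)" for v w
  proof -
    obtain a b where "v = hom_vec n k a" "\<forall>i\<le>k. a i \<in> carrier_vec n"
      "w = hom_vec n k b" "\<forall>i\<le>k. b i \<in> carrier_vec n"
      using hom_space_carrierE[OF v] hom_space_carrierE[OF w] by metis
    then show ?thesis
      by (auto simp: hom_space_def hom_vec_add intro!: exI[of _ "\<lambda>i. a i + b i"])
  qed
  have zero: "0\<^sub>v n \<in> carrier (hom_space n k)"
    by (auto simp: hom_space_def hom_vec_zero intro!: exI[of _ "\<lambda>i. 0\<^sub>v n"])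
  have z: "\<zero>\<^bsub>hom_space n k\<^esub> = 0\<^sub>v n" and p: "(\<oplus>\<^bsub>hom_space n k\<^esub>) = (+)"
    and s: "(\<odot>\<^bsub>hom_space n k\<^esub>) = (\<lambda>c v. const2 c \<cdot>\<^sub>v v)" by (simp_all add: hom_space_def)
  have "Module.module class_ring (hom_space n k)"
  proof (rule moduleI)
    show "cring (class_ring :: complex ring)" by (rule domain.axioms(1)[OF field.axioms(1)[OF class_field]])
    show "abelian_group (hom_space n k)"
    proof (rule abelian_groupI)
      fix v assume v: "v \<in> carrier (hom_space n k)"
      have m: "const2 (- 1) = - 1" by (simp add: one_pCons)
      have "- 1 \<cdot>\<^sub>v v + v = 0\<^sub>v n" using sub[OF v] by (intro eq_vecI) auto
      then show "\<exists>w\<in>carrier (hom_space n k). w \<oplus>\<^bsub>hom_space n k\<^esub> v = \<zero>\<^bsub>hom_space n k\<^esub>"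
        using sm[OF v, of "- 1"] unfolding m p z by blast
    next
      fix u v w assume "u \<in> carrier (hom_space n k)" "v \<in> carrier (hom_space n k)" "w \<in> carrier (hom_space n k)"
      then show "u \<oplus>\<^bsub>hom_space n k\<^esub> v \<oplus>\<^bsub>hom_space n k\<^esub> w = u \<oplus>\<^bsub>hom_space n k\<^esub> (v \<oplus>\<^bsub>hom_space n k\<^esub> w)"
        unfolding p using assoc_add_vec sub by blast
    next
      fix u v assume "u \<in> carrier (hom_space n k)" "v \<in> carrier (hom_space n k)"
      then show "u \<oplus>\<^bsub>hom_space n k\<^esub> v = v \<oplus>\<^bsub>hom_space n k\<^esub> u"
        unfolding p using comm_add_vec sub by blast
    next
      fix u assume "u \<in> carrier (hom_space n k)"
      then show "\<zero>\<^bsub>hom_space n k\<^esub> \<oplus>\<^bsub>hom_space n k\<^esub> u = u"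
        unfolding p z using left_zero_vec sub by blast
    qed (auto simp: p z zero add)
  next
    fix a b :: complex and v assume v: "v \<in> carrier (hom_space n k)"
    have "const2 (a + b) = const2 a + const2 b" by simp
    then show "(a \<oplus>\<^bsub>class_ring\<^esub> b) \<odot>\<^bsub>hom_space n k\<^esub> v = a \<odot>\<^bsub>hom_space n k\<^esub> v \<oplus>\<^bsub>hom_space n k\<^esub> b \<odot>\<^bsub>hom_space n k\<^esub> v"
      using add_smult_distrib_vec[of "const2 a" "const2 b" v] unfolding p s by simp
    have "const2 (a * b) = const2 a * const2 b" by simp
    then show "(a \<otimes>\<^bsub>class_ring\<^esub> b) \<odot>\<^bsub>hom_space n k\<^esub> v = a \<odot>\<^bsub>hom_space n k\<^esub> (b \<odot>\<^bsub>hom_space n k\<^esub> v)"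
      using smult_smult_assoc[of "const2 a" "const2 b" v] unfolding s by simp
  next
    fix a :: complex and v w assume "v \<in> carrier (hom_space n k)" "w \<in> carrier (hom_space n k)"
    then show "a \<odot>\<^bsub>hom_space n k\<^esub> (v \<oplus>\<^bsub>hom_space n k\<^esub> w) = a \<odot>\<^bsub>hom_space n k\<^esub> v \<oplus>\<^bsub>hom_space n k\<^esub> a \<odot>\<^bsub>hom_space n k\<^esub> w"
      unfolding p s using smult_add_distrib_vec sub by blast
  next
    fix v assume "v \<in> carrier (hom_space n k)"
    then show "\<one>\<^bsub>class_ring\<^esub> \<odot>\<^bsub>hom_space n k\<^esub> v = v"
      unfolding s by (simp flip: one_pCons)
  qed (simp only: s sm)
  then show ?thesis using class_field by (simp add: vectorspace_def)
qed

lemma hom_mat_mult_vec: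
  assumes "\<forall>i\<le>d. A i \<in> carrier_mat n n" "u \<in> carrier_vec n"
  shows "hom_mat n d A *\<^sub>v map_vec const2 u = hom_vec n d (\<lambda>i. A i *\<^sub>v u)"
proof (intro eq_vecI)
  fix r assume "r < dim_vec (hom_vec n d (\<lambda>i. A i *\<^sub>v u))"
  then have r: "r < n" by (simp add: hom_vec_def)
  have c: "const2 (\<Sum>j<n. f j) = (\<Sum>j<n. const2 (f j))" for f :: "nat \<Rightarrow> complex"
  proof (induction n)
    case (Suc n)
    have "const2 (x + y) = const2 x + const2 y" for x y by simp
    then show ?case using Suc by (simp only: sum.lessThan_Suc)
  qed simp
  have "(hom_mat n d A *\<^sub>v map_vec const2 u) $ r
      = (\<Sum>j<n. const2 (u $ j) * hom_poly d (\<lambda>i. A i $$ (r, j)))"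
    using r assms by (auto simp: hom_mat_def scalar_prod_def mult.commute lessThan_atLeast0 intro!: sum.cong)
  also have "\<dots> = (\<Sum>j<n. hom_poly d (\<lambda>i. u $ j * A i $$ (r, j)))"
    by (simp only: hom_poly_smult)
  also have "\<dots> = hom_poly d (\<lambda>i. \<Sum>j<n. u $ j * A i $$ (r, j))"
    unfolding hom_poly_def c sum_distrib_right by (rule sum.swap)
  also have "\<dots> = hom_poly d (\<lambda>i. (A i *\<^sub>v u) $ r)"
    using r assms
    by (intro hom_poly_cong) (auto simp: scalar_prod_def mult.commute lessThan_atLeast0 intro!: sum.cong)
  finally show "(hom_mat n d A *\<^sub>v map_vec const2 u) $ r = hom_vec n d (\<lambda>i. A i *\<^sub>v u) $ r"
    using r by (simp add: hom_vec_def)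
qed (simp add: hom_vec_def hom_mat_def)

lemma image_space_eq:
  assumes "\<forall>i\<le>d. A i \<in> carrier_mat n n"
  shows "image_space n d A = {hom_vec n d (\<lambda>i. A i *\<^sub>v u) | u. u \<in> carrier_vec n}"
proof -
  have "hom_vec n d (\<lambda>i. A i *\<^sub>v u) \<in> carrier (hom_space n d)" if "u \<in> carrier_vec n" for u
  proof -
    have "\<forall>i\<le>d. A i *\<^sub>v u \<in> carrier_vec n" using assms that by auto
    then show ?thesis unfolding hom_space_def by auto
  qed
  then show ?thesis unfolding image_space_def using hom_mat_mult_vec[OF assms] by auto
qed

lemma submodule_image_space:
  assumes A: "\<forall>i\<le>d. A i \<in> carrier_mat n n"
  shows "submodule class_ring (image_space n d A) (hom_space n d)"
proof -
  have c: "hom_vec n d a = hom_vec n d b" if "\<forall>i\<le>d. a i = b i" for a b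
    using that by (auto simp: hom_vec_def intro!: eq_vecI hom_poly_cong)
  have z: "\<zero>\<^bsub>hom_space n d\<^esub> = 0\<^sub>v n" and p: "(\<oplus>\<^bsub>hom_space n d\<^esub>) = (+)"
    and s: "(\<odot>\<^bsub>hom_space n d\<^esub>) = (\<lambda>c v. const2 c \<cdot>\<^sub>v v)" by (simp_all add: hom_space_def)
  show ?thesis
  proof (rule submodule.intro)
    show "Module.module class_ring (hom_space n d)"
      using vectorspace_hom_space by (rule vectorspace.axioms)
    show "image_space n d A \<subseteq> carrier (hom_space n d)" by (auto simp: image_space_def)
    fix v w assume "v \<in> image_space n d A" "w \<in> image_space n d A"
    then obtain x y where x: "x \<in> carrier_vec n" "v = hom_vec n d (\<lambda>i. A i *\<^sub>v x)"
      and y: "y \<in> carrier_vec n" "w = hom_vec n d (\<lambda>i. A i *\<^sub>v y)"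
      using image_space_eq[OF A] by auto
    have "v + w = hom_vec n d (\<lambda>i. A i *\<^sub>v x + A i *\<^sub>v y)"
      unfolding x y by (rule hom_vec_add) (use A x y in auto)
    also have "\<dots> = hom_vec n d (\<lambda>i. A i *\<^sub>v (x + y))"
      by (rule c) (use A x y in \<open>auto simp: mult_add_distrib_mat_vec\<close>)
    finally show "v \<oplus>\<^bsub>hom_space n d\<^esub> w \<in> image_space n d A"
      unfolding p image_space_eq[OF A] using x y by auto
  next
    have "hom_vec n d (\<lambda>i. A i *\<^sub>v 0\<^sub>v n) = 0\<^sub>v n"
      unfolding hom_vec_zero[of n d, symmetric] by (rule c) (use A in \<open>auto intro!: eq_vecI simp: scalar_prod_def\<close>)
    then show "\<zero>\<^bsub>hom_space n d\<^esub> \<in> image_space n d A"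
      unfolding z image_space_eq[OF A] mem_Collect_eq by (intro exI[of _ "0\<^sub>v n"]) simp
  next
    fix k v assume "v \<in> image_space n d A"
    then obtain x where x: "x \<in> carrier_vec n" "v = hom_vec n d (\<lambda>i. A i *\<^sub>v x)"
      using image_space_eq[OF A] by auto
    have "const2 k \<cdot>\<^sub>v v = hom_vec n d (\<lambda>i. k \<cdot>\<^sub>v (A i *\<^sub>v x))"
      unfolding x by (rule hom_vec_smult) (use A x in auto)
    also have "\<dots> = hom_vec n d (\<lambda>i. A i *\<^sub>v (k \<cdot>\<^sub>v x))"
      by (rule c) (use A x in \<open>auto simp: mult_mat_vec\<close>)
    finally show "k \<odot>\<^bsub>hom_space n d\<^esub> v \<in> image_space n d A"
      unfolding s image_space_eq[OF A] using x by auto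
  qed
qed

lemma vectorspace_quot_space:
  assumes "\<forall>i\<le>d. A i \<in> carrier_mat n n"
  shows "vectorspace class_ring (quot_space n d A)"
  unfolding quot_space_def
  by (rule vectorspace_quotient_module[OF class_field submodule_image_space[OF assms]])

lemma var_lam_hom_poly:
  "var_lam * hom_poly k a = hom_poly (Suc k) (\<lambda>i. case i of 0 \<Rightarrow> 0 | Suc j \<Rightarrow> a j)"
  unfolding hom_poly_def sum.atMost_Suc_shift sum_distrib_left
  by (simp only: nat.case diff_Suc_Suc power_Suc) (simp add: mult_ac)

lemma var_mu_hom_poly:
  "var_mu * hom_poly k a = hom_poly (Suc k) (\<lambda>i. if i \<le> k then a i else 0)"
proof -
  have "var_mu * (const2 (a i) * var_lam ^ i * var_mu ^ (k - i))
      = const2 (if i \<le> k then a i else 0) * var_lam ^ i * var_mu ^ (Suc k - i)" if "i \<le> k" for i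
    unfolding Suc_diff_le[OF that] power_Suc using that by (simp only: if_True mult_ac)
  then have "(\<Sum>i\<le>k. var_mu * (const2 (a i) * var_lam ^ i * var_mu ^ (k - i)))
      = (\<Sum>i\<le>k. const2 (if i \<le> k then a i else 0) * var_lam ^ i * var_mu ^ (Suc k - i))"
    by (intro sum.cong) auto
  then show ?thesis unfolding hom_poly_def sum_distrib_left sum.atMost_Suc by simp
qed

lemma var_smult_hom_space:
  assumes v: "v \<in> carrier (hom_space n k)"
  shows "var_lam \<cdot>\<^sub>v v \<in> carrier (hom_space n (Suc k))"
    and "var_mu \<cdot>\<^sub>v v \<in> carrier (hom_space n (Suc k))"
proof -
  obtain a where a: "v = hom_vec n k a" "\<forall>i\<le>k. a i \<in> carrier_vec n"
    using hom_space_carrierE[OF v] by blast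
  let ?b = "\<lambda>i. case i of 0 \<Rightarrow> 0\<^sub>v n | Suc j \<Rightarrow> a j" and ?c = "\<lambda>i. if i \<le> k then a i else 0\<^sub>v n"
  have "var_lam \<cdot>\<^sub>v v = hom_vec n (Suc k) ?b"
  proof (intro eq_vecI)
    fix r assume "r < dim_vec (hom_vec n (Suc k) ?b)"
    then have r: "r < n" by (simp add: hom_vec_def)
    have "var_lam * hom_poly k (\<lambda>i. a i $ r) = hom_poly (Suc k) (\<lambda>i. ?b i $ r)"
      unfolding var_lam_hom_poly using r by (intro hom_poly_cong) (auto split: nat.split)
    then show "(var_lam \<cdot>\<^sub>v v) $ r = hom_vec n (Suc k) ?b $ r"
      using r by (simp add: a hom_vec_def)
  qed (simp add: a hom_vec_def)
  moreover have "\<forall>i\<le>Suc k. ?b i \<in> carrier_vec n" using a by (auto split: nat.split)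
  ultimately show "var_lam \<cdot>\<^sub>v v \<in> carrier (hom_space n (Suc k))"
    unfolding hom_space_def by auto
  have "var_mu \<cdot>\<^sub>v v = hom_vec n (Suc k) ?c"
  proof (intro eq_vecI)
    fix r assume "r < dim_vec (hom_vec n (Suc k) ?c)"
    then have r: "r < n" by (simp add: hom_vec_def)
    have "var_mu * hom_poly k (\<lambda>i. a i $ r) = hom_poly (Suc k) (\<lambda>i. ?c i $ r)"
      unfolding var_mu_hom_poly using r by (intro hom_poly_cong) auto
    then show "(var_mu \<cdot>\<^sub>v v) $ r = hom_vec n (Suc k) ?c $ r"
      using r by (simp add: a hom_vec_def)
  qed (simp add: a hom_vec_def)
  moreover have "\<forall>i\<le>Suc k. ?c i \<in> carrier_vec n" using a by auto
  ultimately show "var_mu \<cdot>\<^sub>v v \<in> carrier (hom_space n (Suc k))"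
    unfolding hom_space_def by auto
qed

lemma quotient_map_hom:
  assumes H: "submodule R H M"
  shows "(\<lambda>x. H +>\<^bsub>M\<^esub> x) \<in> LinearCombinations.module_hom R M (quotient_module M H)"
proof -
  interpret as: abelian_subgroup H M by (rule abelian_subgroup_submodule[OF H])
  show ?thesis
    using quotient_smult_coset[OF H] unfolding LinearCombinations.module_hom_def quotient_module_def
    by (simp add: as.a_rcos_sum A_RCOSETS_def') blast
qed

lemma mult_maps_linear:
  assumes A: "\<forall>i\<le>d. A i \<in> carrier_mat n n" and d: "d \<ge> 1"
  shows "mult_lam n d A \<in> LinearCombinations.module_hom class_ring (hom_space n (d - 1)) (quot_space n d A)"
    and "mult_mu n d A \<in> LinearCombinations.module_hom class_ring (hom_space n (d - 1)) (quot_space n d A)"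
proof -
  obtain k where k: "d = Suc k" using d by (cases d) auto
  let ?q = "\<lambda>x. image_space n d A +>\<^bsub>hom_space n d\<^esub> x"
  have q: "?q \<in> LinearCombinations.module_hom class_ring (hom_space n d) (quot_space n d A)"
    unfolding quot_space_def by (rule quotient_map_hom[OF submodule_image_space[OF A]])
  have p: "(\<oplus>\<^bsub>hom_space n l\<^esub>) = (+)"
    and s: "(\<odot>\<^bsub>hom_space n l\<^esub>) = (\<lambda>c v. const2 c \<cdot>\<^sub>v v)" for l by (simp_all add: hom_space_def)
  have *: "(\<lambda>v. ?q (t \<cdot>\<^sub>v v)) \<in> LinearCombinations.module_hom class_ring (hom_space n (d - 1)) (quot_space n d A)"
    if t: "\<And>v. v \<in> carrier (hom_space n k) \<Longrightarrow> t \<cdot>\<^sub>v v \<in> carrier (hom_space n (Suc k))" for t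
  proof -
    have dist: "t \<cdot>\<^sub>v (v + w) = t \<cdot>\<^sub>v v + t \<cdot>\<^sub>v w"
      if "v \<in> carrier (hom_space n k)" "w \<in> carrier (hom_space n k)" for v w
      using that by (auto elim!: hom_space_carrierE intro!: smult_add_distrib_vec hom_vec_carrier)
    have comm: "t \<cdot>\<^sub>v (const2 c \<cdot>\<^sub>v v) = const2 c \<cdot>\<^sub>v (t \<cdot>\<^sub>v v)" for c v
      by (simp only: smult_smult_assoc mult.commute)
    show ?thesis
      unfolding LinearCombinations.module_hom_def mem_Collect_eq
    proof (intro conjI allI impI)
      show "(\<lambda>v. ?q (t \<cdot>\<^sub>v v)) \<in> carrier (hom_space n (d - 1)) \<rightarrow> carrier (quot_space n d A)"
        using t LinearCombinations.module_hom_closed[OF q] k by auto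
    next
      fix v w assume "v \<in> carrier (hom_space n (d - 1)) \<and> w \<in> carrier (hom_space n (d - 1))"
      then have vw: "v \<in> carrier (hom_space n k)" "w \<in> carrier (hom_space n k)" using k by auto
      show "?q (t \<cdot>\<^sub>v (v \<oplus>\<^bsub>hom_space n (d - 1)\<^esub> w)) = ?q (t \<cdot>\<^sub>v v) \<oplus>\<^bsub>quot_space n d A\<^esub> ?q (t \<cdot>\<^sub>v w)"
        using LinearCombinations.module_hom_add[OF q, unfolded p] t[OF vw(1)] t[OF vw(2)] dist[OF vw] k by (simp add: p)
    next
      fix c :: complex and v assume "c \<in> carrier class_ring \<and> v \<in> carrier (hom_space n (d - 1))"
      then have v: "v \<in> carrier (hom_space n k)" using k by auto
      show "?q (t \<cdot>\<^sub>v (c \<odot>\<^bsub>hom_space n (d - 1)\<^esub> v)) = c \<odot>\<^bsub>quot_space n d A\<^esub> ?q (t \<cdot>\<^sub>v v)"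
        using LinearCombinations.module_hom_smult[OF q, unfolded s, of c "t \<cdot>\<^sub>v v"] t[OF v] k unfolding s comm by simp
    qed
  qed
  show "mult_lam n d A \<in> LinearCombinations.module_hom class_ring (hom_space n (d - 1)) (quot_space n d A)"
    unfolding mult_lam_def[abs_def] by (rule *[OF var_smult_hom_space(1)])
  show "mult_mu n d A \<in> LinearCombinations.module_hom class_ring (hom_space n (d - 1)) (quot_space n d A)"
    unfolding mult_mu_def[abs_def] by (rule *[OF var_smult_hom_space(2)])
qed

end

theory Submission
  imports Defs
begin

text \<open>
  Write \<open>x = \<lambda>/\<mu>\<close>, let \<open>X\<close> be the stacked column of the \<open>A\<^sub>i\<close>, and let \<open>W = [w\<^sub>0, \<dots>, w\<^sub>d]\<close> be cut into
  blocks of \<open>n\<close> columns, so that the pencil of the theorem has the blocks \<open>w\<^sub>j\<^sub>+\<^sub>1 - x w\<^sub>j\<close>.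

  \<^bold>\<open>The operators.\<close> In the monomial basis, a homogeneous polynomial vector of degree \<open>d\<close> is a vector of
  length \<open>(d + 1) n\<close>, the space \<open>(A)\<close> is the column space of \<open>X\<close>, and multiplication by \<open>\<lambda>\<close> or \<open>\<mu>\<close>
  moves the blocks of a vector of length \<open>d n\<close> to the last or to the first \<open>d\<close> places. The dimension
  hypothesis says that \<open>X\<close> is injective. As \<open>W\<close> has full row rank and \<open>W X = 0\<close>, counting dimensions
  shows that the kernel of \<open>W\<close> is exactly the column space of \<open>X\<close> (\<open>kernel_eq_column_space\<close>). Hence
  \<open>W\<close> induces an isomorphism from the quotient to \<open>\<complex>\<^sup>d\<^sup>n\<close>, under which multiplication by \<open>\<lambda>\<close> and
  \<open>\<mu>\<close> becomes multiplication by \<open>W\<^sub>0\<close> and \<open>W\<^sub>1\<close> (\<open>quotient_coordinates\<close>). Any other choice of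
  bases multiplies both matrices by the same invertible matrices on the left and on the right, and that
  does not affect whether a pencil is a strong linearization.

  \<^bold>\<open>The linearization.\<close> If \<open>det A\<close> is not zero, there is a number \<open>c\<close>, which may be chosen nonzero, with
  \<open>H = A(c)\<close> invertible. Let \<open>G\<close> be the value of the pencil at \<open>c\<close>. Two telescoping identities
  hold for the blocks \<open>V\<^sub>j\<^sub>+\<^sub>1 - c V\<^sub>j\<close> of any \<open>V = [V\<^sub>0, \<dots>, V\<^sub>d]\<close>: one factors out a unitriangular matrix
  \<open>R(x)\<close> (\<open>shift_pencil_mult_base\<close>), the other is division of \<open>A(x)\<close> by \<open>x - c\<close> with quotient
  coefficients \<open>B\<close> (\<open>shift_pencil_mult_horner\<close>). Applied to \<open>W\<close> and to \<open>[I, x I, \<dots>, x\<^sup>d I]\<close> they give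
  \<open>w\<^sub>0 = - G B H\<^sup>-\<^sup>1\<close>, the invertibility of \<open>G\<close>, and, with \<open>\<Lambda> = [I, x I, \<dots>, x\<^sup>d\<^sup>-\<^sup>1 I]\<close> and
  \<open>P = (x - c) B H\<^sup>-\<^sup>1\<close>, the factorization \<open>G (I + P \<Lambda>) R\<close> of the pencil, together with
  \<open>(I + \<Lambda> P) H = A(x)\<close>. Because \<open>\<Lambda>\<close> begins with an identity block, \<open>I + P \<Lambda>\<close> is unimodularly equivalent
  to the block diagonal matrix of \<open>A(x)\<close> and an identity, as in Sylvester's determinant identity
  (\<open>rank_update_equivalent_diag\<close>). So no canonical form of matrix polynomials enters.

  \<^bold>\<open>Reversal.\<close> Reversing the order of the blocks of \<open>W\<close> gives an annihilator of the coefficients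
  of the reversed polynomial, which is invertible at \<open>1/c\<close>; the pencil of this annihilator is the
  reversed pencil up to sign and an order of columns. So the same argument applies, and the linearization
  is strong.
\<close>


section \<open>Sums over indices in blocks\<close>

lemma sum_blocks: "(\<Sum>s<d * n. f s) = (\<Sum>j<d. \<Sum>k<n. f (j * n + k))" for f :: "nat \<Rightarrow> 'a::comm_monoid_add"
proof -
  have "(\<Sum>k<n. f (j * n + k)) = sum f {j * n..<j * n + n}" for j
    using sum.shift_bounds_nat_ivl[of f 0 "j * n" n] by (simp add: atLeast0LessThan add.commute)
  then show ?thesis by (simp add: sum.nat_group)
qed

lemma sum_residue_class:
  fixes f :: "nat \<Rightarrow> 'a::comm_monoid_add"
  assumes "k < n"
  shows "(\<Sum>s<d * n. if s mod n = k then f s else 0) = (\<Sum>j<d. f (j * n + k))"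
  unfolding sum_blocks by (rule sum.cong) (use assms in \<open>auto simp: if_distrib sum.delta cong: if_cong\<close>)

lemma mult_mat_entry:
  assumes "A \<in> carrier_mat p q" "B \<in> carrier_mat q r" "i < p" "j < r"
  shows "(A * B) $$ (i, j) = (\<Sum>k<q. A $$ (i, k) * B $$ (k, j))"
  using assms by (auto simp: scalar_prod_def lessThan_atLeast0)

section \<open>Shifted differences of blocks\<close>

text \<open>
  For \<open>V = [V\<^sub>0, \<dots>, V\<^sub>d]\<close> with blocks of \<open>n\<close> columns, the blocks of this matrix are \<open>V\<^sub>j\<^sub>+\<^sub>1 - t V\<^sub>j\<close>. With
  \<open>t = x\<close> and \<open>V = W\<close> it is the pencil of the theorem, and with \<open>t = c\<close> the value of that pencil at \<open>c\<close>.
\<close>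

definition shift_pencil :: "nat \<Rightarrow> nat \<Rightarrow> 'a \<Rightarrow> 'a::comm_ring_1 mat \<Rightarrow> 'a mat" where
  "shift_pencil n d t V = mat (dim_row V) (d * n) (\<lambda>(r, s). V $$ (r, s + n) - t * V $$ (r, s))"

definition first_block :: "nat \<Rightarrow> 'a mat \<Rightarrow> 'a mat" where
  "first_block n V = mat (dim_row V) n (\<lambda>(r, s). V $$ (r, s))"

text \<open>
The block row \<open>[I, t I, \<dots>, t\<^sup>d\<^sup>-\<^sup>1 I]\<close>.
\<close>

definition power_row :: "nat \<Rightarrow> nat \<Rightarrow> 'a \<Rightarrow> 'a::comm_ring_1 mat" where
  "power_row n d t = mat n (d * n) (\<lambda>(k, s). if s mod n = k then t ^ (s div n) else 0)"

text \<open>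
  The unitriangular factor that turns shifted differences at \<open>c\<close> into shifted differences at \<open>x\<close>,
  apart from a term in the first block. Above the diagonal, block column \<open>j\<close> holds the weights
  \<open>c\<^sup>j\<^sup>-\<^sup>i\<^sup>-\<^sup>1\<close> for which the differences telescope, times \<open>c - x\<close>.
\<close>

definition shift_base :: "nat \<Rightarrow> nat \<Rightarrow> 'a \<Rightarrow> 'a \<Rightarrow> 'a::comm_ring_1 mat" where
  "shift_base n d c x = mat (d * n) (d * n) (\<lambda>(r, s).
     if r mod n = s mod n then
       if r div n = s div n then 1
       else if r div n < s div n then (c - x) * c ^ (s div n - r div n - 1) else 0
     else 0)"

text \<open>
  The block column of the coefficients over any ring: it is needed for the complex coefficients
  and for the same coefficients seen as constant polynomials.
\<close>

definition stack :: "nat \<Rightarrow> nat \<Rightarrow> (nat \<Rightarrow> 'a mat) \<Rightarrow> 'a mat" where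
  "stack n d A = mat ((d + 1) * n) n (\<lambda>(r, l). A (r div n) $$ (r mod n, l))"

definition mat_poly_at :: "nat \<Rightarrow> nat \<Rightarrow> (nat \<Rightarrow> 'a mat) \<Rightarrow> 'a \<Rightarrow> 'a::comm_ring_1 mat" where
  "mat_poly_at n d A t = mat n n (\<lambda>(k, l). \<Sum>i\<le>d. t ^ i * A i $$ (k, l))"

text \<open>
  The stacked coefficients of the polynomial quotient of \<open>A(x) - A(c)\<close> by \<open>x - c\<close>, as the Horner scheme
  produces them.
\<close>

definition horner_stack :: "nat \<Rightarrow> nat \<Rightarrow> (nat \<Rightarrow> 'a mat) \<Rightarrow> 'a \<Rightarrow> 'a::comm_ring_1 mat" where
  "horner_stack n d A c = mat (d * n) n
     (\<lambda>(r, l). \<Sum>i<d - r div n. c ^ i * A (r div n + 1 + i) $$ (r mod n, l))"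

lemma shift_pencil_carrier [simp]:
  "V \<in> carrier_mat p q \<Longrightarrow> shift_pencil n d t V \<in> carrier_mat p (d * n)"
  by (auto simp: shift_pencil_def)

lemma first_block_carrier [simp]: "V \<in> carrier_mat p q \<Longrightarrow> first_block n V \<in> carrier_mat p n"
  by (auto simp: first_block_def)

lemma power_row_carrier [simp]: "power_row n d t \<in> carrier_mat n (d * n)"
  by (auto simp: power_row_def)

lemma shift_base_carrier [simp]: "shift_base n d c x \<in> carrier_mat (d * n) (d * n)"
  by (auto simp: shift_base_def)

lemma stack_carrier [simp]: "stack n d A \<in> carrier_mat ((d + 1) * n) n"
  by (auto simp: stack_def)

lemma mat_poly_at_carrier [simp]: "mat_poly_at n d A t \<in> carrier_mat n n"
  by (auto simp: mat_poly_at_def)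

lemma horner_stack_carrier [simp]: "horner_stack n d A c \<in> carrier_mat (d * n) n"
  by (auto simp: horner_stack_def)

lemma det_shift_base: "det (shift_base n d c x) = 1"
proof -
  have "upper_triangular (shift_base n d c x)"
  proof (rule upper_triangularI)
    fix r s assume sr: "s < r" and "r < dim_row (shift_base n d c x)"
    then have r: "r < d * n" by (simp add: shift_base_def)
    have "s div n \<le> r div n" using sr by (intro div_le_mono) simp
    moreover have "r mod n = s mod n \<Longrightarrow> s div n \<noteq> r div n"
      using sr by (metis less_irrefl mod_div_mult_eq)
    ultimately show "shift_base n d c x $$ (r, s) = 0" using r sr by (auto simp: shift_base_def)
  qed
  then have "det (shift_base n d c x) = prod_list (diag_mat (shift_base n d c x))"
    by (rule det_upper_triangular[OF _ shift_base_carrier])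
  moreover have "diag_mat (shift_base n d c x) = replicate (d * n) 1"
    by (intro nth_equalityI) (auto simp: diag_mat_def shift_base_def)
  ultimately show ?thesis by simp
qed

lemma geometric_telescope:
  fixes w :: "nat \<Rightarrow> 'a::comm_ring_1"
  shows "(\<Sum>j<k. c ^ (k - j - 1) * (w (Suc j) - c * w j)) = w k - c ^ k * w 0"
proof (induction k)
  case (Suc k)
  have "(\<Sum>j<k. c ^ (Suc k - j - 1) * (w (Suc j) - c * w j))
      = c * (\<Sum>j<k. c ^ (k - j - 1) * (w (Suc j) - c * w j))"
    unfolding sum_distrib_left
  proof (rule sum.cong)
    fix j assume "j \<in> {..<k}"
    then have "Suc k - j - 1 = Suc (k - j - 1)" by auto
    then show "c ^ (Suc k - j - 1) * (w (Suc j) - c * w j) = c * (c ^ (k - j - 1) * (w (Suc j) - c * w j))"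
      by (simp add: mult.assoc)
  qed simp
  then show ?case unfolding sum.lessThan_Suc Suc.IH by (simp add: algebra_simps)
qed simp

text \<open>
  The Horner quotients \<open>b\<^sub>j\<close> satisfy \<open>b\<^sub>j = a\<^sub>j\<^sub>+\<^sub>1 + c b\<^sub>j\<^sub>+\<^sub>1\<close>, so summation by parts collapses the left
  side. For \<open>w\<^sub>j = x\<^sup>j\<close> this is the division of a polynomial by \<open>x - c\<close>; general weights \<open>w\<close> are needed to
  put the blocks of \<open>W\<close> in the place of the powers of \<open>x\<close>.
\<close>

lemma horner_telescope:
  fixes w a :: "nat \<Rightarrow> 'a::comm_ring_1"
  shows "(\<Sum>j<d. (w (Suc j) - c * w j) * (\<Sum>i<d - j. c ^ i * a (j + 1 + i)))
    = (\<Sum>j\<le>d. w j * a j) - w 0 * (\<Sum>i\<le>d. c ^ i * a i)"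
proof -
  define b where "b j = (\<Sum>i<d - j. c ^ i * a (j + 1 + i))" for j
  have b: "b j = a (Suc j) + c * b (Suc j)" if "j < d" for j
  proof -
    have "d - j = Suc (d - Suc j)" using that by simp
    then show ?thesis
      by (simp only: b_def sum.lessThan_Suc_shift) (simp add: sum_distrib_left mult.assoc)
  qed
  have *: "(\<Sum>j<e. (w (Suc j) - c * w j) * b j)
      = (\<Sum>j<e. w (Suc j) * a (Suc j)) + c * w e * b e - c * w 0 * b 0" if "e \<le> d" for e
    using that
  proof (induction e)
    case (Suc e)
    then show ?case using b[of e] by (simp add: algebra_simps)
  qed simp
  have "b d = 0" by (simp add: b_def)
  moreover have "(\<Sum>i\<le>d. c ^ i * a i) = a 0 + c * b 0"
    by (simp add: b_def lessThan_Suc_atMost[symmetric] sum.lessThan_Suc_shift sum_distrib_left mult.assoc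
        del: sum.lessThan_Suc)
  moreover have "(\<Sum>j\<le>d. w j * a j) = w 0 * a 0 + (\<Sum>j<d. w (Suc j) * a (Suc j))"
    by (simp add: lessThan_Suc_atMost[symmetric] sum.lessThan_Suc_shift del: sum.lessThan_Suc)
  ultimately show ?thesis using *[of d] by (simp add: b_def algebra_simps)
qed

lemma block_index_less: "j < d \<Longrightarrow> k < n \<Longrightarrow> j * n + k < d * n" for j k n d :: nat
  by (metis add.commute add_less_cancel_right less_le_trans mult_Suc mult_le_mono1 Suc_leI add_less_cancel_left)

text \<open>
  Block column \<open>j\<close> of the product is \<open>V\<^sub>j\<^sub>+\<^sub>1 - c V\<^sub>j\<close> minus \<open>x - c\<close> times the sum of
  \<open>c\<^sup>j\<^sup>-\<^sup>i\<^sup>-\<^sup>1 (V\<^sub>i\<^sub>+\<^sub>1 - c V\<^sub>i)\<close> over \<open>i < j\<close>, and this sum telescopes to \<open>V\<^sub>j - c\<^sup>j V\<^sub>0\<close>.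
\<close>

lemma shift_pencil_mult_base:
  fixes V :: "'a::comm_ring_1 mat"
  assumes n: "n \<ge> 1" and V: "V \<in> carrier_mat p ((d + 1) * n)"
  shows "shift_pencil n d c V * shift_base n d c x
    = shift_pencil n d x V + first_block n V * ((x - c) \<cdot>\<^sub>m power_row n d c)"
proof (rule eq_matI)
  let ?R = "shift_pencil n d x V + first_block n V * ((x - c) \<cdot>\<^sub>m power_row n d c)"
  fix r s assume "r < dim_row ?R" "s < dim_col ?R"
  then have r: "r < p" and s: "s < d * n" using V by (auto simp: first_block_def power_row_def)
  define j k where "j = s div n" and "k = s mod n"
  have k: "k < n" and j: "j < d" and sjk: "s = j * n + k"
    using n s by (auto simp: j_def k_def less_mult_imp_div_less)
  define w where "w i = V $$ (r, i * n + k)" for i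
  have "(shift_pencil n d c V * shift_base n d c x) $$ (r, s)
      = (\<Sum>t<d * n. if t mod n = k then (V $$ (r, t + n) - c * V $$ (r, t)) *
          (if t div n = j then 1 else if t div n < j then (c - x) * c ^ (j - t div n - 1) else 0) else 0)"
    unfolding mult_mat_entry[OF shift_pencil_carrier[OF V] shift_base_carrier r s]
    by (rule sum.cong) (use r s V in \<open>auto simp: shift_pencil_def shift_base_def j_def k_def\<close>)
  also have "\<dots> = (\<Sum>i<d. (w (Suc i) - c * w i) *
          (if i = j then 1 else if i < j then (c - x) * c ^ (j - i - 1) else 0))"
    unfolding sum_residue_class[OF k] by (rule sum.cong) (use k in \<open>auto simp: w_def algebra_simps\<close>)
  also have "\<dots> = (\<Sum>i<d. (if i = j then w (Suc j) - c * w j else 0)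
          + (if i < j then (c - x) * (c ^ (j - i - 1) * (w (Suc i) - c * w i)) else 0))"
    by (rule sum.cong) (auto simp: algebra_simps)
  also have "\<dots> = (w (Suc j) - c * w j) + (\<Sum>i<d. if i < j then (c - x) * (c ^ (j - i - 1) * (w (Suc i) - c * w i)) else 0)"
    using j by (simp add: sum.distrib)
  also have "(\<Sum>i<d. if i < j then (c - x) * (c ^ (j - i - 1) * (w (Suc i) - c * w i)) else 0)
      = (\<Sum>i<j. (c - x) * (c ^ (j - i - 1) * (w (Suc i) - c * w i)))"
    by (rule sum.mono_neutral_cong_right) (use j in auto)
  also have "\<dots> = (c - x) * (w j - c ^ j * w 0)"
    by (simp only: sum_distrib_left[symmetric] geometric_telescope)
  finally have lhs: "(shift_pencil n d c V * shift_base n d c x) $$ (r, s)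
      = (w (Suc j) - x * w j) + (x - c) * (c ^ j * w 0)"
    by (simp add: algebra_simps)
  have "(first_block n V * ((x - c) \<cdot>\<^sub>m power_row n d c)) $$ (r, s)
      = (\<Sum>t<n. first_block n V $$ (r, t) * ((x - c) \<cdot>\<^sub>m power_row n d c) $$ (t, s))"
    by (rule mult_mat_entry[OF first_block_carrier[OF V] smult_carrier_mat[OF power_row_carrier] r s])
  also have "\<dots> = (\<Sum>t<n. if t = k then (x - c) * (c ^ j * w 0) else 0)"
    by (rule sum.cong) (use r s V in \<open>auto simp: first_block_def power_row_def k_def[symmetric] j_def[symmetric] w_def\<close>)
  finally have "(first_block n V * ((x - c) \<cdot>\<^sub>m power_row n d c)) $$ (r, s) = (x - c) * (c ^ j * w 0)"
    using k by simp
  moreover have "shift_pencil n d x V $$ (r, s) = w (Suc j) - x * w j"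
    using r s V by (simp add: shift_pencil_def w_def sjk algebra_simps)
  ultimately show "(shift_pencil n d c V * shift_base n d c x) $$ (r, s) = ?R $$ (r, s)"
    using lhs r s V by (simp add: first_block_def power_row_def)
qed (use V in \<open>auto simp: shift_pencil_def shift_base_def first_block_def power_row_def\<close>)

text \<open>
  The telescoping identity of the Horner scheme, for each row of \<open>V\<close> and each column of the \<open>A\<^sub>i\<close>. When
  \<open>V\<close> annihilates the stacked coefficients, it expresses \<open>V\<^sub>0 A(c)\<close> by the shifted differences.
\<close>

lemma shift_pencil_mult_horner:
  fixes V :: "'a::comm_ring_1 mat"
  assumes n: "n \<ge> 1" and V: "V \<in> carrier_mat p ((d + 1) * n)"
  shows "shift_pencil n d c V * horner_stack n d A c
    = V * stack n d A - first_block n V * mat_poly_at n d A c"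
proof (rule eq_matI)
  let ?R = "V * stack n d A - first_block n V * mat_poly_at n d A c"
  fix r l assume "r < dim_row ?R" "l < dim_col ?R"
  then have r: "r < p" and l: "l < n" using V by (auto simp: first_block_def mat_poly_at_def)
  define w where "w k i = V $$ (r, i * n + k)" for k i
  define a where "a k i = A i $$ (k, l)" for k i
  have "(shift_pencil n d c V * horner_stack n d A c) $$ (r, l)
      = (\<Sum>j<d. \<Sum>k<n. (w k (Suc j) - c * w k j) * (\<Sum>i<d - j. c ^ i * a k (j + 1 + i)))"
    unfolding mult_mat_entry[OF shift_pencil_carrier[OF V] horner_stack_carrier r l] sum_blocks
  proof (intro sum.cong refl)
    fix j k assume "j \<in> {..<d}" "k \<in> {..<n}"
    then have jk: "k < n" "j * n + k < d * n" by (auto simp: block_index_less)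
    have "w k (Suc j) = V $$ (r, j * n + k + n)" by (simp add: w_def add_ac)
    then show "shift_pencil n d c V $$ (r, j * n + k) * horner_stack n d A c $$ (j * n + k, l)
        = (w k (Suc j) - c * w k j) * (\<Sum>i<d - j. c ^ i * a k (j + 1 + i))"
      using r l V jk by (simp add: shift_pencil_def horner_stack_def w_def a_def)
  qed
  also have "\<dots> = (\<Sum>k<n. (\<Sum>j\<le>d. w k j * a k j) - w k 0 * (\<Sum>i\<le>d. c ^ i * a k i))"
    by (subst sum.swap) (simp only: horner_telescope)
  also have "\<dots> = (\<Sum>k<n. \<Sum>j\<le>d. w k j * a k j) - (\<Sum>k<n. w k 0 * (\<Sum>i\<le>d. c ^ i * a k i))"
    by (rule sum_subtractf)
  also have "(\<Sum>k<n. \<Sum>j\<le>d. w k j * a k j) = (\<Sum>j<d + 1. \<Sum>k<n. w k j * a k j)"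
    by (subst sum.swap) (simp only: Suc_eq_plus1[symmetric] lessThan_Suc_atMost)
  also have "(\<Sum>j<d + 1. \<Sum>k<n. w k j * a k j) = (V * stack n d A) $$ (r, l)"
    unfolding mult_mat_entry[OF V stack_carrier r l] sum_blocks
    using r l V block_index_less[of _ "d + 1" _ n] by (intro sum.cong) (auto simp: stack_def w_def a_def)
  also have "(\<Sum>k<n. w k 0 * (\<Sum>i\<le>d. c ^ i * a k i)) = (first_block n V * mat_poly_at n d A c) $$ (r, l)"
    unfolding mult_mat_entry[OF first_block_carrier[OF V] mat_poly_at_carrier r l]
    using r l V by (intro sum.cong) (auto simp: first_block_def mat_poly_at_def w_def a_def)
  finally show "(shift_pencil n d c V * horner_stack n d A c) $$ (r, l) = ?R $$ (r, l)"
    using r l V by (simp add: first_block_def mat_poly_at_def)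
qed (use V in \<open>auto simp: shift_pencil_def horner_stack_def first_block_def mat_poly_at_def\<close>)

section \<open>Constant and unimodular matrices\<close>

interpretation const: comm_ring_hom "\<lambda>a :: 'a::comm_ring_1. [:a:]"
  by unfold_locales (auto simp: one_pCons)

abbreviation const_mat :: "complex mat \<Rightarrow> complex poly mat" where
  "const_mat \<equiv> map_mat (\<lambda>a. [:a:])"

lemma obtain_inverse:
  fixes M :: "'a::field mat"
  assumes "M \<in> carrier_mat m m" "det M \<noteq> 0"
  obtains N where "N \<in> carrier_mat m m" "M * N = 1\<^sub>m m" "N * M = 1\<^sub>m m" "det N \<noteq> 0"
proof -
  from det_non_zero_imp_unit[OF assms, of "()"]
  obtain N where N: "N \<in> carrier_mat m m" "M * N = 1\<^sub>m m" "N * M = 1\<^sub>m m"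
    by (auto simp: Units_def ring_mat_def)
  moreover have "det M * det N = 1" using det_mult[OF assms(1) N(1)] N(2) by simp
  then have "det N \<noteq> 0" by auto
  ultimately show thesis using that by blast
qed

lemma unimodular_mult:
  assumes "unimodular m E" "unimodular m F"
  shows "unimodular m (E * F)"
proof -
  obtain a b where "E \<in> carrier_mat m m" "F \<in> carrier_mat m m" "a \<noteq> 0" "b \<noteq> 0"
    "det E = [:a:]" "det F = [:b:]" using assms by (auto simp: unimodular_def)
  then have "E * F \<in> carrier_mat m m" "det (E * F) = [:a * b:]" "a * b \<noteq> 0"
    by (simp_all add: det_mult)
  then show ?thesis unfolding unimodular_def by blast
qed

lemma unimodular_const: "M \<in> carrier_mat m m \<Longrightarrow> det M \<noteq> 0 \<Longrightarrow> unimodular m (const_mat M)"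
  unfolding unimodular_def by (auto simp: const.hom_det)

lemma unimodularI: "E \<in> carrier_mat m m \<Longrightarrow> det E = 1 \<Longrightarrow> unimodular m E"
  unfolding unimodular_def by (auto intro!: exI[of _ 1])

section \<open>Rank updates of the identity\<close>

text \<open>
  The left side is \<open>I + P L\<close> for \<open>P = [P\<^sub>1; P\<^sub>2]\<close> and \<open>L = [I, L\<^sub>2]\<close>. Conjugation by the shear whose first
  block row is \<open>L\<close> turns \<open>L\<close> into \<open>[I, 0]\<close>, so that only the first block column differs from the identity, and
  its upper block is \<open>I + L P\<close>.
\<close>

lemma block_rank_update:
  fixes P1 P2 L2 :: "'a::comm_ring_1 mat"
  assumes P1: "P1 \<in> carrier_mat n n" and P2: "P2 \<in> carrier_mat m n" and L2: "L2 \<in> carrier_mat n m"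
  shows "four_block_mat (1\<^sub>m n + P1) (P1 * L2) P2 (1\<^sub>m m + P2 * L2)
    = four_block_mat (1\<^sub>m n) (- L2) (0\<^sub>m m n) (1\<^sub>m m)
      * (four_block_mat (1\<^sub>m n + (P1 + L2 * P2)) (0\<^sub>m n m) P2 (1\<^sub>m m)
      * four_block_mat (1\<^sub>m n) L2 (0\<^sub>m m n) (1\<^sub>m m))"
proof -
  define M where "M = 1\<^sub>m n + (P1 + L2 * P2)"
  have M: "M \<in> carrier_mat n n" unfolding M_def using assms by auto
  have "four_block_mat M (0\<^sub>m n m) P2 (1\<^sub>m m) * four_block_mat (1\<^sub>m n) L2 (0\<^sub>m m n) (1\<^sub>m m)
      = four_block_mat M (M * L2) P2 (P2 * L2 + 1\<^sub>m m)"
    by (subst mult_four_block_mat[where ?nr1.0 = n and ?n1.0 = n and ?n2.0 = m and ?nr2.0 = m and ?nc1.0 = n and ?nc2.0 = m])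
       (use assms M in auto)
  moreover have "four_block_mat (1\<^sub>m n) (- L2) (0\<^sub>m m n) (1\<^sub>m m) * four_block_mat M (M * L2) P2 (P2 * L2 + 1\<^sub>m m)
      = four_block_mat (M + - L2 * P2) (M * L2 + - L2 * (P2 * L2 + 1\<^sub>m m)) P2 (P2 * L2 + 1\<^sub>m m)"
    by (subst mult_four_block_mat[where ?nr1.0 = n and ?n1.0 = n and ?n2.0 = m and ?nr2.0 = m and ?nc1.0 = n and ?nc2.0 = m])
       (use assms M in auto)
  moreover have "M + - L2 * P2 = 1\<^sub>m n + P1"
    unfolding M_def using assms by (intro eq_matI) auto
  moreover have "M * L2 + - L2 * (P2 * L2 + 1\<^sub>m m) = P1 * L2"
  proof -
    have "M * L2 = L2 + (P1 * L2 + L2 * (P2 * L2))"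
      unfolding M_def using assms
      by (simp add: add_mult_distrib_mat[of _ n n _ _ m] assoc_mult_mat[of _ n m _ n _ m])
    moreover have "- L2 * (P2 * L2 + 1\<^sub>m m) = - (L2 * (P2 * L2)) + - L2"
      using assms by (simp add: mult_add_distrib_mat[of _ n m _ m])
    ultimately show ?thesis using assms by (intro eq_matI) auto
  qed
  moreover have "P2 * L2 + 1\<^sub>m m = 1\<^sub>m m + P2 * L2"
    using assms by (intro comm_add_mat[of _ m m]) auto
  ultimately show ?thesis unfolding M_def by simp
qed

lemma mult_mat_regroup:
  assumes "A \<in> carrier_mat k k" "B \<in> carrier_mat k k" "C \<in> carrier_mat k k" "D \<in> carrier_mat k k"
  shows "A * (B * C * D) = A * B * (C * D)"
  using assms by (simp add: assoc_mult_mat[of _ k k _ k _ k])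

lemma sum_lessThan_add:
  fixes f :: "nat \<Rightarrow> 'a::comm_monoid_add"
  shows "(\<Sum>k<n + m. f k) = (\<Sum>k<n. f k) + (\<Sum>k<m. f (k + n))"
  by (induction m) (simp_all add: add_ac)

text \<open>
  Sylvester's identity \<open>det (I + P L) = det (I + L P)\<close> as an equivalence of matrices. It is stated with an
  extra constant factor \<open>H\<close> because \<open>(I + L P) H\<close>, and not \<open>I + L P\<close>, will be the given matrix polynomial.
\<close>

lemma rank_update_equivalent_diag:
  fixes P L :: "complex poly mat"
  assumes P: "P \<in> carrier_mat (n + m) n" and L: "L \<in> carrier_mat n (n + m)"
    and L1: "first_block n L = 1\<^sub>m n"
    and H: "H \<in> carrier_mat n n" "Hi \<in> carrier_mat n n" "H * Hi = 1\<^sub>m n" and u: "unimodular n Hi"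
  shows "\<exists>E F. unimodular (n + m) E \<and> unimodular (n + m) F \<and>
    1\<^sub>m (n + m) + P * L = E * diag_block_mat [(1\<^sub>m n + L * P) * H, 1\<^sub>m m] * F"
proof -
  define P1 P2 L2 where "P1 = mat n n (\<lambda>(r, s). P $$ (r, s))"
    and "P2 = mat m n (\<lambda>(r, s). P $$ (r + n, s))" and "L2 = mat n m (\<lambda>(r, s). L $$ (r, s + n))"
  have c: "P1 \<in> carrier_mat n n" "P2 \<in> carrier_mat m n" "L2 \<in> carrier_mat n m"
    by (auto simp: P1_def P2_def L2_def)
  have L1e: "L $$ (k, s) = (if k = s then 1 else 0)" if "k < n" "s < n" for k s
    using arg_cong[OF L1, of "\<lambda>M. M $$ (k, s)"] that L by (simp add: first_block_def)
  have P1e: "P1 $$ (r, s) = P $$ (r, s)" if "r < n" "s < n" for r s using that by (simp add: P1_def)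
  have P2e: "P2 $$ (r - n, s) = P $$ (r, s)" if "\<not> r < n" "r < n + m" "s < n" for r s
    using that by (simp add: P2_def)
  have PL: "(P * L) $$ (r, s) = (if s < n then P $$ (r, s) else (\<Sum>k<n. P $$ (r, k) * L2 $$ (k, s - n)))"
    if "r < n + m" "s < n + m" for r s
    using that unfolding mult_mat_entry[OF P L that] by (auto simp: L1e L2_def if_distrib cong: if_cong)
  have eq: "1\<^sub>m (n + m) + P * L = four_block_mat (1\<^sub>m n + P1) (P1 * L2) P2 (1\<^sub>m m + P2 * L2)" (is "?l = ?r")
  proof (rule eq_matI)
    fix r s assume "r < dim_row ?r" "s < dim_col ?r"
    then have rs: "r < n + m" "s < n + m" using c by auto
    have 1: "(P1 * L2) $$ (r, s - n) = (\<Sum>k<n. P $$ (r, k) * L2 $$ (k, s - n))" if "r < n" "\<not> s < n"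
      using that rs mult_mat_entry[OF c(1) c(3), of r "s - n"] by (simp add: P1_def)
    have 2: "(P2 * L2) $$ (r - n, s - n) = (\<Sum>k<n. P $$ (r, k) * L2 $$ (k, s - n))" if "\<not> r < n" "\<not> s < n"
      using that rs mult_mat_entry[OF c(2) c(3), of "r - n" "s - n"] by (simp add: P2_def)
    have "dim_row (P * L) = n + m" "dim_col (P * L) = n + m" using P L by auto
    then show "?l $$ (r, s) = ?r $$ (r, s)"
      using rs c PL[OF rs] 1 2 P1e P2e by (auto simp del: index_mult_mat(1))
  qed (use P L c in auto)
  have LP: "L * P = P1 + L2 * P2"
  proof (rule eq_matI)
    fix r s assume "r < dim_row (P1 + L2 * P2)" "s < dim_col (P1 + L2 * P2)"
    then have rs: "r < n" "s < n" using c by auto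
    have "(L * P) $$ (r, s) = (\<Sum>k<n + m. L $$ (r, k) * P $$ (k, s))" by (rule mult_mat_entry[OF L P rs])
    also have "\<dots> = (\<Sum>k<n. L $$ (r, k) * P $$ (k, s)) + (\<Sum>k<m. L $$ (r, k + n) * P $$ (k + n, s))"
      by (rule sum_lessThan_add)
    also have "(\<Sum>k<n. L $$ (r, k) * P $$ (k, s)) = P $$ (r, s)"
      using rs by (simp add: L1e if_distrib if_distribR cong: if_cong)
    also have "(\<Sum>k<m. L $$ (r, k + n) * P $$ (k + n, s)) = (L2 * P2) $$ (r, s)"
      unfolding mult_mat_entry[OF c(3) c(2) rs] using rs by (intro sum.cong) (auto simp: L2_def P2_def)
    finally show "(L * P) $$ (r, s) = (P1 + L2 * P2) $$ (r, s)" using rs c by (simp add: P1_def)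
  qed (use P L c in auto)
  define M where "M = 1\<^sub>m n + (P1 + L2 * P2)"
  have M: "M \<in> carrier_mat n n" unfolding M_def using c by auto
  let ?S = "four_block_mat (1\<^sub>m n) L2 (0\<^sub>m m n) (1\<^sub>m m)"
    and ?S' = "four_block_mat (1\<^sub>m n) (- L2) (0\<^sub>m m n) (1\<^sub>m m)"
    and ?U = "four_block_mat Hi (0\<^sub>m n m) P2 (1\<^sub>m m)"
    and ?D = "four_block_mat (M * H) (0\<^sub>m n m) (0\<^sub>m m n) (1\<^sub>m m)"
  have carr: "?S \<in> carrier_mat (n + m) (n + m)" "?S' \<in> carrier_mat (n + m) (n + m)"
    "?U \<in> carrier_mat (n + m) (n + m)" "?D \<in> carrier_mat (n + m) (n + m)"
    using c H M by (auto intro!: four_block_carrier_mat)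
  have DU: "?D * ?U = four_block_mat M (0\<^sub>m n m) P2 (1\<^sub>m m)"
    by (subst mult_four_block_mat[where ?nr1.0 = n and ?n1.0 = n and ?n2.0 = m and ?nr2.0 = m and ?nc1.0 = n and ?nc2.0 = m])
       (use c M H in \<open>auto simp: assoc_mult_mat[of _ n n _ n _ n]\<close>)
  have "1\<^sub>m (n + m) + P * L = ?S' * (?D * ?U * ?S)"
    unfolding eq block_rank_update[OF c] M_def[symmetric] DU ..
  also have "\<dots> = ?S' * ?D * (?U * ?S)"
    by (rule mult_mat_regroup[OF carr(2,4,3,1)])
  also have "?D = diag_block_mat [(1\<^sub>m n + L * P) * H, 1\<^sub>m m]"
    unfolding LP M_def[symmetric] using M H
    by (simp add: Let_def diag_block_mat.simps(2)[of "M * H" "[1\<^sub>m m]"] del: diag_block_mat.simps)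
  finally have "1\<^sub>m (n + m) + P * L
    = ?S' * diag_block_mat [(1\<^sub>m n + L * P) * H, 1\<^sub>m m] * (?U * ?S)" .
  moreover have "unimodular (n + m) ?S'" "unimodular (n + m) ?S"
    by (rule unimodularI, rule carr, subst det_four_block_mat_lower_left_zero, use c in auto)+
  moreover have "unimodular (n + m) ?U"
  proof -
    have "det ?U = det Hi" using c H by (simp add: det_four_block_mat_upper_right_zero[of _ n _ m])
    then show ?thesis using u carr by (auto simp: unimodular_def)
  qed
  ultimately show ?thesis using unimodular_mult by blast
qed

section \<open>Linearization at a regular point\<close>

text \<open>
  On \<open>[I, x I, \<dots>, x\<^sup>d I]\<close> a shifted difference at \<open>c\<close> is multiplication by \<open>x - c\<close>; for \<open>c = x\<close> it vanishes.
\<close>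

lemma shift_pencil_power_row:
  "n \<ge> 1 \<Longrightarrow> shift_pencil n d c (power_row n (d + 1) x) = (x - c) \<cdot>\<^sub>m power_row n d x"
  by (rule eq_matI) (auto simp: shift_pencil_def power_row_def algebra_simps)

lemma first_block_power_row: "n \<ge> 1 \<Longrightarrow> first_block n (power_row n (d + 1) x) = 1\<^sub>m n"
  by (rule eq_matI) (auto simp: first_block_def power_row_def)

lemma power_row_mult_stack:
  assumes "n \<ge> 1"
  shows "power_row n (d + 1) x * stack n d A = mat_poly_at n d A x"
proof (rule eq_matI)
  fix k l assume "k < dim_row (mat_poly_at n d A x)" "l < dim_col (mat_poly_at n d A x)"
  then have kl: "k < n" "l < n" by (simp_all add: mat_poly_at_def)
  have "(power_row n (d + 1) x * stack n d A) $$ (k, l)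
      = (\<Sum>s<(d + 1) * n. if s mod n = k then x ^ (s div n) * A (s div n) $$ (s mod n, l) else 0)"
    unfolding mult_mat_entry[OF power_row_carrier stack_carrier kl]
    by (rule sum.cong) (use kl in \<open>auto simp: power_row_def stack_def\<close>)
  also have "\<dots> = mat_poly_at n d A x $$ (k, l)"
    unfolding sum_residue_class[OF kl(1)] using kl
    by (simp only: Suc_eq_plus1[symmetric] lessThan_Suc_atMost) (simp add: mat_poly_at_def)
  finally show "(power_row n (d + 1) x * stack n d A) $$ (k, l) = mat_poly_at n d A x $$ (k, l)" .
qed (simp_all add: power_row_def stack_def mat_poly_at_def)

lemma const_power: "[:c:] ^ i = [:c ^ i :: 'a::comm_ring_1:]"
  by (rule const.hom_power[symmetric])

lemma const_mat_poly_at: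
  assumes "\<And>i. i \<le> d \<Longrightarrow> A i \<in> carrier_mat n n"
  shows "mat_poly_at n d (\<lambda>i. const_mat (A i)) [:c:] = const_mat (mat_poly_at n d A c)"
proof (rule eq_matI)
  fix k l assume "k < dim_row (const_mat (mat_poly_at n d A c))" "l < dim_col (const_mat (mat_poly_at n d A c))"
  then have kl: "k < n" "l < n" by (simp_all add: mat_poly_at_def)
  have "(\<Sum>i\<le>d. [:c:] ^ i * const_mat (A i) $$ (k, l)) = (\<Sum>i\<le>d. [:c ^ i * A i $$ (k, l):])"
  proof (rule sum.cong)
    fix i assume "i \<in> {..d}"
    then have "A i \<in> carrier_mat n n" by (intro assms) auto
    then show "[:c:] ^ i * const_mat (A i) $$ (k, l) = [:c ^ i * A i $$ (k, l):]"
      using kl by (auto simp: const_power)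
  qed simp
  then show "mat_poly_at n d (\<lambda>i. const_mat (A i)) [:c:] $$ (k, l) = const_mat (mat_poly_at n d A c) $$ (k, l)"
    using kl by (simp add: mat_poly_at_def const.hom_sum)
qed (simp_all add: mat_poly_at_def)

lemma const_horner_stack:
  assumes "n \<ge> 1" and A: "\<And>i. i \<le> d \<Longrightarrow> A i \<in> carrier_mat n n"
  shows "horner_stack n d (\<lambda>i. const_mat (A i)) [:c:] = const_mat (horner_stack n d A c)"
proof (rule eq_matI)
  fix r l assume "r < dim_row (const_mat (horner_stack n d A c))" "l < dim_col (const_mat (horner_stack n d A c))"
  then have rl: "r < d * n" "l < n" by (simp_all add: horner_stack_def)
  have "(\<Sum>i<d - r div n. [:c:] ^ i * const_mat (A (r div n + 1 + i)) $$ (r mod n, l))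
      = (\<Sum>i<d - r div n. [:c ^ i * A (r div n + 1 + i) $$ (r mod n, l):])"
  proof (rule sum.cong)
    fix i assume "i \<in> {..<d - r div n}"
    then have "A (r div n + 1 + i) \<in> carrier_mat n n" by (intro A) auto
    then show "[:c:] ^ i * const_mat (A (r div n + 1 + i)) $$ (r mod n, l)
        = [:c ^ i * A (r div n + 1 + i) $$ (r mod n, l):]"
      using rl \<open>n \<ge> 1\<close> by (auto simp: const_power)
  qed simp
  then show "horner_stack n d (\<lambda>i. const_mat (A i)) [:c:] $$ (r, l) = const_mat (horner_stack n d A c) $$ (r, l)"
    using rl by (simp add: horner_stack_def const.hom_sum)
qed (simp_all add: horner_stack_def)

lemma const_shift_pencil:
  assumes "n \<ge> 1" "V \<in> carrier_mat p ((d + 1) * n)"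
  shows "shift_pencil n d [:c:] (const_mat V) = const_mat (shift_pencil n d c V)"
  by (rule eq_matI) (use assms in \<open>auto simp: shift_pencil_def\<close>)

lemma const_first_block:
  assumes "V \<in> carrier_mat p ((d + 1) * n)"
  shows "first_block n (const_mat V) = const_mat (first_block n V)"
  by (rule eq_matI) (use assms in \<open>auto simp: first_block_def\<close>)

text \<open>
  If a row vector \<open>v\<close> annihilates the shifted differences at \<open>c\<close>, the blocks of \<open>v W\<close> form a geometric
  progression with ratio \<open>c\<close>. Its first block is zero because the first block of \<open>W\<close> factors through these
  differences, hence \<open>v W = 0\<close>, and the right inverse of \<open>W\<close> gives \<open>v = 0\<close>.
\<close>

lemma det_shift_pencil_nonzero:
  fixes W :: "complex mat"
  assumes n: "n \<ge> 1" and W: "W \<in> carrier_mat (d * n) ((d + 1) * n)"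
    and Z: "Z \<in> carrier_mat ((d + 1) * n) (d * n)" "W * Z = 1\<^sub>m (d * n)"
    and F: "first_block n W = - (shift_pencil n d c W * B)" and B: "B \<in> carrier_mat (d * n) n"
  shows "det (shift_pencil n d c W) \<noteq> 0"
proof
  let ?G = "shift_pencil n d c W" and ?m = "d * n"
  have G: "?G \<in> carrier_mat ?m ?m" using W by simp
  assume "det ?G = 0"
  then have "det (?G\<^sup>T) = 0" using det_transpose[OF G] by simp
  then obtain v where v: "v \<in> carrier_vec ?m" "v \<noteq> 0\<^sub>v ?m" "?G\<^sup>T *\<^sub>v v = 0\<^sub>v ?m"
    using det_0_iff_vec_prod_zero_field[of "?G\<^sup>T" ?m] G by auto
  have T: "W\<^sup>T *\<^sub>v v = 0\<^sub>v ((d + 1) * n)"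
  proof (rule eq_vecI)
    define f where "f s = (W\<^sup>T *\<^sub>v v) $ s" for s
    have f: "f s = (\<Sum>r<?m. W $$ (r, s) * v $ r)" if "s < (d + 1) * n" for s
      using that W v(1) by (auto simp: f_def scalar_prod_def lessThan_atLeast0 intro!: sum.cong)
    have step: "f (s + n) = c * f s" if "s < ?m" for s
    proof -
      have "0 = (?G\<^sup>T *\<^sub>v v) $ s" using v that by simp
      also have "\<dots> = (\<Sum>r<?m. (W $$ (r, s + n) - c * W $$ (r, s)) * v $ r)"
        using that W v(1) by (auto simp: shift_pencil_def scalar_prod_def lessThan_atLeast0 intro!: sum.cong)
      also have "\<dots> = f (s + n) - c * f s"
        using that by (simp add: f algebra_simps sum_subtractf sum_distrib_left)
      finally show ?thesis by simp
    qed
    have base: "f s = 0" if "s < n" for s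
    proof -
      have "(first_block n W)\<^sup>T *\<^sub>v v = - (B\<^sup>T *\<^sub>v (?G\<^sup>T *\<^sub>v v))"
      proof -
        have neg: "(- M)\<^sup>T = - (M\<^sup>T)" for M :: "complex mat" by (intro eq_matI) auto
        have "(first_block n W)\<^sup>T = - (B\<^sup>T * ?G\<^sup>T)"
          unfolding F neg transpose_mult[OF G B] ..
        then show ?thesis using G B v
          by (simp add: uminus_mult_mat_vec assoc_mult_mat_vec[of _ n ?m _ ?m])
      qed
      also have "\<dots> = 0\<^sub>v n" unfolding v(3) using B by (intro eq_vecI) auto
      finally have "((first_block n W)\<^sup>T *\<^sub>v v) $ s = 0" using that by simp
      moreover have "((first_block n W)\<^sup>T *\<^sub>v v) $ s = (\<Sum>r<?m. W $$ (r, s) * v $ r)"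
        using that W v(1) by (auto simp: first_block_def scalar_prod_def lessThan_atLeast0 intro!: sum.cong)
      ultimately show ?thesis using f[of s] that by simp
    qed
    have zero: "f s = 0" if "s < (d + 1) * n" for s
      using that
    proof (induction s rule: less_induct)
      case (less s)
      show ?case
      proof (cases "s < n")
        case False
        then have "f s = c * f (s - n)" using step[of "s - n"] less.prems by simp
        moreover have "f (s - n) = 0" using False n less.prems by (intro less.IH) auto
        ultimately show ?thesis by simp
      qed (rule base)
    qed
    fix s assume "s < dim_vec (0\<^sub>v ((d + 1) * n))"
    then show "(W\<^sup>T *\<^sub>v v) $ s = 0\<^sub>v ((d + 1) * n) $ s" using zero[of s] by (simp add: f_def)
  qed (use W in simp)
  have "v = (W * Z)\<^sup>T *\<^sub>v v" unfolding Z(2) using v by simp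
  also have "\<dots> = Z\<^sup>T *\<^sub>v (W\<^sup>T *\<^sub>v v)"
    unfolding transpose_mult[OF W Z(1)]
    by (rule assoc_mult_mat_vec[of _ ?m "(d + 1) * n" _ ?m]) (use W Z(1) v(1) in auto)
  also have "\<dots> = 0\<^sub>v ?m" unfolding T using Z by (intro eq_vecI) auto
  finally show False using v by simp
qed

text \<open>
  The pencil is \<open>G (I + P L) R\<close>, with the constant invertible matrix
  \<open>G\<close>, the unitriangular matrix \<open>R\<close> and a rank update in the middle for which \<open>(I + L P) H = A(x)\<close>.
\<close>

lemma is_linearization_shift_pencil:
  fixes A :: "nat \<Rightarrow> complex mat" and W Z :: "complex mat"
  assumes n: "n \<ge> 1" and d: "d \<ge> 1"
    and A: "\<And>i. i \<le> d \<Longrightarrow> A i \<in> carrier_mat n n"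
    and W: "W \<in> carrier_mat (d * n) ((d + 1) * n)"
    and Z: "Z \<in> carrier_mat ((d + 1) * n) (d * n)" "W * Z = 1\<^sub>m (d * n)"
    and WA: "W * stack n d A = 0\<^sub>m (d * n) n"
    and reg: "det (mat_poly_at n d A c) \<noteq> 0"
  shows "is_linearization n d (shift_pencil n d [:0, 1:] (const_mat W))
    (mat_poly_at n d (\<lambda>i. const_mat (A i)) [:0, 1:])"
proof -
  define m where "m = d * n"
  define k where "k = (d - 1) * n"
  have mk: "m = n + k" using d by (cases d) (simp_all add: m_def k_def)
  define G where "G = shift_pencil n d c W"
  define B where "B = horner_stack n d A c"
  define H where "H = mat_poly_at n d A c"
  define Wf where "Wf = first_block n W"
  have H: "H \<in> carrier_mat n n" by (simp add: H_def)
  obtain Hi where Hi: "Hi \<in> carrier_mat n n" "H * Hi = 1\<^sub>m n" "Hi * H = 1\<^sub>m n" "det Hi \<noteq> 0"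
    using obtain_inverse[OF H] reg H_def by metis
  have carr: "G \<in> carrier_mat m m" "B \<in> carrier_mat m n" "Wf \<in> carrier_mat m n"
    using W by (simp_all add: G_def B_def Wf_def m_def)
  (* The second identity for W, which annihilates the stacked coefficients. *)
  have GB: "G * B = - (Wf * H)"
    using shift_pencil_mult_horner[OF n W, of c A] carr H unfolding WA
    by (simp add: G_def B_def Wf_def H_def m_def minus_add_uminus_mat[of _ "d * n" n])
  have Wf: "Wf = - (G * (B * Hi))"
  proof -
    have "Wf = Wf * (H * Hi)" using carr Hi by simp
    also have "\<dots> = Wf * H * Hi" using carr H Hi by simp
    also have "Wf * H = - (G * B)" unfolding GB using carr H by (intro eq_matI) auto
    also have "- (G * B) * Hi = - (G * (B * Hi))" using carr Hi by (simp add: uminus_mult_left_mat)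
    finally show ?thesis .
  qed
  have detG: "det G \<noteq> 0"
    unfolding G_def
  proof (rule det_shift_pencil_nonzero[OF n W Z])
    show "first_block n W = - (shift_pencil n d c W * (B * Hi))" using Wf unfolding Wf_def G_def .
    show "B * Hi \<in> carrier_mat (d * n) n" using carr Hi by (simp add: m_def)
  qed
  let ?x = "[:0, 1:] :: complex poly" and ?c = "[:c:]"
  define L where "L = power_row n d ?x"
  define R where "R = shift_base n d ?c ?x"
  define V where "V = const_mat W"
  (* The factor x - c is kept in P, so that L begins with an identity block. *)
  define P where "P = (?x - ?c) \<cdot>\<^sub>m const_mat (B * Hi)"
  define y where "y = ?x - ?c"
  have V: "V \<in> carrier_mat m ((d + 1) * n)" using W by (simp add: V_def m_def)
  have pc: "L \<in> carrier_mat n m" "R \<in> carrier_mat m m" "P \<in> carrier_mat m n"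
    using carr Hi by (simp_all add: L_def R_def P_def m_def)
  have BHi: "B * Hi \<in> carrier_mat m n" using carr Hi by simp
  (* The first identity on [I, x I, ...], where its term at x vanishes. *)
  have LR: "(y \<cdot>\<^sub>m L) * R = y \<cdot>\<^sub>m power_row n d ?c"
  proof -
    have "shift_pencil n d ?c (power_row n (d + 1) ?x) * R
        = shift_pencil n d ?x (power_row n (d + 1) ?x)
          + first_block n (power_row n (d + 1) ?x) * (y \<cdot>\<^sub>m power_row n d ?c)"
      unfolding R_def y_def by (rule shift_pencil_mult_base[OF n power_row_carrier])
    then have "(y \<cdot>\<^sub>m L) * R = 0 \<cdot>\<^sub>m L + 1\<^sub>m n * (y \<cdot>\<^sub>m power_row n d ?c)"
      unfolding shift_pencil_power_row[OF n] first_block_power_row[OF n] L_def y_def by simp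
    also have "\<dots> = y \<cdot>\<^sub>m power_row n d ?c"
      by (intro eq_matI) (auto simp: L_def power_row_def)
    finally show ?thesis .
  qed
  have pencil: "shift_pencil n d ?x V = const_mat G * ((1\<^sub>m m + P * L) * R)"
  proof -
    have "const_mat G * R = shift_pencil n d ?x V + const_mat Wf * (y \<cdot>\<^sub>m L * R)"
      using shift_pencil_mult_base[OF n V, of ?c ?x] W LR n
      by (simp add: V_def const_shift_pencil const_first_block G_def Wf_def R_def y_def)
    moreover have "const_mat Wf * (y \<cdot>\<^sub>m L * R) = - (const_mat G * (P * L * R))"
    proof -
      have w: "const_mat Wf = - (const_mat G * const_mat (B * Hi))"
        unfolding Wf const.mat_hom_mult[OF carr(1) BHi, symmetric]
        by (intro eq_matI) (use carr Hi in auto)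
      have p: "P * L = const_mat (B * Hi) * (y \<cdot>\<^sub>m L)"
        unfolding P_def y_def[symmetric] using BHi pc by (simp add: mult_smult_distrib[of _ m n _ m] mult_smult_assoc_mat[of _ m n _ m])
      have "- (X * C) * (Y * R) = - (X * (C * Y * R))"
        if "X \<in> carrier_mat m m" "C \<in> carrier_mat m n" "Y \<in> carrier_mat n m" for X C Y :: "complex poly mat"
      proof -
        have "- (X * C) * (Y * R) = - (X * C * (Y * R))"
          by (rule uminus_mult_left_mat) (use that pc in auto)
        also have "X * C * (Y * R) = X * (C * Y * R)"
          using that pc by (simp add: assoc_mult_mat[of _ m n _ m _ m] assoc_mult_mat[of _ m m _ n _ m])
        finally show ?thesis .
      qed
      then show ?thesis unfolding w p by this (use carr BHi pc in auto)
    qed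
    ultimately have eq: "const_mat G * R = shift_pencil n d ?x V + - (const_mat G * (P * L * R))" by simp
    have X: "shift_pencil n d ?x V \<in> carrier_mat m m" using V by (simp add: m_def)
    have "const_mat G * ((1\<^sub>m m + P * L) * R) = const_mat G * R + const_mat G * (P * L * R)"
      using carr pc by (simp add: add_mult_distrib_mat[of _ m m _ _ m] mult_add_distrib_mat[of _ m m _ m])
    also have "\<dots> = shift_pencil n d ?x V"
      unfolding eq using X carr pc by (intro eq_matI) auto
    finally show ?thesis by simp
  qed
  have core: "(1\<^sub>m n + L * P) * const_mat H = mat_poly_at n d (\<lambda>i. const_mat (A i)) ?x"
  proof -
    let ?A = "mat_poly_at n d (\<lambda>i. const_mat (A i)) ?x"
    have cH: "mat_poly_at n d (\<lambda>i. const_mat (A i)) ?c = const_mat H"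
      unfolding H_def by (rule const_mat_poly_at) (rule A)
    have cB: "horner_stack n d (\<lambda>i. const_mat (A i)) ?c = const_mat B"
      unfolding B_def by (rule const_horner_stack[OF n]) (rule A)
    (* The second identity on [I, x I, ...], whose product with the stacked coefficients is A(x). *)
    have "y \<cdot>\<^sub>m L * const_mat B = ?A - const_mat H"
      using shift_pencil_mult_horner[OF n power_row_carrier[of n "d + 1" ?x],
          of ?c "\<lambda>i. const_mat (A i)"]
      unfolding shift_pencil_power_row[OF n] first_block_power_row[OF n] power_row_mult_stack[OF n] cH cB
      using H by (simp add: L_def y_def left_mult_one_mat[of _ n n])
    moreover have "L * P * const_mat H = y \<cdot>\<^sub>m L * const_mat B"
    proof -
      have "L * P = y \<cdot>\<^sub>m L * const_mat (B * Hi)"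
        unfolding P_def y_def[symmetric] using BHi pc by (simp add: mult_smult_distrib[of _ n m _ n] mult_smult_assoc_mat[of _ n m _ n])
      then have "L * P * const_mat H = y \<cdot>\<^sub>m L * (const_mat (B * Hi) * const_mat H)"
        using BHi pc H by (simp add: assoc_mult_mat[of _ n m _ n _ n])
      also have "const_mat (B * Hi) * const_mat H = const_mat (B * Hi * H)"
        using const.mat_hom_mult[OF BHi H] by simp
      also have "B * Hi * H = B" using carr Hi H by (simp add: assoc_mult_mat[of _ m n _ n _ n])
      finally show ?thesis .
    qed
    ultimately have "L * P * const_mat H = ?A - const_mat H" by simp
    moreover have "(1\<^sub>m n + L * P) * const_mat H = const_mat H + L * P * const_mat H"
      using pc H by (simp add: add_mult_distrib_mat[of _ n n _ _ n])
    ultimately show ?thesis using H by (intro eq_matI) (auto simp: mat_poly_at_def)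
  qed
  have "\<exists>E F. unimodular m E \<and> unimodular m F \<and>
    1\<^sub>m m + P * L = E * diag_block_mat [(1\<^sub>m n + L * P) * const_mat H, 1\<^sub>m k] * F"
    unfolding mk
  proof (rule rank_update_equivalent_diag)
    show "first_block n L = 1\<^sub>m n"
      using first_block_power_row[OF n, of "d - 1" ?x] d by (simp add: L_def)
    show "const_mat H * const_mat Hi = 1\<^sub>m n"
      using const.mat_hom_mult[OF H Hi(1)] Hi by (simp add: const.mat_hom_one)
    show "unimodular n (const_mat Hi)" using Hi by (intro unimodular_const)
  qed (use pc H Hi mk in auto)
  then obtain E F where EF: "unimodular m E" "unimodular m F"
    "1\<^sub>m m + P * L = E * diag_block_mat [mat_poly_at n d (\<lambda>i. const_mat (A i)) ?x, 1\<^sub>m k] * F"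
    unfolding core by blast
  let ?D = "diag_block_mat [mat_poly_at n d (\<lambda>i. const_mat (A i)) ?x, 1\<^sub>m k]"
  have D: "?D \<in> carrier_mat m m"
    by (rule carrier_matI) (simp_all add: dim_diag_block_mat mk mat_poly_at_def)
  have ef: "E \<in> carrier_mat m m" "F \<in> carrier_mat m m" using EF by (auto simp: unimodular_def)
  have "shift_pencil n d ?x V = const_mat G * E * ?D * (F * R)"
    unfolding pencil EF(3) using ef D carr pc
    by (simp add: assoc_mult_mat[of _ m m _ m _ m] del: diag_block_mat.simps)
  moreover have "unimodular m (const_mat G * E)"
    using unimodular_mult[OF unimodular_const[OF carr(1) detG] EF(1)] .
  moreover have "unimodular m (F * R)"
    using pc by (intro unimodular_mult EF unimodularI) (simp_all add: R_def det_shift_base)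
  moreover have "shift_pencil n d ?x V \<in> carrier_mat m m" using V by (simp add: m_def)
  moreover have "degree (shift_pencil n d ?x V $$ (i, j)) \<le> 1" if "i < m" "j < m" for i j
    using that W n by (auto simp: shift_pencil_def V_def m_def intro!: degree_diff_le)
  ultimately show ?thesis
    unfolding is_linearization_def V_def m_def k_def by blast
qed

section \<open>Strong linearization\<close>


lemma degree_const_mat_mult:
  assumes P: "P \<in> carrier_mat p q" and M: "M \<in> carrier_mat q r"
    and deg: "\<And>i j. i < q \<Longrightarrow> j < r \<Longrightarrow> degree (M $$ (i, j)) \<le> k" and ij: "i < p" "j < r"
  shows "degree ((const_mat P * M) $$ (i, j)) \<le> k"
proof -
  have "(const_mat P * M) $$ (i, j) = (\<Sum>l<q. [:P $$ (i, l):] * M $$ (l, j))"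
    using mult_mat_entry[OF map_carrier_mat[THEN iffD2, OF P] M ij] P ij by simp
  also have "degree \<dots> \<le> k"
    using deg ij by (intro degree_sum_le) (auto intro: order_trans[OF degree_smult_le])
  finally show ?thesis .
qed

lemma degree_mult_const_mat:
  assumes P: "P \<in> carrier_mat q r" and M: "M \<in> carrier_mat p q"
    and deg: "\<And>i j. i < p \<Longrightarrow> j < q \<Longrightarrow> degree (M $$ (i, j)) \<le> k" and ij: "i < p" "j < r"
  shows "degree ((M * const_mat P) $$ (i, j)) \<le> k"
proof -
  have "(M * const_mat P) $$ (i, j) = (\<Sum>l<q. M $$ (i, l) * [:P $$ (l, j):])"
    using mult_mat_entry[OF M map_carrier_mat[THEN iffD2, OF P] ij] P ij by simp
  also have "degree \<dots> \<le> k"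
    using deg ij by (intro degree_sum_le) (auto intro: order_trans[OF degree_smult_le])
  finally show ?thesis .
qed

lemma is_linearization_const_equivalent:
  assumes L: "is_linearization n d L M" and M: "M \<in> carrier_mat n n" and d: "d \<ge> 1"
    and P: "P \<in> carrier_mat (d * n) (d * n)" "det P \<noteq> 0" and Q: "Q \<in> carrier_mat (d * n) (d * n)" "det Q \<noteq> 0"
  shows "is_linearization n d (const_mat P * L * const_mat Q) M"
proof -
  let ?m = "d * n" and ?D = "diag_block_mat [M, 1\<^sub>m ((d - 1) * n)]"
  obtain E F where EF: "unimodular ?m E" "unimodular ?m F" "L = E * ?D * F"
    and Lc: "L \<in> carrier_mat ?m ?m" and deg: "\<And>i j. i < ?m \<Longrightarrow> j < ?m \<Longrightarrow> degree (L $$ (i, j)) \<le> 1"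
    using L unfolding is_linearization_def by blast
  have ef: "E \<in> carrier_mat ?m ?m" "F \<in> carrier_mat ?m ?m" using EF by (auto simp: unimodular_def)
  have PL: "const_mat P * L \<in> carrier_mat ?m ?m" using P Lc by simp
  have "n + (d - 1) * n = ?m" using d by (cases d) auto
  then have D: "?D \<in> carrier_mat ?m ?m"
    using M by (intro carrier_matI) (simp_all add: dim_diag_block_mat)
  have "const_mat P * L * const_mat Q = const_mat P * E * ?D * (F * const_mat Q)"
    unfolding EF(3) using ef D P Q
    by (simp add: assoc_mult_mat[of _ ?m ?m _ ?m _ ?m] del: diag_block_mat.simps)
  moreover have "unimodular ?m (const_mat P * E)" "unimodular ?m (F * const_mat Q)"
    using P Q EF by (auto intro!: unimodular_mult unimodular_const)
  moreover have "degree ((const_mat P * L * const_mat Q) $$ (i, j)) \<le> 1" if "i < ?m" "j < ?m" for i j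
    using that by (intro degree_mult_const_mat[OF Q(1) PL] degree_const_mat_mult[OF P(1) Lc] deg)
  moreover have "const_mat P * L * const_mat Q \<in> carrier_mat ?m ?m" using PL Q by simp
  ultimately show ?thesis unfolding is_linearization_def by blast
qed

lemma exists_nonzero_nonroot:
  fixes q :: "'a::{idom,ring_char_0} poly"
  assumes "q \<noteq> 0"
  shows "\<exists>z. z \<noteq> 0 \<and> poly q z \<noteq> 0"
proof -
  have "finite (insert 0 {z. poly q z = 0})" using assms by (simp add: poly_roots_finite)
  then have "insert 0 {z. poly q z = 0} \<noteq> UNIV" using infinite_UNIV_char_0 by metis
  then show ?thesis by auto
qed

lemma hom_poly_monom: "hom_poly k a = (\<Sum>i\<le>k. monom (monom (a i) (k - i)) i)"
proof -
  have 1: "var_lam ^ i = monom 1 i" for i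
    by (metis monom_altdef smult_1_left)
  have 2: "var_mu ^ i = [:monom 1 i:]" for i
    by (simp add: const_power monom_altdef)
  show ?thesis unfolding hom_poly_def 1 2
    by (rule sum.cong) (simp_all add: smult_monom mult.commute monom_altdef)
qed

lemma coeff_hom_poly: "coeff (hom_poly k a) i = (if i \<le> k then monom (a i) (k - i) else 0)"
  unfolding hom_poly_monom by (simp add: coeff_sum)

lemma dehom_hom_mat:
  assumes "\<And>i. i \<le> d \<Longrightarrow> A i \<in> carrier_mat n n"
  shows "dehom (hom_mat n d A) = mat_poly_at n d (\<lambda>i. const_mat (A i)) [:0, 1:]"
proof (rule eq_matI)
  fix k l assume "k < dim_row (mat_poly_at n d (\<lambda>i. const_mat (A i)) [:0, 1:])"
    "l < dim_col (mat_poly_at n d (\<lambda>i. const_mat (A i)) [:0, 1:])"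
  then have kl: "k < n" "l < n" by (simp_all add: mat_poly_at_def)
  have "map_poly (\<lambda>p. poly p 1) (hom_poly d a) = (\<Sum>i\<le>d. monom (a i) i)" for a
    by (rule poly_eqI) (simp add: coeff_map_poly coeff_hom_poly coeff_sum poly_monom)
  moreover have "(\<Sum>i\<le>d. monom (A i $$ (k, l)) i) = (\<Sum>i\<le>d. [:0, 1:] ^ i * const_mat (A i) $$ (k, l))"
  proof (rule sum.cong)
    fix i assume "i \<in> {..d}"
    then have "A i \<in> carrier_mat n n" by (intro assms) auto
    then show "monom (A i $$ (k, l)) i = [:0, 1:] ^ i * const_mat (A i) $$ (k, l)"
      using kl by (simp add: monom_altdef)
  qed simp
  ultimately show "dehom (hom_mat n d A) $$ (k, l) = mat_poly_at n d (\<lambda>i. const_mat (A i)) [:0, 1:] $$ (k, l)"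
    using kl by (simp add: dehom_def hom_mat_def mat_poly_at_def)
qed (simp_all add: dehom_def hom_mat_def mat_poly_at_def)

lemma rev_mat_dehom_hom_mat:
  assumes A: "\<And>i. i \<le> d \<Longrightarrow> A i \<in> carrier_mat n n"
  shows "rev_mat d (dehom (hom_mat n d A)) = dehom (hom_mat n d (\<lambda>i. A (d - i)))"
proof (rule eq_matI)
  fix k l assume "k < dim_row (dehom (hom_mat n d (\<lambda>i. A (d - i))))" "l < dim_col (dehom (hom_mat n d (\<lambda>i. A (d - i))))"
  then have kl: "k < n" "l < n" by (simp_all add: dehom_def hom_mat_def)
  then show "rev_mat d (dehom (hom_mat n d A)) $$ (k, l) = dehom (hom_mat n d (\<lambda>i. A (d - i))) $$ (k, l)"
    by (auto intro!: poly_eqI simp: rev_mat_def dehom_def hom_mat_def coeff_map_poly coeff_hom_poly coeff_sum poly_monom)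
qed (simp_all add: rev_mat_def dehom_def hom_mat_def)

text \<open>
  A nonzero polynomial in two variables has a nonzero value at some point with both coordinates
  nonzero, and by homogeneity \<open>A(\<lambda>, \<mu>)\<close> is there a multiple of \<open>A(\<lambda>/\<mu>)\<close>. A nonzero ratio
  \<open>c\<close> is wanted since the reversed polynomial has to be regular at \<open>1/c\<close>.
\<close>

lemma regular_at_nonzero_point:
  assumes "det (hom_mat n d A) \<noteq> 0"
  shows "\<exists>c. c \<noteq> 0 \<and> det (mat_poly_at n d A c) \<noteq> 0"
proof -
  let ?p = "det (hom_mat n d A)"
  obtain l m where lm: "l \<noteq> 0" "m \<noteq> 0" "poly (poly ?p [:l:]) m \<noteq> 0"
  proof -
    have "finite (insert 0 {l. poly ?p [:l:] = 0})"
    proof -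
      have "{l. poly ?p [:l:] = 0} = (\<lambda>l. [:l:]) -` {q. poly ?p q = 0}" by auto
      moreover have "finite ((\<lambda>l :: complex. [:l:]) -` {q. poly ?p q = 0})"
        by (rule finite_vimageI) (use assms in \<open>auto simp: poly_roots_finite inj_def\<close>)
      ultimately show ?thesis by simp
    qed
    then have "insert 0 {l. poly ?p [:l:] = 0} \<noteq> UNIV" using infinite_UNIV_char_0 by metis
    then obtain l where "l \<noteq> 0" "poly ?p [:l:] \<noteq> 0" by auto
    then show thesis using exists_nonzero_nonroot that by metis
  qed
  interpret ev: comm_ring_hom "\<lambda>p :: complex poly poly. poly (poly p [:l:]) m" by unfold_locales auto
  have "poly (poly (hom_poly d a) [:l:]) m = m ^ d * (\<Sum>i\<le>d. (l / m) ^ i * a i)" for a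
  proof -
    have "m ^ (d - i) = m ^ d / m ^ i" if "i \<le> d" for i using lm that by (simp add: power_diff)
    then show ?thesis
      by (simp add: hom_poly_monom poly_sum poly_monom const_power sum_distrib_left power_divide mult_ac)
  qed
  then have "map_mat (\<lambda>p. poly (poly p [:l:]) m) (hom_mat n d A) = m ^ d \<cdot>\<^sub>m mat_poly_at n d A (l / m)"
    by (intro eq_matI) (auto simp: hom_mat_def mat_poly_at_def)
  then have "poly (poly ?p [:l:]) m = det (m ^ d \<cdot>\<^sub>m mat_poly_at n d A (l / m))"
    using ev.hom_det[of "hom_mat n d A"] by simp
  then have "det (mat_poly_at n d A (l / m)) \<noteq> 0" using lm by auto
  then show ?thesis using lm by (intro exI[of _ "l / m"]) simp
qed

lemma det_mat_poly_at_reverse: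
  assumes "c \<noteq> 0" "det (mat_poly_at n d A c) \<noteq> (0 :: complex)"
  shows "det (mat_poly_at n d (\<lambda>i. A (d - i)) (1 / c)) \<noteq> 0"
proof -
  have "mat_poly_at n d A c = c ^ d \<cdot>\<^sub>m mat_poly_at n d (\<lambda>i. A (d - i)) (1 / c)"
  proof (rule eq_matI)
    fix k l assume "k < dim_row (c ^ d \<cdot>\<^sub>m mat_poly_at n d (\<lambda>i. A (d - i)) (1 / c))"
      "l < dim_col (c ^ d \<cdot>\<^sub>m mat_poly_at n d (\<lambda>i. A (d - i)) (1 / c))"
    then have kl: "k < n" "l < n" by (simp_all add: mat_poly_at_def)
    have "(\<Sum>i\<le>d. c ^ i * A i $$ (k, l)) = (\<Sum>i\<le>d. c ^ (d - i) * A (d - i) $$ (k, l))"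
      by (rule sum.reindex_bij_witness[of _ "\<lambda>i. d - i" "\<lambda>i. d - i"]) auto
    also have "\<dots> = (\<Sum>i\<le>d. c ^ d * ((1 / c) ^ i * A (d - i) $$ (k, l)))"
      by (rule sum.cong) (use assms in \<open>auto simp: power_diff power_divide\<close>)
    finally show "mat_poly_at n d A c $$ (k, l) = (c ^ d \<cdot>\<^sub>m mat_poly_at n d (\<lambda>i. A (d - i)) (1 / c)) $$ (k, l)"
      using kl by (simp add: mat_poly_at_def sum_distrib_left)
  qed (simp_all add: mat_poly_at_def)
  then show ?thesis using assms by auto
qed

definition block_reverse :: "nat \<Rightarrow> nat \<Rightarrow> nat \<Rightarrow> nat" where
  "block_reverse n d s = (d - 1 - s div n) * n + s mod n"

lemma block_reverse:
  assumes "n \<ge> 1" "s < d * n"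
  shows "block_reverse n d s < d * n" "block_reverse n d (block_reverse n d s) = s"
    "block_reverse n d s div n = d - 1 - s div n" "block_reverse n d s mod n = s mod n"
proof -
  have j: "s div n < d" using assms by (simp add: less_mult_imp_div_less)
  then have "d - 1 - s div n < d" by simp
  then show "block_reverse n d s < d * n" unfolding block_reverse_def using assms by (intro block_index_less) auto
  show 1: "block_reverse n d s div n = d - 1 - s div n" "block_reverse n d s mod n = s mod n"
    unfolding block_reverse_def using assms by auto
  show "block_reverse n d (block_reverse n d s) = s"
    unfolding block_reverse_def[of n d "block_reverse n d s"] 1 using j by simp
qed

lemma sum_block_reverse:
  fixes f :: "nat \<Rightarrow> 'a::comm_monoid_add"
  assumes "n \<ge> 1"
  shows "(\<Sum>s<d * n. f (block_reverse n d s)) = (\<Sum>s<d * n. f s)"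
  by (rule sum.reindex_bij_witness[of _ "block_reverse n d" "block_reverse n d"])
     (use assms block_reverse in auto)

text \<open>
  A common form for a pencil, with \<open>(a, b) = (1, - x)\<close>, and for its reversal, with \<open>(a, b) = (x, - 1)\<close>: a
  change of bases acts on both in the same way.
\<close>

definition linear_pencil :: "complex poly \<Rightarrow> complex poly \<Rightarrow> complex mat \<Rightarrow> complex mat \<Rightarrow> complex poly mat" where
  "linear_pencil a b L0 L1 = a \<cdot>\<^sub>m const_mat L0 + b \<cdot>\<^sub>m const_mat L1"

lemma dehom_pencil:
  assumes "L0 \<in> carrier_mat m m" "L1 \<in> carrier_mat m m"
  shows "dehom (pencil L0 L1) = linear_pencil 1 (- [:0, 1:]) L0 L1"
  by (rule eq_matI) (use assms in \<open>auto intro!: poly_eqI simp: dehom_def pencil_def linear_pencil_def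
      coeff_map_poly coeff_pCons split: nat.split\<close>)

lemma rev_mat_dehom_pencil:
  assumes "L0 \<in> carrier_mat m m" "L1 \<in> carrier_mat m m"
  shows "rev_mat 1 (dehom (pencil L0 L1)) = linear_pencil [:0, 1:] (- 1) L0 L1"
  unfolding dehom_pencil[OF assms]
  by (rule eq_matI) (use assms in \<open>auto intro!: poly_eqI simp: rev_mat_def linear_pencil_def
      coeff_sum coeff_pCons split: nat.split\<close>)

lemma linear_pencil_equivalent:
  assumes P: "P \<in> carrier_mat m m" and Q: "Q \<in> carrier_mat m m"
    and L: "L0 \<in> carrier_mat m m" "L1 \<in> carrier_mat m m"
  shows "linear_pencil a b (P * L0 * Q) (P * L1 * Q) = const_mat P * linear_pencil a b L0 L1 * const_mat Q"
proof -
  have "const_mat P * (t \<cdot>\<^sub>m const_mat M) * const_mat Q = t \<cdot>\<^sub>m const_mat (P * M * Q)"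
    if "M \<in> carrier_mat m m" for M t
    using that P Q by (simp add: const.mat_hom_mult[of _ m m _ m] mult_smult_distrib[of _ m m _ m] mult_smult_assoc_mat[of _ m m _ m])
  then show ?thesis unfolding linear_pencil_def using P Q L
    by (simp add: mult_add_distrib_mat[of _ m m _ m] add_mult_distrib_mat[of _ m m _ _ m])
qed

lemma shift_pencil_linear_pencil:
  fixes W :: "complex mat"
  assumes "n \<ge> 1" "W \<in> carrier_mat p ((d + 1) * n)"
    and W0: "W0 = mat p (d * n) (\<lambda>(r, s). W $$ (r, s + n))" and W1: "W1 = mat p (d * n) (\<lambda>(r, s). W $$ (r, s))"
  shows "shift_pencil n d x (const_mat W) = linear_pencil 1 (- x) W0 W1"
  unfolding W0 W1 by (rule eq_matI) (use assms in \<open>auto simp: shift_pencil_def linear_pencil_def\<close>)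

text \<open>
  Reversal of the blocks exchanges the first \<open>d\<close> and the last \<open>d\<close> blocks, so it exchanges \<open>W\<^sub>0\<close> and \<open>W\<^sub>1\<close>
  up to the order of columns; the sign in \<open>J\<close> turns \<open>W\<^sub>1 - x W\<^sub>0\<close> into the reversed pencil \<open>x W\<^sub>0 - W\<^sub>1\<close>.
\<close>

lemma reversed_shift_pencil:
  fixes W :: "complex mat"
  assumes n: "n \<ge> 1" and W: "W \<in> carrier_mat p ((d + 1) * n)"
    and W0: "W0 = mat p (d * n) (\<lambda>(r, s). W $$ (r, s + n))" and W1: "W1 = mat p (d * n) (\<lambda>(r, s). W $$ (r, s))"
  defines "W' \<equiv> mat p ((d + 1) * n) (\<lambda>(r, s). W $$ (r, block_reverse n (d + 1) s))"
    and "J \<equiv> mat (d * n) (d * n) (\<lambda>(s, t). if s = block_reverse n d t then - 1 else 0)"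
  shows "linear_pencil x (- 1) W0 W1 = shift_pencil n d x (const_mat W') * const_mat J"
proof (rule eq_matI)
  fix r t assume "r < dim_row (shift_pencil n d x (const_mat W') * const_mat J)"
    "t < dim_col (shift_pencil n d x (const_mat W') * const_mat J)"
  then have r: "r < p" and t: "t < d * n" by (simp_all add: shift_pencil_def W'_def J_def)
  let ?u = "block_reverse n d t"
  have u: "?u < d * n" "?u div n = d - 1 - t div n" "?u mod n = t mod n"
    using block_reverse[OF n t] by auto
  have j: "t div n < d" using t by (simp add: less_mult_imp_div_less)
  have W': "W' \<in> carrier_mat p ((d + 1) * n)" by (simp add: W'_def)
  have J: "J \<in> carrier_mat (d * n) (d * n)" by (simp add: J_def)
  have b0: "block_reverse n (d + 1) (?u + n) = t"
  proof -
    have q: "(?u + n) div n = d - t div n" "(?u + n) mod n = t mod n" using n j u by simp_all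
    show ?thesis unfolding block_reverse_def[of n "d + 1"] q using j by simp
  qed
  have "block_reverse n (d + 1) ?u = (t div n + 1) * n + t mod n"
    unfolding block_reverse_def[of n "d + 1"] u using j by simp
  then have b1: "block_reverse n (d + 1) ?u = t + n" by (simp add: algebra_simps)
  have "(shift_pencil n d x (const_mat W') * const_mat J) $$ (r, t)
      = (\<Sum>s<d * n. shift_pencil n d x (const_mat W') $$ (r, s) * const_mat J $$ (s, t))"
    by (rule mult_mat_entry[of _ p _ _ "d * n"]) (use W' J r t in auto)
  also have "\<dots> = (\<Sum>s<d * n. if s = ?u then - shift_pencil n d x (const_mat W') $$ (r, s) else 0)"
    by (rule sum.cong) (use t in \<open>auto simp: J_def\<close>)
  also have "\<dots> = - shift_pencil n d x (const_mat W') $$ (r, ?u)" using u by simp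
  also have "\<dots> = x * [:W $$ (r, t + n):] - [:W $$ (r, t):]"
    using r u b0 b1 by (simp add: shift_pencil_def W'_def)
  finally show "linear_pencil x (- 1) W0 W1 $$ (r, t) = (shift_pencil n d x (const_mat W') * const_mat J) $$ (r, t)"
    using r t by (simp add: linear_pencil_def W0 W1)
qed (simp_all add: linear_pencil_def W0 W1 shift_pencil_def W'_def J_def)

text \<open>
  The matrices \<open>P\<close> and \<open>Q\<close> account for arbitrary bases. The reversed half is the same
  linearization result for the block reversal of \<open>W\<close>, which annihilates the coefficients in reversed order.
\<close>

lemma is_strong_linearization_annihilator_pencil:
  fixes A :: "nat \<Rightarrow> complex mat" and W Z P Q :: "complex mat"
  assumes n: "n \<ge> 1" and d: "d \<ge> 1"
    and A: "\<And>i. i \<le> d \<Longrightarrow> A i \<in> carrier_mat n n"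
    and W: "W \<in> carrier_mat (d * n) ((d + 1) * n)"
    and Z: "Z \<in> carrier_mat ((d + 1) * n) (d * n)" "W * Z = 1\<^sub>m (d * n)"
    and WA: "W * stack n d A = 0\<^sub>m (d * n) n"
    and reg: "det (hom_mat n d A) \<noteq> 0"
    and W0: "W0 = mat (d * n) (d * n) (\<lambda>(r, s). W $$ (r, s + n))"
    and W1: "W1 = mat (d * n) (d * n) (\<lambda>(r, s). W $$ (r, s))"
    and P: "P \<in> carrier_mat (d * n) (d * n)" "det P \<noteq> 0" and Q: "Q \<in> carrier_mat (d * n) (d * n)" "det Q \<noteq> 0"
  shows "is_strong_linearization n d (dehom (pencil (P * W0 * Q) (P * W1 * Q))) (dehom (hom_mat n d A))"
proof -
  let ?m = "d * n" and ?x = "[:0, 1:] :: complex poly"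
  obtain c where c: "c \<noteq> 0" "det (mat_poly_at n d A c) \<noteq> 0" using regular_at_nonzero_point[OF reg] by blast
  have Wc: "W0 \<in> carrier_mat ?m ?m" "W1 \<in> carrier_mat ?m ?m" by (simp_all add: W0 W1)
  then have PWQ: "P * W0 * Q \<in> carrier_mat ?m ?m" "P * W1 * Q \<in> carrier_mat ?m ?m" using P Q by auto
  have dh: "dehom (hom_mat n d B) \<in> carrier_mat n n" for B by (simp add: dehom_def hom_mat_def)
  have e: "dehom (hom_mat n d B) = mat_poly_at n d (\<lambda>i. const_mat (B i)) ?x"
    if "\<And>i. i \<le> d \<Longrightarrow> B i \<in> carrier_mat n n" for B
    by (rule dehom_hom_mat) (rule that)
  have eA: "dehom (hom_mat n d A) = mat_poly_at n d (\<lambda>i. const_mat (A i)) ?x" by (rule e) (rule A)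
  have er: "rev_mat d (dehom (hom_mat n d A)) = dehom (hom_mat n d (\<lambda>i. A (d - i)))"
    by (rule rev_mat_dehom_hom_mat) (rule A)
  have "is_linearization n d (linear_pencil 1 (- ?x) W0 W1) (dehom (hom_mat n d A))"
    unfolding eA shift_pencil_linear_pencil[OF n W W0 W1, symmetric]
    by (rule is_linearization_shift_pencil[OF n d A W Z WA c(2)])
  then have "is_linearization n d (dehom (pencil (P * W0 * Q) (P * W1 * Q))) (dehom (hom_mat n d A))"
    unfolding dehom_pencil[OF PWQ] linear_pencil_equivalent[OF P(1) Q(1) Wc]
    by (rule is_linearization_const_equivalent[OF _ dh d P Q])
  moreover have "is_linearization n d (rev_mat 1 (dehom (pencil (P * W0 * Q) (P * W1 * Q))))
    (rev_mat d (dehom (hom_mat n d A)))"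
  proof -
    define A' where "A' i = A (d - i)" for i
    define W' where "W' = mat ?m ((d + 1) * n) (\<lambda>(r, s). W $$ (r, block_reverse n (d + 1) s))"
    define Z' where "Z' = mat ((d + 1) * n) ?m (\<lambda>(s, t). Z $$ (block_reverse n (d + 1) s, t))"
    define J where "J = mat ?m ?m (\<lambda>(s, t). if s = block_reverse n d t then - 1 else 0 :: complex)"
    have carr: "W' \<in> carrier_mat ?m ((d + 1) * n)" "Z' \<in> carrier_mat ((d + 1) * n) ?m" "J \<in> carrier_mat ?m ?m"
      by (simp_all add: W'_def Z'_def J_def)
    have A': "A' i \<in> carrier_mat n n" if "i \<le> d" for i unfolding A'_def by (rule A) simp
    note br = block_reverse[OF n, of _ "d + 1"]
    have WZ: "W' * Z' = 1\<^sub>m ?m"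
      unfolding Z(2)[symmetric]
    proof (rule eq_matI)
      fix r t assume "r < dim_row (W * Z)" "t < dim_col (W * Z)"
      then have rt: "r < ?m" "t < ?m" using W Z by auto
      have "(W' * Z') $$ (r, t) = (\<Sum>s<(d + 1) * n. W $$ (r, block_reverse n (d + 1) s) * Z $$ (block_reverse n (d + 1) s, t))"
        unfolding mult_mat_entry[OF carr(1,2) rt] by (rule sum.cong) (use rt in \<open>auto simp: W'_def Z'_def\<close>)
      also have "\<dots> = (W * Z) $$ (r, t)"
        unfolding sum_block_reverse[OF n, of "\<lambda>s. W $$ (r, s) * Z $$ (s, t)"] mult_mat_entry[OF W Z(1) rt] ..
      finally show "(W' * Z') $$ (r, t) = (W * Z) $$ (r, t)" .
    qed (use carr W Z in auto)
    have WA': "W' * stack n d A' = 0\<^sub>m ?m n"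
      unfolding WA[symmetric]
    proof (rule eq_matI)
      fix r t assume "r < dim_row (W * stack n d A)" "t < dim_col (W * stack n d A)"
      then have rt: "r < ?m" "t < n" using W by (auto simp: stack_def)
      have "(W' * stack n d A') $$ (r, t)
          = (\<Sum>s<(d + 1) * n. W $$ (r, block_reverse n (d + 1) s) * stack n d A $$ (block_reverse n (d + 1) s, t))"
        unfolding mult_mat_entry[OF carr(1) stack_carrier rt]
        by (rule sum.cong) (use rt br in \<open>auto simp: W'_def stack_def A'_def\<close>)
      also have "\<dots> = (W * stack n d A) $$ (r, t)"
        unfolding sum_block_reverse[OF n, of "\<lambda>s. W $$ (r, s) * stack n d A $$ (s, t)"]
          mult_mat_entry[OF W stack_carrier rt] ..
      finally show "(W' * stack n d A') $$ (r, t) = (W * stack n d A) $$ (r, t)" .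
    qed (use carr W in \<open>auto simp: stack_def\<close>)
    have "J * J = 1\<^sub>m ?m"
    proof (rule eq_matI)
      fix s t assume "s < dim_row (1\<^sub>m ?m)" "t < dim_col (1\<^sub>m ?m)"
      then have st: "s < ?m" "t < ?m" by auto
      have "(J * J) $$ (s, t) = (\<Sum>u<?m. if u = block_reverse n d t then (if s = block_reverse n d u then 1 else 0) else 0)"
        unfolding mult_mat_entry[OF carr(3,3) st] by (rule sum.cong) (use st in \<open>auto simp: J_def\<close>)
      then show "(J * J) $$ (s, t) = 1\<^sub>m ?m $$ (s, t)" using st block_reverse[OF n st(2)] by simp
    qed (use carr in auto)
    then have "det J * det J = 1" using det_mult[OF carr(3,3)] by simp
    then have J: "det J \<noteq> 0" by auto
    have eA': "dehom (hom_mat n d A') = mat_poly_at n d (\<lambda>i. const_mat (A' i)) ?x" by (rule e) (rule A')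
    have lin: "is_linearization n d (shift_pencil n d ?x (const_mat W')) (dehom (hom_mat n d A'))"
      unfolding eA' using det_mat_poly_at_reverse[OF c]
      by (intro is_linearization_shift_pencil[OF n d A' carr(1,2) WZ WA', of "1 / c"]) (simp_all add: A'_def[abs_def])
    have "linear_pencil ?x (- 1) W0 W1 = const_mat (1\<^sub>m ?m) * shift_pencil n d ?x (const_mat W') * const_mat J"
    proof -
      have "const_mat (1\<^sub>m ?m) * shift_pencil n d ?x (const_mat W') = shift_pencil n d ?x (const_mat W')"
        unfolding const.mat_hom_one by (rule left_mult_one_mat[of _ ?m ?m]) (use carr in simp)
      then show ?thesis using reversed_shift_pencil[OF n W W0 W1, of ?x] unfolding W'_def J_def by simp
    qed
    then have "is_linearization n d (linear_pencil ?x (- 1) W0 W1) (dehom (hom_mat n d A'))"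
      using is_linearization_const_equivalent[OF lin dh d _ _ carr(3) J, of "1\<^sub>m ?m"] by simp
    then show ?thesis
      unfolding rev_mat_dehom_pencil[OF PWQ] linear_pencil_equivalent[OF P(1) Q(1) Wc]
        er A'_def[abs_def, symmetric]
      by (rule is_linearization_const_equivalent[OF _ dh d P Q])
  qed
  ultimately show ?thesis unfolding is_strong_linearization_def by blast
qed

section \<open>Bases as invertible matrices\<close>


lemma linear_mapI:
  "vectorspace K V \<Longrightarrow> vectorspace K W \<Longrightarrow> T \<in> LinearCombinations.module_hom K V W \<Longrightarrow> linear_map K V W T"
  unfolding linear_map_def mod_hom_def mod_hom_axioms_def vectorspace_def by blast

lemma finsum_linear_image:
  fixes g :: "nat \<Rightarrow> complex vec"
  assumes lin: "linear_map class_ring (module_vec TYPE(complex) m) V T"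
    and g: "\<And>i. i < k \<Longrightarrow> g i \<in> carrier_vec m"
  shows "(\<Oplus>\<^bsub>V\<^esub> i \<in> {..<k}. c i \<odot>\<^bsub>V\<^esub> T (g i)) = T (vec m (\<lambda>r. \<Sum>i<k. c i * g i $ r))"
proof -
  interpret V: vectorspace class_ring V using lin by (simp add: linear_map_def)
  interpret T: linear_map class_ring "module_vec TYPE(complex) m" V T by (rule lin)
  show ?thesis using g
  proof (induction k)
    case 0
    have "vec m (\<lambda>r. 0) = \<zero>\<^bsub>module_vec TYPE(complex) m\<^esub>" by (auto simp: module_vec_simps)
    then show ?case using T.T0_is_0 by simp
  next
    case (Suc k)
    have cl: "T v \<in> carrier V" if "v \<in> carrier_vec m" for v
      using T.T_im[of v] that by (simp add: module_vec_simps)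
    have sm: "c i \<odot>\<^bsub>V\<^esub> T v = T (c i \<cdot>\<^sub>v v)" if "v \<in> carrier_vec m" for v i
      using T.T_smult[of "c i" v] that by (simp add: module_vec_simps class_ring_simps)
    have sc: "c i \<odot>\<^bsub>V\<^esub> T v \<in> carrier V" if "v \<in> carrier_vec m" for v i
      unfolding sm[OF that] using that by (intro cl) simp
    have "(\<Oplus>\<^bsub>V\<^esub> i \<in> {..<Suc k}. c i \<odot>\<^bsub>V\<^esub> T (g i))
        = c k \<odot>\<^bsub>V\<^esub> T (g k) \<oplus>\<^bsub>V\<^esub> (\<Oplus>\<^bsub>V\<^esub> i \<in> {..<k}. c i \<odot>\<^bsub>V\<^esub> T (g i))"
      unfolding lessThan_Suc
    proof (rule V.M.finsum_insert)
      show "(\<lambda>i. c i \<odot>\<^bsub>V\<^esub> T (g i)) \<in> {..<k} \<rightarrow> carrier V" using sc Suc.prems by auto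
      show "c k \<odot>\<^bsub>V\<^esub> T (g k) \<in> carrier V" using sc Suc.prems by auto
    qed auto
    also have "\<dots> = T (c k \<cdot>\<^sub>v g k) \<oplus>\<^bsub>V\<^esub> T (vec m (\<lambda>r. \<Sum>i<k. c i * g i $ r))"
      using Suc by (simp add: sm)
    also have "\<dots> = T (c k \<cdot>\<^sub>v g k + vec m (\<lambda>r. \<Sum>i<k. c i * g i $ r))"
      using T.T_add[of "c k \<cdot>\<^sub>v g k" "vec m (\<lambda>r. \<Sum>i<k. c i * g i $ r)"] Suc.prems
      by (simp add: module_vec_simps)
    also have "c k \<cdot>\<^sub>v g k + vec m (\<lambda>r. \<Sum>i<k. c i * g i $ r) = vec m (\<lambda>r. \<Sum>i<Suc k. c i * g i $ r)"
      using Suc.prems[of k] by (intro eq_vecI) auto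
    finally show ?case .
  qed
qed

lemma ordered_basis_indexed_independent:
  assumes vs: "vectorspace class_ring V" and cs: "ordered_basis V cs"
    and sum0: "(\<Oplus>\<^bsub>V\<^esub> i \<in> {..<length cs}. c i \<odot>\<^bsub>V\<^esub> cs ! i) = \<zero>\<^bsub>V\<^esub>" and i: "i < length cs"
  shows "c i = 0"
proof -
  interpret V: vectorspace class_ring V by (rule vs)
  have dist: "distinct cs" and basis: "V.basis (set cs)" using cs by (auto simp: ordered_basis_def)
  have sub: "set cs \<subseteq> carrier V" and li: "V.lin_indpt (set cs)" using basis by (auto simp: V.basis_def)
  have inj: "inj_on ((!) cs) {..<length cs}" using dist by (simp add: inj_on_nth)
  have img: "(!) cs ` {..<length cs} = set cs" by (auto simp: set_conv_nth)
  define a where "a v = c (the_inv_into {..<length cs} ((!) cs) v)" for v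
  have a: "a (cs ! j) = c j" if "j < length cs" for j
    unfolding a_def using the_inv_into_f_f[OF inj, of j] that by simp
  have closed: "b v \<odot>\<^bsub>V\<^esub> v \<in> carrier V" if "v \<in> set cs" for b v
    using that sub by (intro V.smult_closed) (auto simp: class_ring_simps)
  have "V.lincomb a (set cs) = (\<Oplus>\<^bsub>V\<^esub> j \<in> {..<length cs}. a (cs ! j) \<odot>\<^bsub>V\<^esub> cs ! j)"
    unfolding V.lincomb_def img[symmetric]
    by (rule V.M.finsum_reindex[OF Pi_I inj]) (rule closed, simp add: img)
  also have "\<dots> = (\<Oplus>\<^bsub>V\<^esub> j \<in> {..<length cs}. c j \<odot>\<^bsub>V\<^esub> cs ! j)"
    by (rule V.M.finsum_cong'[OF refl Pi_I])
      (use closed[of _ "\<lambda>v. c _"] a in auto)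
  finally have "V.lincomb a (set cs) = \<zero>\<^bsub>V\<^esub>" using sum0 by simp
  then have "a \<in> set cs \<rightarrow> {\<zero>\<^bsub>class_ring\<^esub>}"
    using V.not_lindepD[OF li finite_set subset_refl] by (auto simp: class_ring_simps)
  then show ?thesis using a i by (auto simp: class_ring_simps Pi_iff)
qed

text \<open>
  Preimages of the basis vectors are the columns of \<open>P\<close>. A vector in the kernel of \<open>P\<close> holds the coefficients
  of a vanishing combination of the basis, so \<open>P\<close> is invertible; then every vector is \<open>P u\<close>, and the
  same argument shows that \<open>T\<close> is injective. The injectivity is part of the conclusion because for the
  space \<open>(A)\<close> only surjectivity and the dimension are known beforehand.
\<close>

lemma basis_coordinate_matrix:
  assumes lin: "linear_map class_ring (module_vec TYPE(complex) m) V T"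
    and surj: "T ` carrier_vec m = carrier V" and cs: "ordered_basis V cs" and len: "length cs = m"
  obtains P where "P \<in> carrier_mat m m" "det P \<noteq> 0" "\<And>j. j < m \<Longrightarrow> cs ! j = T (col P j)"
    "inj_on T (carrier_vec m)"
proof -
  interpret V: vectorspace class_ring V using lin by (simp add: linear_map_def)
  interpret T: linear_map class_ring "module_vec TYPE(complex) m" V T by (rule lin)
  have vs: "vectorspace class_ring V" by (rule V.vectorspace_axioms)
  have "\<exists>p. p \<in> carrier_vec m \<and> cs ! j = T p" if "j < m" for j
  proof -
    have "cs ! j \<in> carrier V"
      using cs that len unfolding ordered_basis_def V.basis_def by (meson nth_mem subsetD)
    then show ?thesis using surj by (metis imageE)
  qed
  then obtain p where p: "\<And>j. j < m \<Longrightarrow> p j \<in> carrier_vec m" "\<And>j. j < m \<Longrightarrow> cs ! j = T (p j)" by metis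
  define P where "P = mat m m (\<lambda>(r, j). p j $ r)"
  have P: "P \<in> carrier_mat m m" by (simp add: P_def)
  have col: "col P j = p j" if "j < m" for j using p(1)[OF that] that by (intro eq_vecI) (auto simp: P_def)
  have cl: "T v \<in> carrier V" if "v \<in> carrier_vec m" for v
    using T.T_im[of v] that by (simp add: module_vec_simps)
  have TP: "T (P *\<^sub>v u) = (\<Oplus>\<^bsub>V\<^esub> i \<in> {..<length cs}. u $ i \<odot>\<^bsub>V\<^esub> cs ! i)" if "u \<in> carrier_vec m" for u
  proof -
    have "(\<Oplus>\<^bsub>V\<^esub> i \<in> {..<m}. u $ i \<odot>\<^bsub>V\<^esub> T (p i)) = T (vec m (\<lambda>r. \<Sum>i<m. u $ i * p i $ r))"
      by (rule finsum_linear_image[OF lin p(1)])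
    also have "vec m (\<lambda>r. \<Sum>i<m. u $ i * p i $ r) = P *\<^sub>v u"
      using that by (intro eq_vecI) (auto simp: P_def scalar_prod_def lessThan_atLeast0 mult.commute intro!: sum.cong)
    also have "(\<Oplus>\<^bsub>V\<^esub> i \<in> {..<m}. u $ i \<odot>\<^bsub>V\<^esub> T (p i)) = (\<Oplus>\<^bsub>V\<^esub> i \<in> {..<length cs}. u $ i \<odot>\<^bsub>V\<^esub> cs ! i)"
      unfolding len
    proof (rule V.M.finsum_cong')
      show "(\<lambda>i. u $ i \<odot>\<^bsub>V\<^esub> cs ! i) \<in> {..<m} \<rightarrow> carrier V"
      proof (rule Pi_I)
        fix i assume "i \<in> {..<m}"
        then have "cs ! i \<in> carrier V" using cl p by simp
        then show "u $ i \<odot>\<^bsub>V\<^esub> cs ! i \<in> carrier V" by (intro V.smult_closed) (simp add: class_ring_simps)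
      qed
    qed (use p in auto)
    finally show ?thesis by simp
  qed
  have T0: "T (0\<^sub>v m) = \<zero>\<^bsub>V\<^esub>" using T.T0_is_0 by (simp add: module_vec_simps)
  have ker: "u = 0\<^sub>v m" if "u \<in> carrier_vec m" "T (P *\<^sub>v u) = \<zero>\<^bsub>V\<^esub>" for u
  proof (rule eq_vecI)
    fix i assume "i < dim_vec (0\<^sub>v m :: complex vec)"
    then have i: "i < m" by simp
    have "u $ i = 0"
    proof (rule ordered_basis_indexed_independent[OF vs cs])
      show "(\<Oplus>\<^bsub>V\<^esub> i \<in> {..<length cs}. u $ i \<odot>\<^bsub>V\<^esub> cs ! i) = \<zero>\<^bsub>V\<^esub>"
        using TP[OF that(1)] that(2) by simp
    qed (simp add: i len)
    then show "u $ i = 0\<^sub>v m $ i" using i by simp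
  qed (use that in simp)
  have det: "det P \<noteq> 0"
  proof
    assume "det P = 0"
    then obtain u where "u \<in> carrier_vec m" "u \<noteq> 0\<^sub>v m" "P *\<^sub>v u = 0\<^sub>v m"
      using det_0_iff_vec_prod_zero_field[OF P] by auto
    then show False using ker[of u] T0 by simp
  qed
  obtain N where N: "N \<in> carrier_mat m m" "P * N = 1\<^sub>m m" using obtain_inverse[OF P det] by metis
  have zero: "v = 0\<^sub>v m" if "v \<in> carrier_vec m" "T v = \<zero>\<^bsub>V\<^esub>" for v
  proof -
    have "v = P *\<^sub>v (N *\<^sub>v v)"
      using P N that by (simp add: assoc_mult_mat_vec[symmetric, of _ m m _ m])
    then show ?thesis using ker[of "N *\<^sub>v v"] that N P by auto
  qed
  have "inj_on T (carrier (module_vec TYPE(complex) m))"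
  proof (rule T.Ke0_imp_inj)
    show "carrier (T.V.vs T.kerT) = {\<zero>\<^bsub>module_vec TYPE(complex) m\<^esub>}"
      using zero T0 by (auto simp: T.mod_hom.ker_def module_vec_simps)
  qed
  then have "inj_on T (carrier_vec m)" by (simp add: module_vec_simps)
  then show thesis using that P det p(2) col by metis
qed

text \<open>
  A maximal independent set of columns has as many elements as the space has dimensions, so
  the columns span it, and each unit vector has a preimage.
\<close>

lemma full_row_rank_right_inverse:
  fixes W :: "complex mat"
  assumes W: "W \<in> carrier_mat m q" and rank: "vec_space.rank m W = m"
  obtains Z where "Z \<in> carrier_mat q m" "W * Z = 1\<^sub>m m"
proof -
  interpret vec_space "TYPE(complex)" m .
  let ?C = "set (cols W)"
  have sub: "?C \<subseteq> carrier_vec m" using W cols_dim by blast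
  obtain U where U: "finite U" "maximal U (\<lambda>S. S \<subseteq> ?C \<and> lin_indpt S)"
    using maximal_exists_superset[of ?C "\<lambda>S. S \<subseteq> ?C \<and> lin_indpt S" "{}"] unit_vecs_basis
    by (metis (no_types, lifting) empty_subsetI finite_set basis_def subset_li_is_li)
  have "card U = m" using rank_card_indpt[OF W U(2)] rank by simp
  moreover have Us: "U \<subseteq> ?C" "lin_indpt U" using U(2) by (auto simp: maximal_def)
  ultimately have "basis U"
    using U(1) sub by (intro dim_li_is_basis) (auto simp: dim_is_n)
  then have "span U = carrier_vec m" by (simp add: basis_def)
  then have "col_space W = carrier_vec m"
    unfolding col_space_def using span_is_monotone[OF Us(1)] span_closed[OF sub] by (auto simp: subset_antisym)
  then have "\<exists>x \<in> carrier_vec q. W *\<^sub>v x = unit_vec m j" for j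
    using col_space_eq[OF W] W unit_vec_carrier[of m j] by auto
  then obtain z where z: "\<And>j. z j \<in> carrier_vec q" "\<And>j. W *\<^sub>v z j = unit_vec m j" by metis
  define Z where "Z = mat_of_cols q (map z [0..<m])"
  have "W * Z = 1\<^sub>m m"
  proof (rule mat_col_eqI)
    fix j assume "j < dim_col (1\<^sub>m m)"
    then have j: "j < m" by simp
    have "col (W * Z) j = W *\<^sub>v col Z j" using j W by (intro col_mult2[of _ m q _ m]) (auto simp: Z_def)
    also have "col Z j = z j" using j z by (auto simp: Z_def)
    finally show "col (W * Z) j = col (1\<^sub>m m) j" using z j by simp
  qed (use W in \<open>auto simp: Z_def\<close>)
  moreover have "Z \<in> carrier_mat q m"
    using mat_of_cols_carrier(1)[of q "map z [0..<m]"] by (simp add: Z_def)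
  ultimately show thesis using that by blast
qed

text \<open>
  The square matrix \<open>K = [X, Z]\<close> is injective: applying \<open>W\<close> to \<open>X u + Z v = 0\<close> gives \<open>v = 0\<close>, and then
  \<open>u = 0\<close>. So \<open>K\<close> is surjective, and applying \<open>W\<close> to \<open>z = X u + Z v\<close> shows that \<open>v = W z\<close>. The
  shape of \<open>K\<close>, with as many rows as columns, takes the place of a dimension count.
\<close>

lemma kernel_eq_column_space:
  fixes W X Z :: "'a::field mat"
  assumes W: "W \<in> carrier_mat m (n + m)" and Z: "Z \<in> carrier_mat (n + m) m" "W * Z = 1\<^sub>m m"
    and X: "X \<in> carrier_mat (n + m) n" "W * X = 0\<^sub>m m n"
    and inj: "\<And>u. u \<in> carrier_vec n \<Longrightarrow> X *\<^sub>v u = 0\<^sub>v (n + m) \<Longrightarrow> u = 0\<^sub>v n"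
    and z: "z \<in> carrier_vec (n + m)" "W *\<^sub>v z = 0\<^sub>v m"
  shows "\<exists>u \<in> carrier_vec n. z = X *\<^sub>v u"
proof -
  define K where "K = mat (n + m) (n + m) (\<lambda>(r, c). if c < n then X $$ (r, c) else Z $$ (r, c - n))"
  define top bot where "top w = vec n (\<lambda>i. w $ i)" and "bot w = vec m (\<lambda>i. w $ (i + n))" for w :: "'a vec"
  have K: "K \<in> carrier_mat (n + m) (n + m)" by (simp add: K_def)
  have tb: "top w \<in> carrier_vec n" "bot w \<in> carrier_vec m" for w by (simp_all add: top_def bot_def)
  have Kw: "K *\<^sub>v w = X *\<^sub>v top w + Z *\<^sub>v bot w" if "w \<in> carrier_vec (n + m)" for w
  proof (rule eq_vecI)
    fix r assume "r < dim_vec (X *\<^sub>v top w + Z *\<^sub>v bot w)"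
    then have r: "r < n + m" using Z by simp
    have "(K *\<^sub>v w) $ r = (\<Sum>c<n + m. K $$ (r, c) * w $ c)"
      using r K that by (auto simp: scalar_prod_def lessThan_atLeast0 intro!: sum.cong)
    also have "\<dots> = (X *\<^sub>v top w + Z *\<^sub>v bot w) $ r"
      unfolding sum_lessThan_add using r X(1) Z(1)
      by (auto simp: K_def top_def bot_def scalar_prod_def lessThan_atLeast0 intro!: arg_cong2[of _ _ _ _ "(+)"] sum.cong)
    finally show "(K *\<^sub>v w) $ r = (X *\<^sub>v top w + Z *\<^sub>v bot w) $ r" .
  qed (use K Z in auto)
  have WK: "W *\<^sub>v (K *\<^sub>v w) = bot w" if "w \<in> carrier_vec (n + m)" for w
  proof -
    have "W *\<^sub>v (K *\<^sub>v w) = W *\<^sub>v (X *\<^sub>v top w) + W *\<^sub>v (Z *\<^sub>v bot w)"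
      unfolding Kw[OF that] by (rule mult_add_distrib_mat_vec[OF W]) (use X Z tb in auto)
    also have "\<dots> = (W * X) *\<^sub>v top w + (W * Z) *\<^sub>v bot w"
      using assoc_mult_mat_vec[OF W X(1) tb(1)] assoc_mult_mat_vec[OF W Z(1) tb(2)] by simp
    also have "\<dots> = bot w" unfolding X(2) Z(2) using tb[of w] by (intro eq_vecI) auto
    finally show ?thesis .
  qed
  have Kinj: "w = 0\<^sub>v (n + m)" if "w \<in> carrier_vec (n + m)" "K *\<^sub>v w = 0\<^sub>v (n + m)" for w
  proof -
    have b: "bot w = 0\<^sub>v m" using WK[OF that(1)] that(2) W by (metis eq_vecI index_mult_mat_vec carrier_matD index_zero_vec(2) index_zero_vec(1) dim_mult_mat_vec scalar_prod_right_zero row_carrier_vec)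
    then have "X *\<^sub>v top w = 0\<^sub>v (n + m)"
      using Kw[OF that(1)] that(2) X Z tb[of w] by (intro eq_vecI) (auto dest!: arg_cong[of _ _ "\<lambda>v. v $ _"])
    then have t: "top w = 0\<^sub>v n" using inj tb by blast
    show ?thesis
    proof (rule eq_vecI)
      fix i assume "i < dim_vec (0\<^sub>v (n + m) :: 'a vec)"
      then have i: "i < n + m" by simp
      show "w $ i = 0\<^sub>v (n + m) $ i"
      proof (cases "i < n")
        case True
        then show ?thesis using arg_cong[OF t, of "\<lambda>v. v $ i"] i by (simp add: top_def)
      next
        case False
        then have "i - n + n = i" by simp
        then show ?thesis using arg_cong[OF b, of "\<lambda>v. v $ (i - n)"] i False by (simp add: bot_def)
      qed
    qed (use that in simp)
  qed
  have "det K \<noteq> 0" using det_0_iff_vec_prod_zero_field[OF K] Kinj by blast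
  then obtain N where N: "N \<in> carrier_mat (n + m) (n + m)" "K * N = 1\<^sub>m (n + m)"
    using obtain_inverse[OF K] by metis
  define w where "w = N *\<^sub>v z"
  have w: "w \<in> carrier_vec (n + m)" using N z by (simp add: w_def)
  have zK: "z = K *\<^sub>v w" unfolding w_def using K N z by (simp add: assoc_mult_mat_vec[symmetric, of _ "n + m" "n + m" _ "n + m"])
  then have b: "bot w = 0\<^sub>v m" using WK[OF w] z by simp
  have "Z *\<^sub>v 0\<^sub>v m = 0\<^sub>v (n + m)" using Z by (intro eq_vecI) auto
  then have "z = X *\<^sub>v top w" using zK Kw[OF w] b X(1) tb[of w] by simp
  then show ?thesis using tb by blast
qed

section \<open>Coordinates of the quotient\<close>


lemma block_index_le: "i \<le> k \<Longrightarrow> r < n \<Longrightarrow> i * n + r < (k + 1) * n" for i k r n :: nat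
  by (rule block_index_less) auto

text \<open>
  The homogeneous polynomial vector with given coordinates in the monomial basis; block \<open>i\<close> holds the
  coefficient of \<open>\<lambda>\<^sup>i \<mu>\<^sup>k\<^sup>-\<^sup>i\<close>.
\<close>

definition poly_vec :: "nat \<Rightarrow> nat \<Rightarrow> complex vec \<Rightarrow> complex poly poly vec" where
  "poly_vec n k z = hom_vec n k (\<lambda>i. vec n (\<lambda>r. z $ (i * n + r)))"

lemma hom_vec_cong: "(\<And>i. i \<le> k \<Longrightarrow> a i = b i) \<Longrightarrow> hom_vec n k a = hom_vec n k b"
  unfolding hom_vec_def by (intro eq_vecI) (auto intro!: hom_poly_cong)

lemma poly_vec_hom:
  "poly_vec n k \<in> LinearCombinations.module_hom class_ring (module_vec TYPE(complex) ((k + 1) * n)) (hom_space n k)"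
  unfolding LinearCombinations.module_hom_def mem_Collect_eq
proof (intro conjI allI impI)
  show "poly_vec n k \<in> carrier (module_vec TYPE(complex) ((k + 1) * n)) \<rightarrow> carrier (hom_space n k)"
    by (auto simp: hom_space_def poly_vec_def)
next
  fix v w assume "v \<in> carrier (module_vec TYPE(complex) ((k + 1) * n)) \<and> w \<in> carrier (module_vec TYPE(complex) ((k + 1) * n))"
  then have vw: "v \<in> carrier_vec ((k + 1) * n)" "w \<in> carrier_vec ((k + 1) * n)" by (simp_all add: module_vec_simps)
  have "poly_vec n k v + poly_vec n k w = hom_vec n k (\<lambda>i. vec n (\<lambda>r. v $ (i * n + r)) + vec n (\<lambda>r. w $ (i * n + r)))"
    unfolding poly_vec_def by (rule hom_vec_add) auto
  also have "\<dots> = poly_vec n k (v + w)"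
    unfolding poly_vec_def
  proof (intro hom_vec_cong eq_vecI)
    fix i r assume "i \<le> k" "r < dim_vec (vec n (\<lambda>r. (v + w) $ (i * n + r)))"
    then have "r < n" "i * n + r < (k + 1) * n" using block_index_le[of i k r n] by auto
    then show "(vec n (\<lambda>r. v $ (i * n + r)) + vec n (\<lambda>r. w $ (i * n + r))) $ r = vec n (\<lambda>r. (v + w) $ (i * n + r)) $ r"
      using vw by simp
  qed simp
  finally show "poly_vec n k (v \<oplus>\<^bsub>module_vec TYPE(complex) ((k + 1) * n)\<^esub> w) = poly_vec n k v \<oplus>\<^bsub>hom_space n k\<^esub> poly_vec n k w"
    by (simp add: module_vec_simps hom_space_def)
next
  fix c :: complex and v assume "c \<in> carrier class_ring \<and> v \<in> carrier (module_vec TYPE(complex) ((k + 1) * n))"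
  then have v: "v \<in> carrier_vec ((k + 1) * n)" by (simp add: module_vec_simps)
  have "const2 c \<cdot>\<^sub>v poly_vec n k v = hom_vec n k (\<lambda>i. c \<cdot>\<^sub>v vec n (\<lambda>r. v $ (i * n + r)))"
    unfolding poly_vec_def by (rule hom_vec_smult) auto
  also have "\<dots> = poly_vec n k (c \<cdot>\<^sub>v v)"
    unfolding poly_vec_def
  proof (intro hom_vec_cong eq_vecI)
    fix i r assume "i \<le> k" "r < dim_vec (vec n (\<lambda>r. (c \<cdot>\<^sub>v v) $ (i * n + r)))"
    then have "r < n" "i * n + r < (k + 1) * n" using block_index_le[of i k r n] by auto
    then show "(c \<cdot>\<^sub>v vec n (\<lambda>r. v $ (i * n + r))) $ r = vec n (\<lambda>r. (c \<cdot>\<^sub>v v) $ (i * n + r)) $ r"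
      using v by simp
  qed simp
  finally show "poly_vec n k (c \<odot>\<^bsub>module_vec TYPE(complex) ((k + 1) * n)\<^esub> v) = c \<odot>\<^bsub>hom_space n k\<^esub> poly_vec n k v"
    by (simp add: module_vec_simps hom_space_def)
qed

lemma poly_vec_surj:
  assumes "n \<ge> 1" and v: "v \<in> carrier (hom_space n k)"
  shows "v \<in> poly_vec n k ` carrier_vec ((k + 1) * n)"
proof -
  obtain a where a: "v = hom_vec n k a" "\<forall>i\<le>k. a i \<in> carrier_vec n" using hom_space_carrierE[OF v] by blast
  define z where "z = vec ((k + 1) * n) (\<lambda>s. a (s div n) $ (s mod n))"
  have "v = poly_vec n k z"
    unfolding a poly_vec_def
  proof (rule hom_vec_cong, rule eq_vecI)
    fix i r assume "i \<le> k" "r < dim_vec (vec n (\<lambda>r. z $ (i * n + r)))"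
    then have "r < n" "i * n + r < (k + 1) * n" using block_index_le[of i k r n] by auto
    then show "a i $ r = vec n (\<lambda>r. z $ (i * n + r)) $ r" by (simp add: z_def)
  qed (use a in auto)
  then show ?thesis by (auto simp: z_def)
qed

lemma poly_vec_inj:
  assumes n: "n \<ge> 1" and z: "z \<in> carrier_vec ((k + 1) * n)" "z' \<in> carrier_vec ((k + 1) * n)"
    and eq: "poly_vec n k z = poly_vec n k z'"
  shows "z = z'"
proof (rule eq_vecI)
  fix s assume "s < dim_vec z'"
  then have s: "s < (k + 1) * n" using z by simp
  define i r where "i = s div n" and "r = s mod n"
  have ir: "r < n" "i \<le> k" "i * n + r = s" using n s by (auto simp: i_def r_def less_Suc_eq_le[symmetric] less_mult_imp_div_less)
  have coeff: "coeff (coeff (poly_vec n k y $ r) i) (k - i) = y $ s" for y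
    using ir by (simp add: poly_vec_def hom_vec_def coeff_hom_poly)
  show "z $ s = z' $ s" using coeff[of z] coeff[of z'] eq by simp
qed (use z in simp)

lemma poly_vec_stack:
  assumes A: "\<And>i. i \<le> d \<Longrightarrow> A i \<in> carrier_mat n n" and u: "u \<in> carrier_vec n"
  shows "poly_vec n d (stack n d A *\<^sub>v u) = hom_vec n d (\<lambda>i. A i *\<^sub>v u)"
  unfolding poly_vec_def
proof (rule hom_vec_cong, rule eq_vecI)
  fix i r assume i: "i \<le> d" and "r < dim_vec (A i *\<^sub>v u)"
  moreover note Ai = A[OF i]
  ultimately have r: "r < n" "i * n + r < (d + 1) * n" using block_index_le[of i d r n] i by auto
  then show "vec n (\<lambda>r. (stack n d A *\<^sub>v u) $ (i * n + r)) $ r = (A i *\<^sub>v u) $ r"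
    using u Ai by (auto simp: stack_def scalar_prod_def intro!: sum.cong)
qed (use A in auto)

lemma var_lam_poly_vec:
  assumes n: "n \<ge> 1"
  shows "var_lam \<cdot>\<^sub>v poly_vec n k z
    = poly_vec n (Suc k) (vec ((Suc k + 1) * n) (\<lambda>s. if s < n then 0 else z $ (s - n)))"
proof (rule eq_vecI)
  let ?y = "vec ((Suc k + 1) * n) (\<lambda>s. if s < n then 0 else z $ (s - n))"
  fix r assume "r < dim_vec (poly_vec n (Suc k) ?y)"
  then have r: "r < n" by (simp add: poly_vec_def hom_vec_def)
  have "hom_poly (Suc k) (\<lambda>i. case i of 0 \<Rightarrow> 0 | Suc j \<Rightarrow> z $ (j * n + r)) = hom_poly (Suc k) (\<lambda>i. ?y $ (i * n + r))"
  proof (rule hom_poly_cong)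
    fix i assume "i \<le> Suc k"
    then have "i * n + r < (Suc k + 1) * n" using r by (intro block_index_less) auto
    then show "(case i of 0 \<Rightarrow> 0 | Suc j \<Rightarrow> z $ (j * n + r)) = ?y $ (i * n + r)"
      using r by (auto split: nat.split)
  qed
  moreover have "(var_lam \<cdot>\<^sub>v poly_vec n k z) $ r = var_lam * hom_poly k (\<lambda>i. z $ (i * n + r))"
    "poly_vec n (Suc k) ?y $ r = hom_poly (Suc k) (\<lambda>i. ?y $ (i * n + r))"
    using r by (simp_all add: poly_vec_def hom_vec_def)
  ultimately show "(var_lam \<cdot>\<^sub>v poly_vec n k z) $ r = poly_vec n (Suc k) ?y $ r"
    by (simp only: var_lam_hom_poly)
qed (simp add: poly_vec_def hom_vec_def)

lemma var_mu_poly_vec: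
  assumes n: "n \<ge> 1"
  shows "var_mu \<cdot>\<^sub>v poly_vec n k z
    = poly_vec n (Suc k) (vec ((Suc k + 1) * n) (\<lambda>s. if s < (k + 1) * n then z $ s else 0))"
proof (rule eq_vecI)
  let ?y = "vec ((Suc k + 1) * n) (\<lambda>s. if s < (k + 1) * n then z $ s else 0)"
  fix r assume "r < dim_vec (poly_vec n (Suc k) ?y)"
  then have r: "r < n" by (simp add: poly_vec_def hom_vec_def)
  have "hom_poly (Suc k) (\<lambda>i. if i \<le> k then z $ (i * n + r) else 0) = hom_poly (Suc k) (\<lambda>i. ?y $ (i * n + r))"
  proof (rule hom_poly_cong)
    fix i assume i: "i \<le> Suc k"
    then have "i * n + r < (Suc k + 1) * n" using r by (intro block_index_less) auto
    moreover have "i * n + r < (k + 1) * n" if "i \<le> k" using that r by (intro block_index_less) auto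
    moreover have "\<not> i * n + r < (k + 1) * n" if "\<not> i \<le> k"
    proof -
      have "i = k + 1" using that i by simp
      then show ?thesis by simp
    qed
    ultimately show "(if i \<le> k then z $ (i * n + r) else 0) = ?y $ (i * n + r)" by simp
  qed
  moreover have "(var_mu \<cdot>\<^sub>v poly_vec n k z) $ r = var_mu * hom_poly k (\<lambda>i. z $ (i * n + r))"
    "poly_vec n (Suc k) ?y $ r = hom_poly (Suc k) (\<lambda>i. ?y $ (i * n + r))"
    using r by (simp_all add: poly_vec_def hom_vec_def)
  ultimately show "(var_mu \<cdot>\<^sub>v poly_vec n k z) $ r = poly_vec n (Suc k) ?y $ r"
    by (simp only: var_mu_hom_poly)
qed (simp add: poly_vec_def hom_vec_def)

lemma module_hom_mult_mat_vec:
  fixes M :: "complex mat"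
  assumes M: "M \<in> carrier_mat p q"
    and f: "f \<in> LinearCombinations.module_hom class_ring (module_vec TYPE(complex) p) V"
  shows "(\<lambda>u. f (M *\<^sub>v u)) \<in> LinearCombinations.module_hom class_ring (module_vec TYPE(complex) q) V"
  unfolding LinearCombinations.module_hom_def mem_Collect_eq
proof (intro conjI allI impI)
  show "(\<lambda>u. f (M *\<^sub>v u)) \<in> carrier (module_vec TYPE(complex) q) \<rightarrow> carrier V"
    using LinearCombinations.module_hom_closed[OF f] M by (auto simp: module_vec_simps)
next
  fix v w assume "v \<in> carrier (module_vec TYPE(complex) q) \<and> w \<in> carrier (module_vec TYPE(complex) q)"
  then show "f (M *\<^sub>v (v \<oplus>\<^bsub>module_vec TYPE(complex) q\<^esub> w)) = f (M *\<^sub>v v) \<oplus>\<^bsub>V\<^esub> f (M *\<^sub>v w)"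
    using LinearCombinations.module_hom_add[OF f, of "M *\<^sub>v v" "M *\<^sub>v w"] M
    by (simp add: module_vec_simps mult_add_distrib_mat_vec[OF M])
next
  fix c :: complex and v assume "c \<in> carrier class_ring \<and> v \<in> carrier (module_vec TYPE(complex) q)"
  then show "f (M *\<^sub>v (c \<odot>\<^bsub>module_vec TYPE(complex) q\<^esub> v)) = c \<odot>\<^bsub>V\<^esub> f (M *\<^sub>v v)"
    using LinearCombinations.module_hom_smult[OF f, of c "M *\<^sub>v v"] M
    by (simp add: module_vec_simps mult_mat_vec[OF M])
qed

text \<open>
  The map that sends \<open>u\<close> to \<open>A(\<lambda>, \<mu>) u\<close> is linear from \<open>\<complex>\<^sup>n\<close> onto \<open>(A)\<close>, a space of the same dimension, so it is
  injective.
\<close>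

lemma stack_injective:
  assumes n: "n \<ge> 1" and A: "\<And>i. i \<le> d \<Longrightarrow> A i \<in> carrier_mat n n"
    and dim: "vectorspace.dim class_ring ((hom_space n d)\<lparr>carrier := image_space n d A\<rparr>) = n"
    and u: "u \<in> carrier_vec n" "stack n d A *\<^sub>v u = 0\<^sub>v ((d + 1) * n)"
  shows "u = 0\<^sub>v n"
proof -
  let ?V = "(hom_space n d)\<lparr>carrier := image_space n d A\<rparr>" and ?f = "\<lambda>u. poly_vec n d (stack n d A *\<^sub>v u)"
  have A': "\<forall>i\<le>d. A i \<in> carrier_mat n n" using A by blast
  have vs: "vectorspace class_ring ?V"
    by (rule vectorspace.subspace_is_vs[OF vectorspace_hom_space subspace.intro[OF vectorspace_hom_space submodule_image_space[OF A']]])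
  have img: "image_space n d A = ?f ` carrier_vec n"
    unfolding image_space_eq[OF A'] using poly_vec_stack[OF A] by auto
  have "?f \<in> LinearCombinations.module_hom class_ring (module_vec TYPE(complex) n) (hom_space n d)"
    by (rule module_hom_mult_mat_vec[OF stack_carrier poly_vec_hom])
  then have hom: "?f \<in> LinearCombinations.module_hom class_ring (module_vec TYPE(complex) n) ?V"
    unfolding LinearCombinations.module_hom_def using img by (auto simp: module_vec_simps)
  have lin: "linear_map class_ring (module_vec TYPE(complex) n) ?V ?f"
    by (rule linear_mapI[OF vec_vs vs hom])
  interpret V: vectorspace class_ring ?V by (rule vs)
  interpret f: linear_map class_ring "module_vec TYPE(complex) n" ?V ?f by (rule lin)
  have "V.fin_dim"
    by (rule f.surj_fin_dim) (use vec_space.fin_dim img in \<open>auto simp: module_vec_simps\<close>)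
  then obtain b where b: "finite b" "V.basis b" using V.finite_basis_exists by blast
  obtain cs where cs: "set cs = b" "distinct cs" using finite_distinct_list[OF b(1)] by blast
  have len: "length cs = n" using V.dim_basis[OF b] dim cs distinct_card[of cs] by simp
  have ob: "ordered_basis ?V cs" using cs b by (simp add: ordered_basis_def)
  have surj: "?f ` carrier_vec n = carrier ?V" using img by simp
  have "inj_on ?f (carrier_vec n)" by (rule basis_coordinate_matrix[OF lin surj ob len])
  moreover have "stack n d A *\<^sub>v 0\<^sub>v n = 0\<^sub>v ((d + 1) * n)"
    by (intro eq_vecI) (auto simp: stack_def)
  then have "?f u = ?f (0\<^sub>v n)" using u(2) by simp
  ultimately show ?thesis using u(1) by (metis inj_onD zero_carrier_vec)
qed

text \<open>
  The isomorphism \<open>T\<close> is the inverse of the one that \<open>W\<close> induces: \<open>T u\<close> is the class of the vector with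
  coordinates \<open>Z u\<close>, for a right inverse \<open>Z\<close> of \<open>W\<close>. Since \<open>z - Z W z\<close> lies in the kernel of \<open>W\<close>, which is \<open>(A)\<close>,
  the class of any \<open>z\<close> is \<open>T (W z)\<close>. Multiplication by \<open>\<lambda>\<close> or \<open>\<mu>\<close> adds a zero block before or
  after the coordinates, and \<open>W\<close> maps the result to \<open>W\<^sub>0 z\<close> or \<open>W\<^sub>1 z\<close>.
\<close>

lemma quotient_coordinates:
  fixes A :: "nat \<Rightarrow> complex mat" and W Z :: "complex mat"
  assumes n: "n \<ge> 1" and d: "d \<ge> 1"
    and A: "\<And>i. i \<le> d \<Longrightarrow> A i \<in> carrier_mat n n"
    and dim: "vectorspace.dim class_ring ((hom_space n d)\<lparr>carrier := image_space n d A\<rparr>) = n"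
    and W: "W \<in> carrier_mat (d * n) ((d + 1) * n)"
    and Z: "Z \<in> carrier_mat ((d + 1) * n) (d * n)" "W * Z = 1\<^sub>m (d * n)"
    and WA: "W * stack n d A = 0\<^sub>m (d * n) n"
    and W0: "W0 = mat (d * n) (d * n) (\<lambda>(r, s). W $$ (r, s + n))"
    and W1: "W1 = mat (d * n) (d * n) (\<lambda>(r, s). W $$ (r, s))"
  obtains T where "linear_map class_ring (module_vec TYPE(complex) (d * n)) (quot_space n d A) T"
    "inj_on T (carrier_vec (d * n))" "T ` carrier_vec (d * n) = carrier (quot_space n d A)"
    "\<And>z. z \<in> carrier_vec (d * n) \<Longrightarrow> mult_lam n d A (poly_vec n (d - 1) z) = T (W0 *\<^sub>v z)"
    "\<And>z. z \<in> carrier_vec (d * n) \<Longrightarrow> mult_mu n d A (poly_vec n (d - 1) z) = T (W1 *\<^sub>v z)"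
proof -
  let ?m = "d * n" and ?N = "(d + 1) * n" and ?H = "image_space n d A"
  have A': "\<forall>i\<le>d. A i \<in> carrier_mat n n" using A by blast
  note sub = submodule_image_space[OF A']
  define q where "q z = ?H +>\<^bsub>hom_space n d\<^esub> poly_vec n d z" for z
  define T where "T u = q (Z *\<^sub>v u)" for u
  interpret H: abelian_subgroup ?H "hom_space n d" by (rule abelian_subgroup_submodule[OF sub])
  have qhom: "q \<in> LinearCombinations.module_hom class_ring (module_vec TYPE(complex) ?N) (quot_space n d A)"
  proof -
    have "q = (\<lambda>x. ?H +>\<^bsub>hom_space n d\<^esub> x) \<circ> poly_vec n d" by (auto simp: q_def)
    then show ?thesis
      using quotient_map_hom[OF sub] poly_vec_hom[of n d]
      unfolding LinearCombinations.module_hom_def quot_space_def by (auto simp: Pi_iff)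
  qed
  have vsq: "vectorspace class_ring (quot_space n d A)" by (rule vectorspace_quot_space[OF A'])
  have lin: "linear_map class_ring (module_vec TYPE(complex) ?m) (quot_space n d A) T"
    unfolding T_def[abs_def] by (rule linear_mapI[OF vec_vs vsq module_hom_mult_mat_vec[OF Z(1) qhom]])
  interpret Qv: vectorspace class_ring "quot_space n d A" by (rule vsq)
  interpret T: linear_map class_ring "module_vec TYPE(complex) ?m" "quot_space n d A" T by (rule lin)
  have pv: "poly_vec n d z \<in> carrier (hom_space n d)" if "z \<in> carrier_vec ?N" for z
    using LinearCombinations.module_hom_closed[OF poly_vec_hom[of n d]] that by (auto simp: module_vec_simps)
  have zero: "\<zero>\<^bsub>quot_space n d A\<^esub> = ?H" by (simp add: quot_space_def quotient_module_def)
  have imgX: "?H = (\<lambda>u. poly_vec n d (stack n d A *\<^sub>v u)) ` carrier_vec n"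
    unfolding image_space_eq[OF A'] using poly_vec_stack[OF A] by auto
  have qker: "q z = ?H \<longleftrightarrow> W *\<^sub>v z = 0\<^sub>v ?m" if z: "z \<in> carrier_vec ?N" for z
  proof
    assume "q z = ?H"
    then have "poly_vec n d z \<in> ?H" using H.a_rcos_self[OF pv[OF z]] by (simp add: q_def)
    then obtain u where u: "u \<in> carrier_vec n" "poly_vec n d z = poly_vec n d (stack n d A *\<^sub>v u)"
      using imgX by auto
    have "z = stack n d A *\<^sub>v u"
      using poly_vec_inj[OF n z _ u(2)] u(1) by (meson mult_mat_vec_carrier stack_carrier)
    then have "W *\<^sub>v z = (W * stack n d A) *\<^sub>v u"
      using assoc_mult_mat_vec[OF W stack_carrier u(1)] by simp
    then show "W *\<^sub>v z = 0\<^sub>v ?m" unfolding WA using u by (auto intro!: eq_vecI)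
  next
    assume Wz: "W *\<^sub>v z = 0\<^sub>v ?m"
    have "\<exists>u \<in> carrier_vec n. z = stack n d A *\<^sub>v u"
    proof (rule kernel_eq_column_space[OF _ _ Z(2) _ WA _ _ Wz])
      show "u = 0\<^sub>v n" if "u \<in> carrier_vec n" "stack n d A *\<^sub>v u = 0\<^sub>v (n + ?m)" for u
        using stack_injective[OF n A dim that(1)] that(2) by simp
    qed (use W Z z stack_carrier[of n d A] in simp_all)
    then have "poly_vec n d z \<in> ?H" using imgX by auto
    then show "q z = ?H" unfolding q_def using pv[OF z] by (intro H.a_rcos_const)
  qed
  have qT: "q z = T (W *\<^sub>v z)" if z: "z \<in> carrier_vec ?N" for z
  proof -
    let ?y = "Z *\<^sub>v (W *\<^sub>v z)"
    have y: "?y \<in> carrier_vec ?N" and Wz: "W *\<^sub>v z \<in> carrier_vec ?m" using W Z z by auto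
    have "W *\<^sub>v (z - ?y) = W *\<^sub>v z - W *\<^sub>v ?y" by (rule mult_minus_distrib_mat_vec[OF W z y])
    also have "W *\<^sub>v ?y = W *\<^sub>v z"
      using assoc_mult_mat_vec[OF W Z(1) Wz] Wz unfolding Z(2) by simp
    finally have "W *\<^sub>v (z - ?y) = 0\<^sub>v ?m" using Wz by simp
    then have k: "q (z - ?y) = \<zero>\<^bsub>quot_space n d A\<^esub>" using qker[of "z - ?y"] z y zero by simp
    have "z = (z - ?y) + ?y" using z Z by (intro eq_vecI) auto
    then have "q z = q (z - ?y) \<oplus>\<^bsub>quot_space n d A\<^esub> q ?y"
      using LinearCombinations.module_hom_add[OF qhom, of "z - ?y" ?y] z y by (simp add: module_vec_simps)
    also have "\<dots> = q ?y"
    proof -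
      have "q ?y \<in> carrier (quot_space n d A)"
        using LinearCombinations.module_hom_closed[OF qhom] y by (auto simp: module_vec_simps)
      then show ?thesis unfolding k by (rule Qv.M.l_zero)
    qed
    finally show ?thesis by (simp add: T_def)
  qed
  have surj: "T ` carrier_vec ?m = carrier (quot_space n d A)"
  proof
    show "T ` carrier_vec ?m \<subseteq> carrier (quot_space n d A)"
      using LinearCombinations.module_hom_closed[OF T.T_hom] by (auto simp: module_vec_simps)
    show "carrier (quot_space n d A) \<subseteq> T ` carrier_vec ?m"
    proof
      fix X assume "X \<in> carrier (quot_space n d A)"
      then obtain x where x: "x \<in> carrier (hom_space n d)" "X = ?H +>\<^bsub>hom_space n d\<^esub> x"
        by (auto simp: quot_space_def quotient_module_def A_RCOSETS_def')
      obtain z where z: "z \<in> carrier_vec ?N" "x = poly_vec n d z" using poly_vec_surj[OF n x(1)] by auto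
      then have "X = T (W *\<^sub>v z)" using x qT by (simp add: q_def)
      then show "X \<in> T ` carrier_vec ?m" using W z by auto
    qed
  qed
  have "inj_on T (carrier (module_vec TYPE(complex) ?m))"
  proof (rule T.Ke0_imp_inj)
    have "v = 0\<^sub>v ?m" if v: "v \<in> carrier_vec ?m" and "T v = \<zero>\<^bsub>quot_space n d A\<^esub>" for v
    proof -
      have "W *\<^sub>v (Z *\<^sub>v v) = 0\<^sub>v ?m" using that qker[of "Z *\<^sub>v v"] Z unfolding T_def zero by auto
      then show ?thesis using assoc_mult_mat_vec[OF W Z(1) v] v unfolding Z(2) by simp
    qed
    moreover have "T (0\<^sub>v ?m) = \<zero>\<^bsub>quot_space n d A\<^esub>" using T.T0_is_0 by (simp add: module_vec_simps)
    ultimately show "carrier (T.V.vs T.kerT) = {\<zero>\<^bsub>module_vec TYPE(complex) ?m\<^esub>}"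
      by (auto simp: T.mod_hom.ker_def module_vec_simps)
  qed
  then have inj: "inj_on T (carrier_vec ?m)" by (simp add: module_vec_simps)
  have dk: "Suc (d - 1) = d" using d by simp
  have lam: "mult_lam n d A (poly_vec n (d - 1) z) = T (W0 *\<^sub>v z)" if z: "z \<in> carrier_vec ?m" for z
  proof -
    let ?y = "vec ?N (\<lambda>s. if s < n then 0 else z $ (s - n))"
    have "mult_lam n d A (poly_vec n (d - 1) z) = q ?y"
      unfolding mult_lam_def var_lam_poly_vec[OF n] dk q_def ..
    also have "\<dots> = T (W *\<^sub>v ?y)" by (rule qT) simp
    also have "W *\<^sub>v ?y = W0 *\<^sub>v z"
    proof (rule eq_vecI)
      fix r assume "r < dim_vec (W0 *\<^sub>v z)"
      then have r: "r < ?m" by (simp add: W0)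
      have "(W *\<^sub>v ?y) $ r = (\<Sum>s<n + ?m. W $$ (r, s) * (if s < n then 0 else z $ (s - n)))"
        using W r by (auto simp: scalar_prod_def lessThan_atLeast0 intro!: sum.cong)
      also have "\<dots> = (\<Sum>s<?m. W $$ (r, s + n) * z $ s)" unfolding sum_lessThan_add by simp
      also have "\<dots> = (W0 *\<^sub>v z) $ r"
        using r z by (auto simp: W0 scalar_prod_def lessThan_atLeast0 intro!: sum.cong)
      finally show "(W *\<^sub>v ?y) $ r = (W0 *\<^sub>v z) $ r" .
    qed (use W in \<open>auto simp: W0\<close>)
    finally show ?thesis .
  qed
  have mu: "mult_mu n d A (poly_vec n (d - 1) z) = T (W1 *\<^sub>v z)" if z: "z \<in> carrier_vec ?m" for z
  proof -
    let ?y = "vec ?N (\<lambda>s. if s < ?m then z $ s else 0)"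
    have "(d - 1 + 1) * n = ?m" using d by simp
    then have "mult_mu n d A (poly_vec n (d - 1) z) = q ?y"
      unfolding mult_mu_def var_mu_poly_vec[OF n] dk q_def by simp
    also have "\<dots> = T (W *\<^sub>v ?y)" by (rule qT) simp
    also have "W *\<^sub>v ?y = W1 *\<^sub>v z"
    proof (rule eq_vecI)
      fix r assume "r < dim_vec (W1 *\<^sub>v z)"
      then have r: "r < ?m" by (simp add: W1)
      have "(W *\<^sub>v ?y) $ r = (\<Sum>s<?m + n. W $$ (r, s) * (if s < ?m then z $ s else 0))"
        using W r by (auto simp: scalar_prod_def lessThan_atLeast0 add.commute intro!: sum.cong)
      also have "\<dots> = (\<Sum>s<?m. W $$ (r, s) * z $ s)" unfolding sum_lessThan_add by simp
      also have "\<dots> = (W1 *\<^sub>v z) $ r"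
        using r z by (auto simp: W1 scalar_prod_def lessThan_atLeast0 intro!: sum.cong)
      finally show "(W *\<^sub>v ?y) $ r = (W1 *\<^sub>v z) $ r" .
    qed (use W in \<open>auto simp: W1\<close>)
    finally show ?thesis .
  qed
  show thesis by (rule that[OF lin inj surj lam mu])
qed

text \<open>
  If \<open>F\<close> is \<open>U\<close> in the coordinates \<open>T\<^sub>1\<close>, \<open>T\<^sub>2\<close>, then its matrix in the bases with coordinate matrices
  \<open>P\<close> and \<open>Q\<close> is \<open>Q\<^sup>-\<^sup>1 U P\<close>. With \<open>P = Q = I\<close> this yields the bases of the first claim, with arbitrary invertible \<open>P\<close> and
  \<open>Q\<close> the form of the pencil for any choice of bases.
\<close>

lemma represents_iff_matrix_equation:
  fixes M P Q U :: "complex mat"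
  assumes lin: "linear_map class_ring (module_vec TYPE(complex) m) V T2" and inj: "inj_on T2 (carrier_vec m)"
    and len: "length bs = m" "length cs = m"
    and P: "P \<in> carrier_mat m m" "\<And>j. j < m \<Longrightarrow> bs ! j = T1 (col P j)"
    and Q: "Q \<in> carrier_mat m m" "\<And>j. j < m \<Longrightarrow> cs ! j = T2 (col Q j)"
    and U: "U \<in> carrier_mat m m" "\<And>z. z \<in> carrier_vec m \<Longrightarrow> F (T1 z) = T2 (U *\<^sub>v z)"
  shows "represents V bs cs F M \<longleftrightarrow> M \<in> carrier_mat m m \<and> U * P = Q * M"
proof (cases "M \<in> carrier_mat m m")
  case True
  have left: "F (bs ! j) = T2 (col (U * P) j)" if "j < m" for j
    using U(2)[of "col P j"] P that col_mult2[OF U(1) P(1) that] by simp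
  have right: "(\<Oplus>\<^bsub>V\<^esub> i \<in> {..<length cs}. M $$ (i, j) \<odot>\<^bsub>V\<^esub> (cs ! i)) = T2 (col (Q * M) j)" if j: "j < m" for j
  proof -
    interpret V: vectorspace class_ring V using lin by (simp add: linear_map_def)
    have cl: "T2 (col Q i) \<in> carrier V" if "i < m" for i
    proof -
      have "T2 \<in> LinearCombinations.module_hom class_ring (module_vec TYPE(complex) m) V"
        using lin by (simp add: linear_map_def mod_hom_def mod_hom_axioms_def)
      from LinearCombinations.module_hom_closed[OF this] show ?thesis
        using Q(1) that by (auto simp: module_vec_simps)
    qed
    have "(\<Oplus>\<^bsub>V\<^esub> i \<in> {..<length cs}. M $$ (i, j) \<odot>\<^bsub>V\<^esub> (cs ! i))
        = (\<Oplus>\<^bsub>V\<^esub> i \<in> {..<m}. M $$ (i, j) \<odot>\<^bsub>V\<^esub> T2 (col Q i))"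
      unfolding len
    proof (rule V.M.finsum_cong')
      show "(\<lambda>i. M $$ (i, j) \<odot>\<^bsub>V\<^esub> T2 (col Q i)) \<in> {..<m} \<rightarrow> carrier V"
        using cl by (intro Pi_I V.smult_closed) (auto simp: class_ring_simps)
    qed (use Q in auto)
    also have "\<dots> = T2 (vec m (\<lambda>r. \<Sum>i<m. M $$ (i, j) * col Q i $ r))"
      by (rule finsum_linear_image[OF lin]) (use Q in auto)
    also have "vec m (\<lambda>r. \<Sum>i<m. M $$ (i, j) * col Q i $ r) = col (Q * M) j"
      using Q(1) True j
      by (intro eq_vecI) (auto simp: scalar_prod_def lessThan_atLeast0 mult.commute intro!: sum.cong)
    finally show ?thesis .
  qed
  have "represents V bs cs F M \<longleftrightarrow> (\<forall>j<m. T2 (col (U * P) j) = T2 (col (Q * M) j))"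
    unfolding represents_def using left right len True by simp
  also have "\<dots> \<longleftrightarrow> (\<forall>j<m. col (U * P) j = col (Q * M) j)"
    using inj_on_eq_iff[OF inj] U P Q True by simp
  also have "\<dots> \<longleftrightarrow> U * P = Q * M"
  proof -
    have "(\<forall>j<m. col X j = col Y j) \<longleftrightarrow> X = Y" if "X \<in> carrier_mat m m" "Y \<in> carrier_mat m m" for X Y :: "complex mat"
      using that by (auto intro: mat_col_eqI)
    then show ?thesis using U P Q True by (metis mult_carrier_mat)
  qed
  finally show ?thesis using True by simp
qed (simp add: represents_def len)

section \<open>Representation and linearization by annihilators\<close>


lemma mult_embed_high_columns:
  fixes W :: "'a::comm_ring_1 mat"
  assumes W: "W \<in> carrier_mat p (n + m)"
  shows "W * (0\<^sub>m n m @\<^sub>r 1\<^sub>m m) = mat p m (\<lambda>(r, s). W $$ (r, s + n))"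
proof (rule eq_matI)
  fix r s assume "r < dim_row (mat p m (\<lambda>(r, s). W $$ (r, s + n)))" "s < dim_col (mat p m (\<lambda>(r, s). W $$ (r, s + n)))"
  then have rs: "r < p" "s < m" by simp_all
  have E: "0\<^sub>m n m @\<^sub>r 1\<^sub>m m \<in> carrier_mat (n + m) m" by (rule carrier_append_rows) auto
  have "(W * (0\<^sub>m n m @\<^sub>r 1\<^sub>m m)) $$ (r, s)
      = (\<Sum>k<n + m. W $$ (r, k) * (0\<^sub>m n m @\<^sub>r 1\<^sub>m m) $$ (k, s))"
    by (rule mult_mat_entry[OF W E rs])
  also have "\<dots> = (\<Sum>k<m. if k = s then W $$ (r, k + n) else 0)"
  proof -
    have lo: "(0\<^sub>m n m @\<^sub>r 1\<^sub>m m) $$ (k, s) = (0 :: 'a)" if "k < n" for k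
      using that rs by (simp add: append_rows_def)
    have hi: "(0\<^sub>m n m @\<^sub>r 1\<^sub>m m) $$ (k + n, s) = (if k = s then 1 else 0 :: 'a)" if "k < m" for k
      using that rs by (simp add: append_rows_def)
    have delta: "x * (if k = s then 1 else 0) = (if k = s then x else 0)" for x :: 'a and k by simp
    show ?thesis unfolding sum_lessThan_add by (simp add: lo hi delta cong: sum.cong_simp)
  qed
  also have "\<dots> = W $$ (r, s + n)" using rs by simp
  finally show "(W * (0\<^sub>m n m @\<^sub>r 1\<^sub>m m)) $$ (r, s) = mat p m (\<lambda>(r, s). W $$ (r, s + n)) $$ (r, s)"
    using rs by simp
qed (use W in \<open>auto simp: append_rows_def\<close>)

lemma mult_embed_low_columns:
  fixes W :: "'a::comm_ring_1 mat"
  assumes W: "W \<in> carrier_mat p (n + m)"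
  shows "W * (1\<^sub>m m @\<^sub>r 0\<^sub>m n m) = mat p m (\<lambda>(r, s). W $$ (r, s))"
proof (rule eq_matI)
  fix r s assume "r < dim_row (mat p m (\<lambda>(r, s). W $$ (r, s)))" "s < dim_col (mat p m (\<lambda>(r, s). W $$ (r, s)))"
  then have rs: "r < p" "s < m" by simp_all
  have E: "1\<^sub>m m @\<^sub>r 0\<^sub>m n m \<in> carrier_mat (m + n) m" by (rule carrier_append_rows) auto
  have W': "W \<in> carrier_mat p (m + n)" using W by (simp add: add.commute)
  have "(W * (1\<^sub>m m @\<^sub>r 0\<^sub>m n m)) $$ (r, s)
      = (\<Sum>k<m + n. W $$ (r, k) * (1\<^sub>m m @\<^sub>r 0\<^sub>m n m) $$ (k, s))"
    by (rule mult_mat_entry[OF W' E rs])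
  also have "\<dots> = (\<Sum>k<m. if k = s then W $$ (r, k) else 0)"
  proof -
    have hi: "(1\<^sub>m m @\<^sub>r 0\<^sub>m n m) $$ (k + m, s) = (0 :: 'a)" if "k < n" for k
      using that rs by (simp add: append_rows_def)
    have lo: "(1\<^sub>m m @\<^sub>r 0\<^sub>m n m) $$ (k, s) = (if k = s then 1 else 0 :: 'a)" if "k < m" for k
      using that rs by (simp add: append_rows_def)
    have delta: "x * (if k = s then 1 else 0) = (if k = s then x else 0)" for x :: 'a and k by simp
    show ?thesis unfolding sum_lessThan_add by (simp add: lo hi delta cong: sum.cong_simp)
  qed
  also have "\<dots> = W $$ (r, s)" using rs by simp
  finally show "(W * (1\<^sub>m m @\<^sub>r 0\<^sub>m n m)) $$ (r, s) = mat p m (\<lambda>(r, s). W $$ (r, s)) $$ (r, s)"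
    using rs by simp
qed (use W in \<open>auto simp: append_rows_def\<close>)

lemma linear_bijection_basis:
  assumes lin: "linear_map class_ring (module_vec TYPE(complex) m) V T"
    and inj: "inj_on T (carrier_vec m)" and surj: "T ` carrier_vec m = carrier V"
  shows "ordered_basis V (map T (unit_vecs m))"
    and "ordered_basis V cs \<Longrightarrow> length cs = m"
proof -
  interpret V: vectorspace class_ring V using lin by (simp add: linear_map_def)
  interpret C: vec_space "TYPE(complex)" m .
  interpret T: linear_map class_ring "module_vec TYPE(complex) m" V T by (rule lin)
  have inj': "inj_on T (carrier (module_vec TYPE(complex) m))" and
    surj': "T ` carrier (module_vec TYPE(complex) m) = carrier V"
    using inj surj by (simp_all add: module_vec_simps)
  have basis: "V.basis (T ` set (unit_vecs m))"
    by (rule T.linear_inj_image_is_basis[OF inj' surj' C.unit_vecs_basis C.fin_dim])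
  have "inj_on T (set (unit_vecs m))" by (rule inj_on_subset[OF inj]) (auto simp: unit_vecs_def)
  then show "ordered_basis V (map T (unit_vecs m))"
    using basis C.unit_vecs_distinct by (simp add: ordered_basis_def distinct_map)
  have dim: "V.dim = m" using T.dim_eq[OF C.fin_dim inj' surj'] C.dim_is_n by simp
  show "length cs = m" if "ordered_basis V cs"
    using V.dim_basis[OF finite_set, of cs] that dim distinct_card[of cs] by (simp add: ordered_basis_def)
qed

theorem theorem4:
  fixes n d :: nat and A :: "nat \<Rightarrow> complex mat" and W W0 W1 :: "complex mat"
  assumes "n \<ge> 1" and "d \<ge> 1"
    and "\<And>i. i \<le> d \<Longrightarrow> A i \<in> carrier_mat n n"
    and "vectorspace.dim class_ring ((hom_space n d)\<lparr>carrier := image_space n d A\<rparr>) = n"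
    and "W \<in> carrier_mat (d * n) ((d + 1) * n)"
    and "vec_space.rank (d * n) W = d * n"
    and "W * block_column n d A = 0\<^sub>m (d * n) n"
  defines "W0 \<equiv> W * (0\<^sub>m n (d * n) @\<^sub>r 1\<^sub>m (d * n))"
    and "W1 \<equiv> W * (1\<^sub>m (d * n) @\<^sub>r 0\<^sub>m n (d * n))"
  shows "(\<exists>bs cs. ordered_basis (hom_space n (d - 1)) bs \<and> ordered_basis (quot_space n d A) cs \<and>
            represents (quot_space n d A) bs cs (mult_lam n d A) W0 \<and>
            represents (quot_space n d A) bs cs (mult_mu n d A) W1) \<and>
         (det (hom_mat n d A) \<noteq> 0 \<longrightarrow>
            is_strong_linearization n d (dehom (pencil W0 W1)) (dehom (hom_mat n d A)) \<and>
            (\<forall>bs cs L0 L1.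
               ordered_basis (hom_space n (d - 1)) bs \<longrightarrow>
               ordered_basis (quot_space n d A) cs \<longrightarrow>
               represents (quot_space n d A) bs cs (mult_lam n d A) L0 \<longrightarrow>
               represents (quot_space n d A) bs cs (mult_mu n d A) L1 \<longrightarrow>
               is_strong_linearization n d (dehom (pencil L0 L1)) (dehom (hom_mat n d A))))"
proof -
  let ?m = "d * n"
  note n = assms(1) and d = assms(2) and A = assms(3) and dim = assms(4) and W = assms(5)
  obtain Z where Z: "Z \<in> carrier_mat ((d + 1) * n) ?m" "W * Z = 1\<^sub>m ?m"
    using full_row_rank_right_inverse[OF W assms(6)] .
  have WA: "W * stack n d A = 0\<^sub>m ?m n"
    using assms(7) by (simp add: stack_def block_column_def)
  have Wn: "W \<in> carrier_mat ?m (n + ?m)" using W by simp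
  have W0: "W0 = mat ?m ?m (\<lambda>(r, s). W $$ (r, s + n))"
    unfolding W0_def by (rule mult_embed_high_columns[OF Wn])
  have W1: "W1 = mat ?m ?m (\<lambda>(r, s). W $$ (r, s))"
    unfolding W1_def by (rule mult_embed_low_columns[OF Wn])
  have Wc: "W0 \<in> carrier_mat ?m ?m" "W1 \<in> carrier_mat ?m ?m" by (simp_all add: W0 W1)
  obtain T where lin: "linear_map class_ring (module_vec TYPE(complex) ?m) (quot_space n d A) T"
    and inj: "inj_on T (carrier_vec ?m)" and surj: "T ` carrier_vec ?m = carrier (quot_space n d A)"
    and lam: "\<And>z. z \<in> carrier_vec ?m \<Longrightarrow> mult_lam n d A (poly_vec n (d - 1) z) = T (W0 *\<^sub>v z)"
    and mu: "\<And>z. z \<in> carrier_vec ?m \<Longrightarrow> mult_mu n d A (poly_vec n (d - 1) z) = T (W1 *\<^sub>v z)"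
    using quotient_coordinates[OF n d A dim W Z WA W0 W1] by metis
  let ?p = "poly_vec n (d - 1)"
  have dk: "(d - 1 + 1) * n = ?m" using d by simp
  have plin: "linear_map class_ring (module_vec TYPE(complex) ?m) (hom_space n (d - 1)) ?p"
    using linear_mapI[OF vec_vs vectorspace_hom_space poly_vec_hom[of n "d - 1"]] unfolding dk .
  have pinj: "inj_on ?p (carrier_vec ?m)"
    using poly_vec_inj[OF n, of _ "d - 1"] unfolding dk by (intro inj_onI)
  have psurj: "?p ` carrier_vec ?m = carrier (hom_space n (d - 1))"
  proof
    show "?p ` carrier_vec ?m \<subseteq> carrier (hom_space n (d - 1))"
      using LinearCombinations.module_hom_closed[OF poly_vec_hom[of n "d - 1"]] unfolding dk
      by (auto simp: module_vec_simps)
    show "carrier (hom_space n (d - 1)) \<subseteq> ?p ` carrier_vec ?m"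
      using poly_vec_surj[OF n, of _ "d - 1"] unfolding dk by blast
  qed
  let ?bs = "map ?p (unit_vecs ?m)" and ?cs = "map T (unit_vecs ?m)"
  have len: "length ?bs = ?m" "length ?cs = ?m" by (simp_all add: unit_vecs_def)
  have bsj: "?bs ! j = ?p (col (1\<^sub>m ?m) j)" and csj: "?cs ! j = T (col (1\<^sub>m ?m) j)" if "j < ?m" for j
    using that by (simp_all add: unit_vecs_def)
  have "represents (quot_space n d A) ?bs ?cs (mult_lam n d A) W0"
    "represents (quot_space n d A) ?bs ?cs (mult_mu n d A) W1"
    using represents_iff_matrix_equation[OF lin inj len one_carrier_mat bsj one_carrier_mat csj Wc(1) lam]
      represents_iff_matrix_equation[OF lin inj len one_carrier_mat bsj one_carrier_mat csj Wc(2) mu] Wc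
    by simp_all
  then have part1: "\<exists>bs cs. ordered_basis (hom_space n (d - 1)) bs \<and> ordered_basis (quot_space n d A) cs \<and>
      represents (quot_space n d A) bs cs (mult_lam n d A) W0 \<and>
      represents (quot_space n d A) bs cs (mult_mu n d A) W1"
    using linear_bijection_basis(1)[OF plin pinj psurj] linear_bijection_basis(1)[OF lin inj surj] by blast
  have part2: "is_strong_linearization n d (dehom (pencil W0 W1)) (dehom (hom_mat n d A))"
    if reg: "det (hom_mat n d A) \<noteq> 0"
    using is_strong_linearization_annihilator_pencil[OF n d A W Z WA reg W0 W1, of "1\<^sub>m ?m" "1\<^sub>m ?m"] Wc by simp
  have part3: "is_strong_linearization n d (dehom (pencil L0 L1)) (dehom (hom_mat n d A))"
    if reg: "det (hom_mat n d A) \<noteq> 0" and bs: "ordered_basis (hom_space n (d - 1)) bs"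
      and cs: "ordered_basis (quot_space n d A) cs"
      and L0: "represents (quot_space n d A) bs cs (mult_lam n d A) L0"
      and L1: "represents (quot_space n d A) bs cs (mult_mu n d A) L1" for bs cs L0 L1
  proof -
    have lb: "length bs = ?m" by (rule linear_bijection_basis(2)[OF plin pinj psurj bs])
    have lc: "length cs = ?m" by (rule linear_bijection_basis(2)[OF lin inj surj cs])
    obtain P where P: "P \<in> carrier_mat ?m ?m" "det P \<noteq> 0" "\<And>j. j < ?m \<Longrightarrow> bs ! j = ?p (col P j)"
      using basis_coordinate_matrix[OF plin psurj bs lb] by metis
    obtain Q where Q: "Q \<in> carrier_mat ?m ?m" "det Q \<noteq> 0" "\<And>j. j < ?m \<Longrightarrow> cs ! j = T (col Q j)"
      using basis_coordinate_matrix[OF lin surj cs lc] by metis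
    obtain N where N: "N \<in> carrier_mat ?m ?m" "N * Q = 1\<^sub>m ?m" "det N \<noteq> 0"
      using obtain_inverse[OF Q(1,2)] by metis
    (* The same N and P serve both operators, so they act on the pencil as a whole. *)
    have solve: "M = N * U * P" if "M \<in> carrier_mat ?m ?m" "U \<in> carrier_mat ?m ?m" "U * P = Q * M" for M U
    proof -
      have "M = N * Q * M" using that N by simp
      also have "\<dots> = N * (U * P)" unfolding that(3) by (rule assoc_mult_mat[OF N(1) Q(1) that(1)])
      finally show ?thesis using that N P by (simp add: assoc_mult_mat[of _ ?m ?m _ ?m _ ?m])
    qed
    have "L0 = N * W0 * P"
      using L0 represents_iff_matrix_equation[OF lin inj lb lc P(1,3) Q(1,3) Wc(1) lam] solve Wc by blast
    moreover have "L1 = N * W1 * P"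
      using L1 represents_iff_matrix_equation[OF lin inj lb lc P(1,3) Q(1,3) Wc(2) mu] solve Wc by blast
    ultimately show ?thesis
      using is_strong_linearization_annihilator_pencil[OF n d A W Z WA reg W0 W1 N(1,3) P(1,2)] by simp
  qed
  show ?thesis using part1 part2 part3 by blast
qed

end
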